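(* Let $X$ be an affine variety over $K$. Then the map $\varprojlim \pi_\iota : X^{\mathrm{an}} \to \varprojlim \mathrm{Trop}(X,\iota)$ is a homeomorphism of $X^{\mathrm{an}}$ onto $\varprojlim \mathrm{Trop}(X,\iota)$, where the inverse limit (in the category of topological spaces) is taken over all affine embeddings $\iota$ of $X$ and all maps $\mathrm{Trop}(\varphi)$ described below.
   Context: $K$ is an algebraically closed field complete with respect to a nontrivial nonarchimedean valuation $\nu: K^*\to\mathbb{R}$, extended by $\nu(0)=\infty$. Let $\mathbf{R}=\mathbb{R}\cup\{\infty\}$ with the topology in which the rays $(a,\infty]$, $a\in\mathbb{R}$, form a basis of neighborhoods of $\infty$ (so $a\mapsto e^{-a}$ is a homeomorphism $\mathbf{R}\to\mathbb{R}_{\ge 0}$). A multiplicative seminorm on a $K$-algebra $A$ is a monoid map $|\cdot|:A\to\mathbb{R}_{\ge0}$ with $|0|=0$ and $|f+g|\le|f|+|g|$; it is compatible with $\nu$ if $|a|=\exp(-\nu(a))$ for $a\in K$. For an affine variety $X$, the analytification $X^{\mathrm{an}}$ is the set of multiplicative seminorms on $K[X]$ compatible with $\nu$, with the coarsest topology making $x\mapsto|f|_x$ continuous for every $f\in K[X]$. An affine embedding $\iota:X\hookrightarrow\mathbf{A}^m$ is a closed embedding $y\mapsto(f_1(y),\dots,f_m(y))$ for generators $f_1,\dots,f_m$ of the $K$-algebra $K[X]$. For $y\in\mathbf{A}^m(K)$ set $\mathrm{Trop}(y)=(\nu(y_1),\dots,\nu(y_m))\in\mathbf{R}^m$, and let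 $\mathrm{Trop}(X,\iota)\subset\mathbf{R}^m$ be the closure of $\{\mathrm{Trop}(\iota(x)) : x\in X(K)\}$. Define $\pi_\iota:X^{\mathrm{an}}\to\mathbf{R}^m$ by $\pi_\iota(x)=(-\log|f_1|_x,\dots,-\log|f_m|_x)$ with $-\log 0=\infty$. If $\jmath:X\hookrightarrow\mathbf{A}^n$ is another affine embedding and $\varphi:\mathbf{A}^m\to\mathbf{A}^n$ is a morphism equivariant with respect to some group homomorphism from the torus $T^m=(\mathbb{G}_m)^m$ to $T^n$, with $\jmath=\varphi\circ\iota$, then $\mathrm{Trop}(\varphi(y))$ depends only on $\mathrm{Trop}(y)$, giving a continuous map $\mathrm{Trop}(\varphi):\mathbf{R}^m\to\mathbf{R}^n$ which maps $\mathrm{Trop}(X,\iota)$ into $\mathrm{Trop}(X,\jmath)$ and satisfies $\pi_\jmath=\mathrm{Trop}(\varphi)\circ\pi_\iota$. The maps $\pi_\iota$ therefore induce $\varprojlim\pi_\iota$. *)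

theory Defs
  imports "HOL-Analysis.Analysis" "HOL-Computational_Algebra.Polynomial"
begin

definition valuation :: "('k::field \<Rightarrow> ereal) \<Rightarrow> bool" where
  "valuation \<nu> \<longleftrightarrow>
     (\<forall>x. \<nu> x = \<infinity> \<longleftrightarrow> x = 0) \<and> (\<forall>x. \<nu> x \<noteq> -\<infinity>) \<and>
     (\<forall>x y. \<nu> (x * y) = \<nu> x + \<nu> y) \<and>
     (\<forall>x y. min (\<nu> x) (\<nu> y) \<le> \<nu> (x + y))"

definition nontrivial_valuation :: "('k::field \<Rightarrow> ereal) \<Rightarrow> bool" where
  "nontrivial_valuation \<nu> \<longleftrightarrow> (\<exists>x. x \<noteq> 0 \<and> \<nu> x \<noteq> 0)"

definition complete_valuation :: "('k::field \<Rightarrow> ereal) \<Rightarrow> bool" where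
  "complete_valuation \<nu> \<longleftrightarrow>
     (\<forall>s :: nat \<Rightarrow> 'k.
        (\<forall>M::real. \<exists>N. \<forall>m\<ge>N. \<forall>n\<ge>N. ereal M \<le> \<nu> (s m - s n)) \<longrightarrow>
        (\<exists>l. \<forall>M::real. \<exists>N. \<forall>n\<ge>N. ereal M \<le> \<nu> (s n - l)))"

definition alg_closed_field :: "'k::field itself \<Rightarrow> bool" where
  "alg_closed_field _ \<longleftrightarrow> (\<forall>p :: 'k poly. degree p > 0 \<longrightarrow> (\<exists>x. poly p x = 0))"

definition absv :: "('k \<Rightarrow> ereal) \<Rightarrow> 'k \<Rightarrow> real" where
  "absv \<nu> c = (if \<nu> c = \<infinity> then 0 else exp (- real_of_ereal (\<nu> c)))"

definition neglog :: "real \<Rightarrow> ereal" where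
  "neglog r = (if r = 0 then \<infinity> else ereal (- ln r))"

text \<open>R is realised as the subspace of the extended reals without -infinity;
  its order topology has the rays (a,infinity] as neighbourhood basis of infinity.\<close>
definition Rtop :: "ereal topology" where
  "Rtop = subtopology euclidean {x. x \<noteq> -\<infinity>}"

definition Rm :: "nat \<Rightarrow> (nat \<Rightarrow> ereal) topology" where
  "Rm m = product_topology (\<lambda>_. Rtop) {..<m}"

section \<open>The variety X, given by its coordinate ring (a K-algebra that is a domain)\<close>

definition is_ring_hom :: "('k::field \<Rightarrow> 'a::comm_ring_1) \<Rightarrow> bool" where
  "is_ring_hom e \<longleftrightarrow> e 0 = 0 \<and> e 1 = 1 \<and> (\<forall>x y. e (x + y) = e x + e y) \<and>
     (\<forall>x y. e (x * y) = e x * e y)"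

inductive_set gen_subalg :: "('k \<Rightarrow> 'a::comm_ring_1) \<Rightarrow> 'a list \<Rightarrow> 'a set"
  for e :: "'k \<Rightarrow> 'a" and fs :: "'a list" where
  const: "e c \<in> gen_subalg e fs"
| gen: "i < length fs \<Longrightarrow> fs ! i \<in> gen_subalg e fs"
| add: "x \<in> gen_subalg e fs \<Longrightarrow> y \<in> gen_subalg e fs \<Longrightarrow> x + y \<in> gen_subalg e fs"
| mult: "x \<in> gen_subalg e fs \<Longrightarrow> y \<in> gen_subalg e fs \<Longrightarrow> x * y \<in> gen_subalg e fs"

definition affine_embeddings :: "('k \<Rightarrow> 'a::comm_ring_1) \<Rightarrow> 'a list set" where
  "affine_embeddings e = {fs. gen_subalg e fs = UNIV}"

definition Kpoints :: "('k::field \<Rightarrow> 'a::comm_ring_1) \<Rightarrow> ('a \<Rightarrow> 'k) set" where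
  "Kpoints e = {p. (\<forall>c. p (e c) = c) \<and> (\<forall>x y. p (x + y) = p x + p y) \<and>
                   (\<forall>x y. p (x * y) = p x * p y)}"

definition tropv :: "('k \<Rightarrow> ereal) \<Rightarrow> nat \<Rightarrow> (nat \<Rightarrow> 'k) \<Rightarrow> (nat \<Rightarrow> ereal)" where
  "tropv \<nu> m y = (\<lambda>i\<in>{..<m}. \<nu> (y i))"

definition TropX :: "('k::field \<Rightarrow> 'a::comm_ring_1) \<Rightarrow> ('k \<Rightarrow> ereal) \<Rightarrow> 'a list \<Rightarrow> (nat \<Rightarrow> ereal) set" where
  "TropX e \<nu> fs = (Rm (length fs)) closure_of
      ((\<lambda>p. tropv \<nu> (length fs) (\<lambda>i. p (fs ! i))) ` Kpoints e)"

definition Xan :: "('k::field \<Rightarrow> 'a::comm_ring_1) \<Rightarrow> ('k \<Rightarrow> ereal) \<Rightarrow> ('a \<Rightarrow> real) set" where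
  "Xan e \<nu> = {s. (\<forall>f. 0 \<le> s f) \<and> s 0 = 0 \<and> s 1 = 1 \<and>
                 (\<forall>f g. s (f * g) = s f * s g) \<and> (\<forall>f g. s (f + g) \<le> s f + s g) \<and>
                 (\<forall>c. s (e c) = absv \<nu> c)}"

text \<open>Coarsest topology making all evaluations continuous = subspace of the product topology.\<close>
definition Xan_top :: "('k::field \<Rightarrow> 'a::comm_ring_1) \<Rightarrow> ('k \<Rightarrow> ereal) \<Rightarrow> ('a \<Rightarrow> real) topology" where
  "Xan_top e \<nu> = subtopology (product_topology (\<lambda>_. euclideanreal) UNIV) (Xan e \<nu>)"

definition trop_pi :: "'a list \<Rightarrow> ('a \<Rightarrow> real) \<Rightarrow> (nat \<Rightarrow> ereal)" where
  "trop_pi fs s = (\<lambda>i\<in>{..<length fs}. neglog (s (fs ! i)))"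

datatype 'k pexpr = PVar nat | PConst 'k | PAdd "'k pexpr" "'k pexpr" | PMul "'k pexpr" "'k pexpr"

primrec peval :: "('k \<Rightarrow> 'b::comm_ring_1) \<Rightarrow> (nat \<Rightarrow> 'b) \<Rightarrow> 'k pexpr \<Rightarrow> 'b" where
  "peval e v (PVar i) = v i"
| "peval e v (PConst c) = e c"
| "peval e v (PAdd p q) = peval e v p + peval e v q"
| "peval e v (PMul p q) = peval e v p * peval e v q"

primrec pvars :: "'k pexpr \<Rightarrow> nat set" where
  "pvars (PVar i) = {i}"
| "pvars (PConst c) = {}"
| "pvars (PAdd p q) = pvars p \<union> pvars q"
| "pvars (PMul p q) = pvars p \<union> pvars q"

text \<open>phi = (phi_0,...,phi_{n-1}) : A^m -> A^n is a morphism, equivariant with respect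
  to a homomorphism of tori T^m -> T^n (given by characters t |-> prod t_i^(b j i)).\<close>
definition equivariant_morphism :: "nat \<Rightarrow> nat \<Rightarrow> (nat \<Rightarrow> 'k::field pexpr) \<Rightarrow> bool" where
  "equivariant_morphism m n \<phi> \<longleftrightarrow>
     (\<forall>j<n. pvars (\<phi> j) \<subseteq> {..<m}) \<and>
     (\<exists>b :: nat \<Rightarrow> nat \<Rightarrow> int. \<forall>t y. (\<forall>i<m. t i \<noteq> 0) \<longrightarrow>
        (\<forall>j<n. peval id (\<lambda>i. t i * y i) (\<phi> j) =
               (\<Prod>i<m. t i powi b j i) * peval id y (\<phi> j)))"

definition factors_through :: "('k \<Rightarrow> 'a::comm_ring_1) \<Rightarrow> 'a list \<Rightarrow> 'a list \<Rightarrow> (nat \<Rightarrow> 'k pexpr) \<Rightarrow> bool" where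
  "factors_through e \<iota> \<kappa> \<phi> \<longleftrightarrow>
     (\<forall>j<length \<kappa>. \<kappa> ! j = peval e (\<lambda>i. \<iota> ! i) (\<phi> j))"

definition is_trop_map :: "('k::field \<Rightarrow> ereal) \<Rightarrow> nat \<Rightarrow> nat \<Rightarrow> (nat \<Rightarrow> 'k pexpr)
    \<Rightarrow> ((nat \<Rightarrow> ereal) \<Rightarrow> (nat \<Rightarrow> ereal)) \<Rightarrow> bool" where
  "is_trop_map \<nu> m n \<phi> g \<longleftrightarrow> continuous_map (Rm m) (Rm n) g \<and>
     (\<forall>y. g (tropv \<nu> m y) = tropv \<nu> n (\<lambda>j. peval id y (\<phi> j)))"

definition lim_trop_top :: "('k::field \<Rightarrow> 'a::comm_ring_1) \<Rightarrow> ('k \<Rightarrow> ereal)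
    \<Rightarrow> ('a list \<Rightarrow> nat \<Rightarrow> ereal) topology" where
  "lim_trop_top e \<nu> =
     subtopology
       (product_topology (\<lambda>\<iota>. subtopology (Rm (length \<iota>)) (TropX e \<nu> \<iota>)) (affine_embeddings e))
       {z. \<forall>\<iota>\<in>affine_embeddings e. \<forall>\<kappa>\<in>affine_embeddings e. \<forall>\<phi> g.
              equivariant_morphism (length \<iota>) (length \<kappa>) \<phi> \<and> factors_through e \<iota> \<kappa> \<phi> \<and>
              is_trop_map \<nu> (length \<iota>) (length \<kappa>) \<phi> g \<longrightarrow> z \<kappa> = g (z \<iota>)}"

definition lim_pi :: "('k \<Rightarrow> 'a::comm_ring_1) \<Rightarrow> ('a \<Rightarrow> real) \<Rightarrow> ('a list \<Rightarrow> nat \<Rightarrow> ereal)" where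
  "lim_pi e s = (\<lambda>\<iota>\<in>affine_embeddings e. trop_pi \<iota> s)"

end

(*
Everything except the inclusion of the image of X^an in the tropicalizations is formal: an
embedding may be enlarged by any element of K[X], so a point of the limit assigns a value to
every f, and the seminorm axioms are closed conditions which hold at K-points.

The inclusion says that K-points are dense in X^an. After rescaling the generators f_i, and
adjoining b_i / f_i when |f_i| > 0, it suffices to find a K-point with integral coordinates on
a seminormed algebra generated by elements of norm at most 1. The power series in the generators
of seminorm 0 form a proper ideal of a Tate algebra, which has a zero in the unit polydisc by the
affinoid Nullstellensatz: by induction on the number of variables, using Weierstrass division by
an element of the ideal and Nakayama's lemma. The Tate algebra is realised as the uniform closure
of the polynomial functions on the polydisc; by the maximum modulus principle this is the
completion for the Gauss norm, and no formal power series are needed.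
*)

theory Submission
  imports Defs "HOL-Computational_Algebra.Fraction_Field"
begin

text \<open>Density is proved up to a tolerance because the value group is dense in the positive
  reals but may be smaller: the bounds around \<open>s f\<close> are values slightly above and
  slightly below it. The fractions \<open>b_i / f_i\<close> live only in the localisation at the
  elements of nonzero seminorm, so the Nullstellensatz is applied to a seminorm on a subring
  \<open>L\<close> of the fraction field. Its completion is never formed:
  \<open>relation_ideal\<close> describes the kernel of the map from the Tate algebra to it by
  polynomial approximants. The maximum modulus principle makes that map contractive, which keeps 1
  out of the kernel. Weierstrass division requires an element that is nearly monic in the last
  variable. Since the residue field is infinite, a linear shear achieves this: each form attains its
  maximum at a point whose last coordinate is a unit. For the limit, the value attached to a
  function must not depend on the embedding that contains it. Concatenating two embeddings puts the
  function in two positions, and equality of two coordinates is a closed condition.\<close>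

section \<open>Complete algebraically closed nonarchimedean fields\<close>

locale na_field =
  fixes av :: "'k::field \<Rightarrow> real"
  assumes av_nonneg [simp]: "0 \<le> av x"
    and av_eq_0 [simp]: "av x = 0 \<longleftrightarrow> x = 0"
    and av_mult: "av (x * y) = av x * av y"
    and av_add: "av (x + y) \<le> max (av x) (av y)"
    and av_nontrivial: "\<exists>x. 0 < av x \<and> av x < 1"
    and av_complete: "(\<And>\<epsilon>. 0 < \<epsilon> \<Longrightarrow> \<exists>N. \<forall>m\<ge>N. \<forall>n\<ge>N. av (s m - s n) \<le> \<epsilon>) \<Longrightarrow>
           \<exists>l. \<forall>\<epsilon>>0. \<exists>N::nat. \<forall>n\<ge>N. av (s n - l) \<le> \<epsilon>"
    and alg_closed: "degree (p :: 'k poly) > 0 \<Longrightarrow> \<exists>x. poly p x = 0"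
begin

lemma av_0 [simp]: "av 0 = 0"
  by simp

lemma av_pos: "0 < av x \<longleftrightarrow> x \<noteq> 0"
  by (metis av_eq_0 av_nonneg less_eq_real_def less_irrefl)

lemma av_1 [simp]: "av 1 = 1"
  using av_mult[of 1 1] av_eq_0[of 1] by (metis mult.right_neutral mult_cancel_left zero_neq_one)

lemma av_minus_1: "av (- 1) = 1"
proof -
  have "av (-1) * av (-1) = 1" using av_mult[of "-1" "-1"] by simp
  then show ?thesis using av_nonneg[of "-1"]
    by (metis abs_of_nonneg abs_square_eq_1 power2_eq_square)
qed

lemma av_minus [simp]: "av (- x) = av x"
  using av_mult[of "-1" x] av_minus_1 by simp

lemma av_diff: "av (x - y) \<le> max (av x) (av y)"
  using av_add[of x "-y"] by simp

lemma av_diff_commute: "av (x - y) = av (y - x)"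
  using av_minus[of "x - y"] by simp

lemma av_addI: "av x \<le> \<rho> \<Longrightarrow> av y \<le> \<rho> \<Longrightarrow> av (x + y) \<le> \<rho>"
  using av_add[of x y] by linarith

lemma av_diffI: "av x \<le> \<rho> \<Longrightarrow> av y \<le> \<rho> \<Longrightarrow> av (x - y) \<le> \<rho>"
  using av_diff[of x y] by linarith

lemma av_add_lessI: "av x < \<rho> \<Longrightarrow> av y < \<rho> \<Longrightarrow> av (x + y) < \<rho>"
  using av_add[of x y] by linarith

lemma av_diff_lessI: "av x < \<rho> \<Longrightarrow> av y < \<rho> \<Longrightarrow> av (x - y) < \<rho>"
  using av_diff[of x y] by linarith

lemma av_multI: "av x \<le> \<rho> \<Longrightarrow> av y \<le> \<sigma> \<Longrightarrow> av (x * y) \<le> \<rho> * \<sigma>"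
  unfolding av_mult by (intro mult_mono) (auto intro: order_trans[OF av_nonneg])

lemma av_mult_le1I: "av x \<le> \<rho> \<Longrightarrow> av y \<le> 1 \<Longrightarrow> av (x * y) \<le> \<rho>"
  using av_multI[of x \<rho> y 1] by simp

lemma av_power: "av (x ^ n) = av x ^ n"
  by (induction n) (simp_all add: av_mult)

lemma av_power_le1: "av x \<le> 1 \<Longrightarrow> av (x ^ n) \<le> 1"
  by (simp add: av_power power_le_one)

lemma av_divide: "av (x / y) = av x / av y"
proof (cases "y = 0")
  case False
  then have "av x = av (x / y) * av y" by (simp flip: av_mult)
  then show ?thesis using False by (simp add: field_simps)
qed simp

lemma av_prod: "av (prod f S) = (\<Prod>i\<in>S. av (f i))"
  by (induction S rule: infinite_finite_induct) (simp_all add: av_mult)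

lemma av_sumI: "0 \<le> \<rho> \<Longrightarrow> (\<And>i. i \<in> S \<Longrightarrow> av (f i) \<le> \<rho>) \<Longrightarrow> av (sum f S) \<le> \<rho>"
  by (induction S rule: infinite_finite_induct) (auto intro: av_addI)

lemma av_add_eq: "av y < av x \<Longrightarrow> av (x + y) = av x"
  using av_add[of x y] av_diff[of "x + y" y] by (simp add: max_def split: if_splits)

lemma av_eq_of_close: "av (x - y) < av x \<Longrightarrow> av y = av x"
  using av_add_eq[of "y - x" x] av_diff_commute[of x y] by simp

lemma eq_if_av_small: "(\<And>\<epsilon>. 0 < \<epsilon> \<Longrightarrow> av (x - y) \<le> \<epsilon>) \<Longrightarrow> x = y"
  by (metis av_pos eq_iff_diff_eq_0 field_lbound_gt_zero linorder_not_le)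

lemma av_limit_le:
  assumes "\<forall>\<epsilon>>0. \<exists>N::nat. \<forall>n\<ge>N. av (s n - l) \<le> \<epsilon>" and "\<And>n. n \<ge> k \<Longrightarrow> av (s n - a) \<le> \<rho>" and "0 < \<rho>"
  shows "av (l - a) \<le> \<rho>"
proof -
  obtain N where N: "\<forall>n\<ge>N. av (s n - l) \<le> \<rho>" using assms by blast
  have "av ((s (max N k) - a) - (s (max N k) - l)) \<le> \<rho>"
    using N assms(2)[of "max N k"] by (intro av_diffI[of "s (max N k) - a"]) auto
  then show ?thesis by simp
qed

section \<open>Polynomials in one variable\<close>

text \<open>A root of \<open>(\<Prod>c\<in>S'. X - c) = 1\<close> does it: at \<open>z\<close> all
  factors have absolute value at most 1 while their product has absolute value 1. This is the
  infinity of the residue field, without introducing that field.\<close>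

lemma exists_unit_avoiding:
  assumes "finite S" and "\<And>c. c \<in> S \<Longrightarrow> av c \<le> 1"
  shows "\<exists>z. av z = 1 \<and> (\<forall>c\<in>S. av (z - c) = 1)"
proof -
  \<comment> \<open>Adding 0 makes the polynomial nonconstant even for empty \<open>S\<close> and
    yields \<open>av z = 1\<close> as one more avoided class.\<close>
  define S' where "S' = insert 0 S"
  have fin: "finite S'" and le: "\<And>c. c \<in> S' \<Longrightarrow> av c \<le> 1"
    using assms by (auto simp: S'_def)
  define p where "p = (\<Prod>c\<in>S'. [:-c, 1:])"
  have "degree p = card S'"
    unfolding p_def by (subst degree_prod_eq_sum_degree) auto
  then have dp: "degree p > 0" using fin by (auto simp: S'_def card_gt_0_iff)
  then have "degree (p - 1) > 0"
    using degree_add_eq_left[of "-1" p] by simp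
  then obtain z where "poly (p - 1) z = 0" using alg_closed by blast
  then have z1: "(\<Prod>c\<in>S'. z - c) = 1"
    by (simp add: p_def poly_prod)
  then have pr: "(\<Prod>c\<in>S'. av (z - c)) = 1"
    by (metis av_1 av_prod)
  have "av z \<le> 1"
  proof (rule ccontr)
    assume "\<not> av z \<le> 1"
    then have "av (z - c) > 1" if "c \<in> S'" for c
      using le[OF that] av_add_eq[of "-c" z] by simp
    then have "(\<Prod>c\<in>S'. av (z - c)) > 1"
      using fin by (intro less_1_prod) (auto simp: S'_def)
    then show False using pr by simp
  qed
  then have le1: "av (z - c) \<le> 1" if "c \<in> S'" for c
    using le[OF that] av_diffI by blast
  have "av (z - c) = 1" if "c \<in> S'" for c
  proof -
    have "(\<Prod>c\<in>S'. av (z - c)) = av (z - c) * (\<Prod>c\<in>S' - {c}. av (z - c))"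
      using fin that by (rule prod.remove)
    moreover have "(\<Prod>c\<in>S' - {c}. av (z - c)) \<le> 1"
      using le1 by (intro prod_le_1) auto
    ultimately have "1 \<le> av (z - c)"
      using pr by (metis av_nonneg mult_left_le)
    then show ?thesis using le1[OF that] by simp
  qed
  from this this[of 0] show ?thesis by (intro exI[of _ z]) (auto simp: S'_def)
qed

text \<open>Excluding finitely many residue classes keeps the difference quotient
  \<^term>\<open>synthetic_div p z\<close> bounded at the remaining points.\<close>
lemma coeff_less:
  assumes "finite S" and "\<And>c. c \<in> S \<Longrightarrow> av c \<le> 1" and "0 < \<rho>"
    and "\<And>z. av z = 1 \<Longrightarrow> (\<forall>c\<in>S. av (z - c) = 1) \<Longrightarrow> av (poly p z) < \<rho>"
  shows "av (coeff p j) < \<rho>"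
  using assms
proof (induction "degree p" arbitrary: p S j rule: less_induct)
  case less
  obtain z0 where z0: "av z0 = 1" "\<forall>c\<in>S. av (z0 - c) = 1"
    using exists_unit_avoiding less.prems(1,2) by blast
  then have pz0: "av (poly p z0) < \<rho>" using less.prems(4) by blast
  show ?case
  proof (cases "degree p = 0")
    case True
    then obtain c where "p = [:c:]" by (auto elim: degree_eq_zeroE)
    then show ?thesis using pz0 less.prems(3) by (cases j) auto
  next
    case False
    define q where "q = synthetic_div p z0"
    have pq: "p = [:-z0, 1:] * q + [:poly p z0:]"
      unfolding q_def by (rule synthetic_div_correct'[symmetric])
    have dq: "degree q < degree p"
      unfolding q_def using False by (simp add: degree_synthetic_div)
    have q: "av (coeff q j) < \<rho>" for j
    proof (rule less.hyps[OF dq, of "insert z0 S"])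
      fix z assume z: "av z = 1" "\<forall>c\<in>insert z0 S. av (z - c) = 1"
      have "(z - z0) * poly q z = poly p z - poly p z0"
        by (subst pq) (simp add: algebra_simps)
      then have "av (poly q z) = av (poly p z - poly p z0)"
        using z av_mult[of "z - z0" "poly q z"] by simp
      also have "\<dots> < \<rho>"
        using pz0 less.prems(4)[of z] z by (intro av_diff_lessI) auto
      finally show "av (poly q z) < \<rho>" .
    qed (use less.prems z0 in auto)
    have "av (- z0 * coeff q j) < \<rho>" using q z0 by (simp add: av_mult)
    moreover have "av (coeff (pCons 0 q) j) < \<rho>"
      using q less.prems(3) by (cases j) auto
    moreover have "av (coeff [:poly p z0:] j) < \<rho>"
      using pz0 less.prems(3) by (cases j) auto
    moreover have "coeff p j = (- z0 * coeff q j + coeff (pCons 0 q) j) + coeff [:poly p z0:] j"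
      by (subst pq) (simp add: coeff_add)
    ultimately show ?thesis by (metis av_add_lessI)
  qed
qed

text \<open>The Gauss norm of a polynomial is attained at a unit. If the largest coefficient
  exceeded the value at every unit, \<open>coeff_less\<close> with nothing excluded would push every
  coefficient strictly below the largest one.\<close>

lemma exists_unit_max:
  "\<exists>z. av z = 1 \<and> (\<forall>j<d. av (a j) \<le> av (\<Sum>j<d. a j * z ^ j))"
proof (rule ccontr)
  assume neg: "\<not> ?thesis"
  then have d: "d > 0" by (metis av_1 not_less_zero gr0I)
  define p where "p = (\<Sum>j<d. monom (a j) j)"
  have cp: "coeff p j = a j" if "j < d" for j
    using that by (simp add: p_def coeff_sum sum.delta)
  have pp: "poly p z = (\<Sum>j<d. a j * z ^ j)" for z
    by (simp add: p_def poly_sum poly_monom)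
  define \<rho> where "\<rho> = Max ((\<lambda>j. av (a j)) ` {..<d})"
  have le: "av (a j) \<le> \<rho>" if "j < d" for j
    unfolding \<rho>_def using that by (intro Max_ge) auto
  have less: "av (poly p z) < \<rho>" if "av z = 1" for z
    using neg that le pp by (metis linorder_not_le order.strict_trans2)
  have "0 < \<rho>" using less[of 1] av_nonneg[of "poly p 1"] by (simp only: av_1) linarith
  then have "av (coeff p j) < \<rho>" for j
    using less by (intro coeff_less[of "{}"]) auto
  moreover have "\<rho> \<in> (\<lambda>j. av (a j)) ` {..<d}"
    unfolding \<rho>_def using d by (intro Max_in) auto
  ultimately show False using cp by (metis imageE lessThan_iff less_irrefl)
qed

lemma coeff_bound:
  assumes "\<And>z. av z = 1 \<Longrightarrow> av (\<Sum>j<d. a j * z ^ j) \<le> \<rho>" and "j < d"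
  shows "av (a j) \<le> \<rho>"
  using exists_unit_max[of d a] assms by force

text \<open>An \<open>n\<close>-th root \<open>x\<close> of an element \<open>p\<close> with
  \<open>0 < av p < 1\<close> has logarithmic size \<open>- h\<close> with
  \<open>h = \<theta> / n\<close>. For large \<open>n\<close> this step is finer than the interval,
  so an integer power of \<open>x\<close> lands inside.\<close>

lemma value_dense:
  assumes "0 < r" and "r < r'"
  shows "\<exists>a. r < av a \<and> av a < r'"
proof -
  obtain p where p: "0 < av p" "av p < 1" using av_nontrivial by blast
  define \<theta> where "\<theta> = - ln (av p)"
  have \<theta>: "\<theta> > 0" using p by (simp add: \<theta>_def)
  define w where "w = ln r' - ln r"
  have w: "w > 0" using assms by (simp add: w_def)
  obtain n :: nat where n: "\<theta> / w < real n" using reals_Archimedean2 by blast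
  then have n0: "n > 0" using \<theta> w by (metis divide_pos_pos gr0I less_trans of_nat_0 less_irrefl)
  have "degree (monom 1 n - [:p:]) > 0"
    using degree_add_eq_left[of "-[:p:]" "monom 1 n"] n0
    by (simp add: degree_monom_eq del: minus_pCons)
  then obtain x where "poly (monom 1 n - [:p:]) x = 0" using alg_closed by blast
  then have x: "x ^ n = p" by (simp add: poly_monom)
  then have x0: "x \<noteq> 0" using p n0 by (auto simp: power_0_left)
  have "ln (av x) * real n = - \<theta>"
    using x x0 unfolding \<theta>_def by (simp add: av_power av_pos ln_realpow flip: x)
  then have lx: "ln (av x) = - \<theta> / real n" using n0 by (simp add: field_simps)
  define h where "h = \<theta> / real n"
  have h: "0 < h" "h < w" using \<theta> n n0 w by (auto simp: h_def field_simps)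
  \<comment> \<open>The least integer with \<open>k * h > ln r\<close>; then
    \<open>k * h \<le> ln r + h < ln r'\<close>.\<close>
  define k where "k = \<lfloor>ln r / h\<rfloor> + 1"
  have k: "ln r < of_int k * h" "of_int k * h \<le> ln r + h"
  proof -
    have "ln r / h < of_int k" "of_int k \<le> ln r / h + 1" unfolding k_def by linarith+
    then show "ln r < of_int k * h" "of_int k * h \<le> ln r + h" using h by (auto simp: field_simps)
  qed
  define a where "a = (if k \<ge> 0 then 1 / x ^ nat k else x ^ nat (- k))"
  have a0: "a \<noteq> 0" using x0 by (simp add: a_def)
  have "ln (av a) = of_int k * h"
    using x0 by (auto simp: a_def av_divide av_power ln_div ln_realpow av_pos lx h_def)
  then have "ln r < ln (av a)" "ln (av a) < ln r'"
    using k h w_def by auto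
  then show ?thesis using assms a0 by (intro exI[of _ a]) (simp add: av_pos)
qed

end

section \<open>Polynomial functions and their values in an algebra\<close>

inductive_set polyfun :: "nat \<Rightarrow> ((nat \<Rightarrow> 'k::comm_ring_1) \<Rightarrow> 'k) set" for M where
  const: "(\<lambda>_. c) \<in> polyfun M"
| var: "i < M \<Longrightarrow> (\<lambda>x. x i) \<in> polyfun M"
| add: "\<phi> \<in> polyfun M \<Longrightarrow> \<psi> \<in> polyfun M \<Longrightarrow> (\<lambda>x. \<phi> x + \<psi> x) \<in> polyfun M"
| mult: "\<phi> \<in> polyfun M \<Longrightarrow> \<psi> \<in> polyfun M \<Longrightarrow> (\<lambda>x. \<phi> x * \<psi> x) \<in> polyfun M"

text \<open>Pairs of a polynomial function and the value of the same polynomial at the point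
  \<^term>\<open>g\<close> of an algebra; this replaces formal multivariate polynomials.\<close>
inductive_set polyrel ::
  "('k::comm_ring_1 \<Rightarrow> 'b::comm_ring_1) \<Rightarrow> (nat \<Rightarrow> 'b) \<Rightarrow> nat \<Rightarrow> (((nat \<Rightarrow> 'k) \<Rightarrow> 'k) \<times> 'b) set"
  for e g M where
  const: "(\<lambda>_. c, e c) \<in> polyrel e g M"
| var: "i < M \<Longrightarrow> (\<lambda>x. x i, g i) \<in> polyrel e g M"
| add: "(\<phi>, u) \<in> polyrel e g M \<Longrightarrow> (\<psi>, v) \<in> polyrel e g M \<Longrightarrow> (\<lambda>x. \<phi> x + \<psi> x, u + v) \<in> polyrel e g M"
| mult: "(\<phi>, u) \<in> polyrel e g M \<Longrightarrow> (\<psi>, v) \<in> polyrel e g M \<Longrightarrow> (\<lambda>x. \<phi> x * \<psi> x, u * v) \<in> polyrel e g M"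

lemma polyfun_if_polyrel: "(\<phi>, u) \<in> polyrel e g M \<Longrightarrow> \<phi> \<in> polyfun M"
  by (induction rule: polyrel.induct) (auto intro: polyfun.intros)

lemma polyrel_if_polyfun: "\<phi> \<in> polyfun M \<Longrightarrow> \<exists>u. (\<phi>, u) \<in> polyrel e g M"
  by (induction rule: polyfun.induct) (blast intro: polyrel.intros)+

lemma polyfun_mono: "\<phi> \<in> polyfun M \<Longrightarrow> M \<le> M' \<Longrightarrow> \<phi> \<in> polyfun M'"
  by (induction rule: polyfun.induct) (auto intro: polyfun.intros)

lemma polyfun_cong: "\<phi> \<in> polyfun M \<Longrightarrow> (\<And>i. i < M \<Longrightarrow> x i = y i) \<Longrightarrow> \<phi> x = \<phi> y"
  by (induction rule: polyfun.induct) auto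

lemma polyfun_uminus: "\<phi> \<in> polyfun M \<Longrightarrow> (\<lambda>x. - \<phi> x) \<in> polyfun M"
  using polyfun.mult[OF polyfun.const[of "-1"], of \<phi> M] by simp

lemma polyfun_power: "\<phi> \<in> polyfun M \<Longrightarrow> (\<lambda>x. \<phi> x ^ n) \<in> polyfun M"
  by (induction n) (auto intro: polyfun.intros polyfun.const)

lemma polyfun_compose:
  "\<phi> \<in> polyfun M \<Longrightarrow> (\<And>i. i < M \<Longrightarrow> (\<lambda>x. \<sigma> x i) \<in> polyfun M') \<Longrightarrow> (\<lambda>x. \<phi> (\<sigma> x)) \<in> polyfun M'"
  by (induction rule: polyfun.induct) (auto intro: polyfun.intros)

section \<open>Expansion in the last variable\<close>

text \<open>Peeling off one coefficient at a time lets sums and products be formed by structural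
  induction; a coefficient sequence with a degree bound appears only in
  \<open>horner_imp_sum\<close>. Function and algebra element are expanded together so that
  corresponding coefficients stay paired.\<close>

inductive_set horner ::
  "('k::comm_ring_1 \<Rightarrow> 'b::comm_ring_1) \<Rightarrow> (nat \<Rightarrow> 'b) \<Rightarrow> nat \<Rightarrow> (((nat \<Rightarrow> 'k) \<Rightarrow> 'k) \<times> 'b) set"
  for e g M where
  base: "(\<lambda>_. 0, 0) \<in> horner e g M"
| step: "(\<phi>, u) \<in> polyrel e g M \<Longrightarrow> (\<psi>, v) \<in> horner e g M \<Longrightarrow>
         (\<lambda>x. \<phi> x + x M * \<psi> x, u + g M * v) \<in> horner e g M"

context
  fixes e :: "'k::comm_ring_1 \<Rightarrow> 'b::comm_ring_1" and g :: "nat \<Rightarrow> 'b" and M :: nat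
  assumes e0: "e 0 = 0" and e1: "e 1 = 1"
begin

lemma horner_polyrel: "(\<phi>, u) \<in> polyrel e g M \<Longrightarrow> (\<phi>, u) \<in> horner e g M"
  using horner.step[OF _ horner.base] by fastforce

lemma horner_var: "(\<phi>, u) \<in> horner e g M \<Longrightarrow> (\<lambda>x. x M * \<phi> x, g M * u) \<in> horner e g M"
  using horner.step[OF polyrel.const[of 0]] e0 by fastforce

lemma horner_add:
  assumes "(\<phi>, u) \<in> horner e g M" and "(\<psi>, v) \<in> horner e g M"
  shows "(\<lambda>x. \<phi> x + \<psi> x, u + v) \<in> horner e g M"
  using assms
proof (induction arbitrary: \<psi> v rule: horner.induct)
  case base
  then show ?case by simp
next
  case (step \<phi> u \<phi>' u')
  from step.prems show ?case
  proof cases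
    case base
    then show ?thesis using horner.step[OF step.hyps(1,2)] by simp
  next
    case (step \<chi> w \<chi>' w')
    from horner.step[OF polyrel.add[OF \<open>(\<phi>, u) \<in> _\<close> step(3)] local.step.IH[OF step(4)]]
    show ?thesis unfolding step by (simp add: algebra_simps)
  qed
qed

lemma horner_scale:
  assumes "(\<psi>, v) \<in> horner e g M" and "(\<phi>, u) \<in> polyrel e g M"
  shows "(\<lambda>x. \<phi> x * \<psi> x, u * v) \<in> horner e g M"
  using assms(1)
proof (induction rule: horner.induct)
  case base
  then show ?case by (simp add: horner.base)
next
  case (step \<chi> w \<chi>' w')
  from horner.step[OF polyrel.mult[OF assms(2) step.hyps(1)] step.IH]
  show ?case by (simp add: algebra_simps)
qed

lemma horner_mult:
  assumes "(\<phi>, u) \<in> horner e g M" and "(\<psi>, v) \<in> horner e g M"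
  shows "(\<lambda>x. \<phi> x * \<psi> x, u * v) \<in> horner e g M"
  using assms(1)
proof (induction rule: horner.induct)
  case base
  then show ?case by (simp add: horner.base)
next
  case (step \<chi> w \<chi>' w')
  from horner_add[OF horner_scale[OF assms(2) step.hyps(1)] horner_var[OF step.IH]]
  show ?case by (simp add: algebra_simps)
qed

lemma horner_if_polyrel:
  "(\<phi>, u) \<in> polyrel e g (Suc M) \<Longrightarrow> (\<phi>, u) \<in> horner e g M"
proof (induction rule: polyrel.induct)
  case (const c)
  show ?case by (intro horner_polyrel polyrel.const)
next
  case (var i)
  show ?case
  proof (cases "i = M")
    case True
    have "(\<lambda>x. x M * (1 + x M * 0), g M * (e 1 + g M * 0)) \<in> horner e g M"
      by (intro horner_var horner.step polyrel.const horner.base)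
    then show ?thesis using True e1 by simp
  next
    case False
    then show ?thesis using var by (intro horner_polyrel polyrel.var) auto
  qed
qed (blast intro: horner_add horner_mult)+


lemma horner_imp_sum:
  "(\<phi>, u) \<in> horner e g M \<Longrightarrow> \<exists>N r t. (\<forall>j<N. (r j, t j) \<in> polyrel e g M) \<and>
     \<phi> = (\<lambda>x. \<Sum>j<N. r j x * x M ^ j) \<and> u = (\<Sum>j<N. t j * g M ^ j)"
proof (induction rule: horner.induct)
  case base
  show ?case by (rule exI[of _ 0]) simp
next
  case (step \<phi> u \<psi> v)
  then obtain N r t where *: "\<forall>j<N. (r j, t j) \<in> polyrel e g M"
    "\<psi> = (\<lambda>x. \<Sum>j<N. r j x * x M ^ j)" "v = (\<Sum>j<N. t j * g M ^ j)" by blast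
  show ?case
    by (rule exI[of _ "Suc N"], rule exI[of _ "case_nat \<phi> r"], rule exI[of _ "case_nat u t"])
      (use * step.hyps(1) in \<open>auto simp: sum.lessThan_Suc_shift sum_distrib_left algebra_simps
        simp del: sum.lessThan_Suc split: nat.splits\<close>)
qed

lemma polyrel_Suc_expand:
  "(\<phi>, u) \<in> polyrel e g (Suc M) \<Longrightarrow> \<exists>N r t. (\<forall>j<N. (r j, t j) \<in> polyrel e g M) \<and>
     \<phi> = (\<lambda>x. \<Sum>j<N. r j x * x M ^ j) \<and> u = (\<Sum>j<N. t j * g M ^ j)"
  by (intro horner_imp_sum horner_if_polyrel)

end

lemma polyfun_Suc_expand:
  fixes \<phi> :: "(nat \<Rightarrow> 'k::comm_ring_1) \<Rightarrow> 'k"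
  assumes "\<phi> \<in> polyfun (Suc M)"
  obtains N r where "\<And>j. j < N \<Longrightarrow> r j \<in> polyfun M" and "\<phi> = (\<lambda>x. \<Sum>j<N. r j x * x M ^ j)"
proof -
  \<comment> \<open>Taking the field itself as the algebra turns the paired expansion into one of
    functions.\<close>
  obtain u :: 'k where "(\<phi>, u) \<in> polyrel (\<lambda>c. c) (\<lambda>_. 0) (Suc M)"
    using polyrel_if_polyfun[OF assms] by blast
  from polyrel_Suc_expand[OF _ _ this] show ?thesis
    using that by (metis polyfun_if_polyrel)
qed

lemma polyfun_upd: "\<phi> \<in> polyfun M \<Longrightarrow> M \<le> i \<Longrightarrow> \<phi> (x(i := z)) = \<phi> x"
  by (erule polyfun_cong) auto

section \<open>The Tate algebra as uniform closure of the polynomial functions on the polydisc\<close>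

context na_field
begin

definition polydisc :: "(nat \<Rightarrow> 'k) set" where
  "polydisc = {x. \<forall>i. av (x i) \<le> 1}"

definition tate :: "nat \<Rightarrow> ((nat \<Rightarrow> 'k) \<Rightarrow> 'k) set" where
  "tate M = {F. \<forall>\<epsilon>>0. \<exists>\<phi>\<in>polyfun M. \<forall>x\<in>polydisc. av (F x - \<phi> x) \<le> \<epsilon>}"

lemma polydiscD: "x \<in> polydisc \<Longrightarrow> av (x i) \<le> 1"
  by (simp add: polydisc_def)

lemma polydisc_upd: "x \<in> polydisc \<Longrightarrow> av z \<le> 1 \<Longrightarrow> x(i := z) \<in> polydisc"
  by (simp add: polydisc_def)

lemma zero_in_polydisc: "(\<lambda>_. 0) \<in> polydisc"
  by (simp add: polydisc_def)

lemma tateD: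
  assumes "F \<in> tate M" and "0 < \<epsilon>"
  obtains \<phi> where "\<phi> \<in> polyfun M" and "\<And>x. x \<in> polydisc \<Longrightarrow> av (F x - \<phi> x) \<le> \<epsilon>"
  using assms unfolding tate_def by blast

lemma tateI:
  "(\<And>\<epsilon>. 0 < \<epsilon> \<Longrightarrow> \<exists>\<phi>\<in>polyfun M. \<forall>x\<in>polydisc. av (F x - \<phi> x) \<le> \<epsilon>) \<Longrightarrow> F \<in> tate M"
  unfolding tate_def by blast

lemma polyfun_bounded: "\<phi> \<in> polyfun M \<Longrightarrow> \<exists>B>0. \<forall>x\<in>polydisc. av (\<phi> x) \<le> B"
proof (induction rule: polyfun.induct)
  case (const c)
  show ?case by (rule exI[of _ "av c + 1"]) (simp add: add_nonneg_pos)
next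
  case (var i)
  show ?case by (rule exI[of _ 1]) (simp add: polydiscD)
next
  case (add \<phi> \<psi>)
  then obtain B C where "B > 0" "\<forall>x\<in>polydisc. av (\<phi> x) \<le> B" "C > 0" "\<forall>x\<in>polydisc. av (\<psi> x) \<le> C"
    by blast
  then show ?case
    by (intro exI[of _ "max B C"]) (fastforce intro: av_addI order_trans[OF _ max.cobounded1] order_trans[OF _ max.cobounded2])
next
  case (mult \<phi> \<psi>)
  then obtain B C where "B > 0" "\<forall>x\<in>polydisc. av (\<phi> x) \<le> B" "C > 0" "\<forall>x\<in>polydisc. av (\<psi> x) \<le> C"
    by blast
  then show ?case
    by (intro exI[of _ "B * C"]) (auto intro!: av_multI)
qed

lemma tate_bounded: 
  assumes "F \<in> tate M"
  obtains B where "0 < B" and "\<And>x. x \<in> polydisc \<Longrightarrow> av (F x) \<le> B"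
proof -
  obtain \<phi> where \<phi>: "\<phi> \<in> polyfun M" "\<And>x. x \<in> polydisc \<Longrightarrow> av (F x - \<phi> x) \<le> 1"
    using tateD[OF assms, of 1] by auto
  obtain B where "B > 0" "\<forall>x\<in>polydisc. av (\<phi> x) \<le> B" using polyfun_bounded[OF \<phi>(1)] by blast
  then have "av (F x) \<le> max 1 B" if "x \<in> polydisc" for x
    using av_add[of "F x - \<phi> x" "\<phi> x"] \<phi>(2)[OF that] that by fastforce
  then show ?thesis using that[of "max 1 B"] by simp
qed

lemma tate_polyfun: "\<phi> \<in> polyfun M \<Longrightarrow> \<phi> \<in> tate M"
  by (intro tateI) (auto intro!: bexI[of _ \<phi>])

lemma tate_const: "(\<lambda>_. c) \<in> tate M"
  by (intro tate_polyfun polyfun.const)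

lemma tate_var: "i < M \<Longrightarrow> (\<lambda>x. x i) \<in> tate M"
  by (intro tate_polyfun polyfun.var)

lemma tate_Suc: "F \<in> tate M \<Longrightarrow> F \<in> tate (Suc M)"
  by (rule tateI) (meson tateD polyfun_mono le_SucI order_refl)

lemma tate_add:
  assumes "F \<in> tate M" and "G \<in> tate M"
  shows "(\<lambda>x. F x + G x) \<in> tate M"
proof (rule tateI)
  fix \<epsilon> :: real assume "0 < \<epsilon>"
  obtain \<phi> where \<phi>: "\<phi> \<in> polyfun M" "\<And>x. x \<in> polydisc \<Longrightarrow> av (F x - \<phi> x) \<le> \<epsilon>"
    using tateD[OF assms(1) \<open>0 < \<epsilon>\<close>] by blast
  obtain \<psi> where \<psi>: "\<psi> \<in> polyfun M" "\<And>x. x \<in> polydisc \<Longrightarrow> av (G x - \<psi> x) \<le> \<epsilon>"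
    using tateD[OF assms(2) \<open>0 < \<epsilon>\<close>] by blast
  have "av (F x + G x - (\<phi> x + \<psi> x)) \<le> \<epsilon>" if "x \<in> polydisc" for x
    using av_addI[OF \<phi>(2)[OF that] \<psi>(2)[OF that]] by (simp add: algebra_simps)
  then show "\<exists>\<phi>\<in>polyfun M. \<forall>x\<in>polydisc. av (F x + G x - \<phi> x) \<le> \<epsilon>"
    using polyfun.add[OF \<phi>(1) \<psi>(1)] by (intro bexI[of _ "\<lambda>x. \<phi> x + \<psi> x"]) auto
qed

lemma tate_mult:
  assumes "F \<in> tate M" and "G \<in> tate M"
  shows "(\<lambda>x. F x * G x) \<in> tate M"
proof (rule tateI)
  fix \<epsilon> :: real assume "0 < \<epsilon>"
  obtain B where B: "0 < B" "\<And>x. x \<in> polydisc \<Longrightarrow> av (F x) \<le> B" using tate_bounded[OF assms(1)] by blast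
  \<comment> \<open>The splitting
    \<open>F G - \<phi> \<psi> = F (G - \<psi>) + (F - \<phi>) \<psi>\<close> dictates the order:
    \<open>\<psi>\<close> from the bound \<open>B\<close> of \<open>F\<close>, then the bound
    \<open>C\<close> of \<open>\<psi>\<close>, then \<open>\<phi>\<close>.\<close>
  obtain \<psi> where \<psi>: "\<psi> \<in> polyfun M" "\<And>x. x \<in> polydisc \<Longrightarrow> av (G x - \<psi> x) \<le> \<epsilon> / B"
    using tateD[OF assms(2)] \<open>0 < \<epsilon>\<close> B(1) by (metis divide_pos_pos)
  obtain C where C: "0 < C" "\<forall>x\<in>polydisc. av (\<psi> x) \<le> C" using polyfun_bounded[OF \<psi>(1)] by blast
  obtain \<phi> where \<phi>: "\<phi> \<in> polyfun M" "\<And>x. x \<in> polydisc \<Longrightarrow> av (F x - \<phi> x) \<le> \<epsilon> / C"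
    using tateD[OF assms(1)] \<open>0 < \<epsilon>\<close> C(1) by (metis divide_pos_pos)
  have "av (F x * G x - \<phi> x * \<psi> x) \<le> \<epsilon>" if x: "x \<in> polydisc" for x
  proof -
    have "av (F x * (G x - \<psi> x)) \<le> \<epsilon>"
      using av_multI[OF B(2)[OF x] \<psi>(2)[OF x]] B(1) by simp
    moreover have "av ((F x - \<phi> x) * \<psi> x) \<le> \<epsilon>"
      using av_multI[OF \<phi>(2)[OF x], of "\<psi> x" C] C x by simp
    ultimately show ?thesis using av_addI by (fastforce simp: algebra_simps)
  qed
  then show "\<exists>\<phi>\<in>polyfun M. \<forall>x\<in>polydisc. av (F x * G x - \<phi> x) \<le> \<epsilon>"
    using polyfun.mult[OF \<phi>(1) \<psi>(1)] by (intro bexI[of _ "\<lambda>x. \<phi> x * \<psi> x"]) auto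
qed

lemma tate_uminus: "F \<in> tate M \<Longrightarrow> (\<lambda>x. - F x) \<in> tate M"
  using tate_mult[OF tate_const[of "-1"]] by fastforce

lemma tate_diff: "F \<in> tate M \<Longrightarrow> G \<in> tate M \<Longrightarrow> (\<lambda>x. F x - G x) \<in> tate M"
  using tate_add[OF _ tate_uminus] by fastforce

lemma tate_cmult: "F \<in> tate M \<Longrightarrow> (\<lambda>x. c * F x) \<in> tate M"
  by (intro tate_mult tate_const)

lemma tate_power: "F \<in> tate M \<Longrightarrow> (\<lambda>x. F x ^ n) \<in> tate M"
  by (induction n) (auto intro: tate_mult tate_const)

lemma tate_sum:
  "(\<And>i. i \<in> S \<Longrightarrow> F i \<in> tate M) \<Longrightarrow> (\<lambda>x. \<Sum>i\<in>S. F i x) \<in> tate M"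
  by (induction S rule: infinite_finite_induct) (auto intro: tate_add tate_const)

lemma tate_saturated:
  assumes "F \<in> tate M" and "\<And>x. x \<in> polydisc \<Longrightarrow> G x = F x"
  shows "G \<in> tate M"
  by (rule tateI) (use assms in \<open>metis tateD\<close>)

lemma tate_cong:
  assumes "F \<in> tate M" and "x \<in> polydisc" and "y \<in> polydisc" and "\<And>i. i < M \<Longrightarrow> x i = y i"
  shows "F x = F y"
proof (rule eq_if_av_small)
  fix \<epsilon> :: real assume "0 < \<epsilon>"
  obtain \<phi> where \<phi>: "\<phi> \<in> polyfun M" "\<And>x. x \<in> polydisc \<Longrightarrow> av (F x - \<phi> x) \<le> \<epsilon>"
    using tateD[OF assms(1) \<open>0 < \<epsilon>\<close>] by blast
  have "\<phi> x = \<phi> y" using \<phi>(1) assms(4) by (rule polyfun_cong)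
  then show "av (F x - F y) \<le> \<epsilon>"
    using av_diffI[OF \<phi>(2)[OF assms(2)] \<phi>(2)[OF assms(3)]] by simp
qed

lemma tate_compose:
  assumes "F \<in> tate M" and "\<And>i. i < M \<Longrightarrow> (\<lambda>x. \<sigma> x i) \<in> polyfun M'"
    and "\<And>x. x \<in> polydisc \<Longrightarrow> \<sigma> x \<in> polydisc"
  shows "(\<lambda>x. F (\<sigma> x)) \<in> tate M'"
proof (rule tateI)
  fix \<epsilon> :: real assume "0 < \<epsilon>"
  obtain \<phi> where \<phi>: "\<phi> \<in> polyfun M" "\<And>x. x \<in> polydisc \<Longrightarrow> av (F x - \<phi> x) \<le> \<epsilon>"
    using tateD[OF assms(1) \<open>0 < \<epsilon>\<close>] by blast
  then show "\<exists>\<phi>\<in>polyfun M'. \<forall>x\<in>polydisc. av (F (\<sigma> x) - \<phi> x) \<le> \<epsilon>"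
    using polyfun_compose[OF \<phi>(1) assms(2)] assms(3) by (intro bexI[of _ "\<lambda>x. \<phi> (\<sigma> x)"]) auto
qed

text \<open>Completeness of the field gives a pointwise limit. The tail estimate does not depend on
  \<open>x\<close>, so the limit is uniform and hence again approximable by polynomials. The
  explicit rate is kept for passing to the limit in Weierstrass division.\<close>

lemma tate_series:
  assumes "\<And>n. \<phi> n \<in> tate M" and "0 < \<delta>" and "\<delta> < 1" and "0 < \<rho>"
    and "\<And>n x. x \<in> polydisc \<Longrightarrow> av (\<phi> n x) \<le> \<rho> * \<delta> ^ n"
  obtains F where "F \<in> tate M" and "\<And>N x. x \<in> polydisc \<Longrightarrow> av (F x - (\<Sum>n<N. \<phi> n x)) \<le> \<rho> * \<delta> ^ N"
proof -
  have tail: "av ((\<Sum>n<m. \<phi> n x) - (\<Sum>n<N. \<phi> n x)) \<le> \<rho> * \<delta> ^ N"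
    if "x \<in> polydisc" "N \<le> m" for x N m
  proof -
    have "(\<Sum>n<m. \<phi> n x) - (\<Sum>n<N. \<phi> n x) = (\<Sum>n\<in>{N..<m}. \<phi> n x)"
      using that(2) sum_diff[of "{..<m}" "{..<N}" "\<lambda>n. \<phi> n x"]
      by (simp add: ivl_diff lessThan_atLeast0)
    also have "av \<dots> \<le> \<rho> * \<delta> ^ N"
    proof (rule av_sumI)
      fix n assume "n \<in> {N..<m}"
      then have "\<rho> * \<delta> ^ n \<le> \<rho> * \<delta> ^ N"
        using assms by (intro mult_left_mono power_decreasing) auto
      then show "av (\<phi> n x) \<le> \<rho> * \<delta> ^ N" using assms(5)[OF that(1), of n] by simp
    qed (use assms in auto)
    finally show ?thesis .
  qed
  have "(\<lambda>N. \<rho> * \<delta> ^ N) \<longlonglongrightarrow> \<rho> * 0"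
    using assms by (intro tendsto_mult tendsto_const LIMSEQ_power_zero) auto
  then have small: "\<exists>N. \<rho> * \<delta> ^ N \<le> \<epsilon>" if "0 < \<epsilon>" for \<epsilon>
    using order_tendstoD(2)[of _ "\<rho> * 0" _ \<epsilon>] that
    by (metis (no_types, lifting) eventually_sequentially less_imp_le mult_zero_right order_refl)
  have "\<exists>l. \<forall>\<epsilon>>0. \<exists>N. \<forall>k\<ge>N. av ((\<Sum>n<k. \<phi> n x) - l) \<le> \<epsilon>" if x: "x \<in> polydisc" for x
  proof (rule av_complete)
    fix \<epsilon> :: real assume "0 < \<epsilon>"
    then obtain N where N: "\<rho> * \<delta> ^ N \<le> \<epsilon>" using small by blast
    have "av ((\<Sum>n<k. \<phi> n x) - (\<Sum>n<l. \<phi> n x)) \<le> \<epsilon>" if "k \<ge> N" "l \<ge> N" for k l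
      using av_diffI[OF tail[OF x \<open>k \<ge> N\<close>] tail[OF x \<open>l \<ge> N\<close>]] N by simp
    then show "\<exists>N. \<forall>m\<ge>N. \<forall>k\<ge>N. av ((\<Sum>n<m. \<phi> n x) - (\<Sum>n<k. \<phi> n x)) \<le> \<epsilon>" by blast
  qed
  then obtain F where F: "\<And>x. x \<in> polydisc \<Longrightarrow>
      \<forall>\<epsilon>>0. \<exists>N. \<forall>k\<ge>N. av ((\<Sum>n<k. \<phi> n x) - F x) \<le> \<epsilon>"
    by metis
  have close: "av (F x - (\<Sum>n<N. \<phi> n x)) \<le> \<rho> * \<delta> ^ N" if "x \<in> polydisc" for N x
    using av_limit_le[OF F[OF that], where k = N and a = "\<Sum>n<N. \<phi> n x" and \<rho> = "\<rho> * \<delta> ^ N"] tail[OF that] assms by simp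
  have "F \<in> tate M"
  proof (rule tateI)
    fix \<epsilon> :: real assume \<epsilon>: "0 < \<epsilon>"
    then obtain N where N: "\<rho> * \<delta> ^ N \<le> \<epsilon>" using small by blast
    have "(\<lambda>x. \<Sum>n<N. \<phi> n x) \<in> tate M" using assms(1) by (intro tate_sum)
    then obtain \<psi> where \<psi>: "\<psi> \<in> polyfun M" "\<And>x. x \<in> polydisc \<Longrightarrow> av ((\<Sum>n<N. \<phi> n x) - \<psi> x) \<le> \<epsilon>"
      using tateD[OF _ \<epsilon>] by blast
    have "av (F x - \<psi> x) \<le> \<epsilon>" if "x \<in> polydisc" for x
      using av_addI[OF order_trans[OF close[OF that] N] \<psi>(2)[OF that]] by simp
    then show "\<exists>\<phi>\<in>polyfun M. \<forall>x\<in>polydisc. av (F x - \<phi> x) \<le> \<epsilon>" using \<psi>(1) by blast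
  qed
  then show ?thesis using close that by blast
qed

section \<open>The maximum modulus principle\<close>

text \<open>The coefficients do not involve the coordinate \<open>M\<close>, so it may run through
  all units while the others stay fixed; the one-variable bound then applies.\<close>

lemma polyfun_coeff_bound:
  assumes "\<And>j. j < N \<Longrightarrow> r j \<in> polyfun M"
    and "\<And>x. x \<in> polydisc \<Longrightarrow> av (\<Sum>j<N. r j x * x M ^ j) \<le> \<rho>"
    and "j < N" and "x \<in> polydisc"
  shows "av (r j x) \<le> \<rho>"
proof (rule coeff_bound[where d = N and a = "\<lambda>j. r j x"])
  fix z assume z: "av z = 1"
  have "r j (x(M := z)) = r j x" if "j < N" for j
    using assms(1)[OF that] by (rule polyfun_upd) simp
  then show "av (\<Sum>j<N. r j x * z ^ j) \<le> \<rho>"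
    using assms(2)[OF polydisc_upd[OF assms(4), of z M]] z by simp
qed fact

text \<open>The induction step of the maximum modulus principle, with the induction hypothesis as an
  assumption so that \<open>polyfun_max\<close> and \<open>polyfun_max_unit\<close> share it. The
  unit last coordinate later allows the point to be scaled to last coordinate 1.\<close>

lemma polyfun_max_unit_step:
  assumes IH: "\<And>\<phi>. \<phi> \<in> polyfun M \<Longrightarrow> \<exists>u\<in>polydisc. \<forall>x\<in>polydisc. av (\<phi> x) \<le> av (\<phi> u)"
    and "\<phi> \<in> polyfun (Suc M)"
  shows "\<exists>u\<in>polydisc. av (u M) = 1 \<and> (\<forall>x\<in>polydisc. av (\<phi> x) \<le> av (\<phi> u))"
proof -
  obtain N r where r: "\<And>j. j < N \<Longrightarrow> r j \<in> polyfun M" "\<phi> = (\<lambda>x. \<Sum>j<N. r j x * x M ^ j)"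
    using polyfun_Suc_expand[OF assms(2)] by blast
  show ?thesis
  proof (cases "N = 0")
    case True
    then show ?thesis using r(2) by (intro bexI[of _ "\<lambda>_. 1"]) (auto simp: polydisc_def)
  next
    case False
    have "\<forall>j\<in>{..<N}. \<exists>u\<in>polydisc. \<forall>x\<in>polydisc. av (r j x) \<le> av (r j u)"
      using IH r(1) by blast
    then obtain u where u: "\<And>j. j < N \<Longrightarrow> u j \<in> polydisc"
      "\<And>j x. j < N \<Longrightarrow> x \<in> polydisc \<Longrightarrow> av (r j x) \<le> av (r j (u j))"
      by (metis lessThan_iff)
    define \<rho> where "\<rho> = Max ((\<lambda>j. av (r j (u j))) ` {..<N})"
    have le: "av (r j (u j)) \<le> \<rho>" if "j < N" for j
      unfolding \<rho>_def using that by (intro Max_ge) auto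
    have "\<rho> \<in> (\<lambda>j. av (r j (u j))) ` {..<N}"
      unfolding \<rho>_def using False by (intro Max_in) auto
    \<comment> \<open>The coefficient with the largest maximum decides: at its maximum point
      \<open>u k\<close>, a unit last coordinate from \<open>exists_unit_max\<close> makes the whole
      polynomial at least as large.\<close>
    then obtain k where k: "k < N" "\<rho> = av (r k (u k))" by auto
    obtain z where z: "av z = 1" "\<forall>j<N. av (r j (u k)) \<le> av (\<Sum>j<N. r j (u k) * z ^ j)"
      using exists_unit_max[of N "\<lambda>j. r j (u k)"] by blast
    have "r j ((u k)(M := z)) = r j (u k)" if "j < N" for j
      using r(1)[OF that] by (rule polyfun_upd) simp
    then have "\<rho> \<le> av (\<phi> ((u k)(M := z)))" using z(2) k by (simp add: r(2))
    moreover have "av (\<phi> x) \<le> \<rho>" if "x \<in> polydisc" for x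
      unfolding r(2) using le u(2) that k
      by (intro av_sumI av_mult_le1I av_power_le1) (auto intro: order_trans polydiscD)
    ultimately show ?thesis using z(1) u(1)[OF k(1)]
      by (intro bexI[of _ "(u k)(M := z)"]) (auto intro: polydisc_upd order_trans)
  qed
qed

lemma polyfun_0_const: "\<phi> \<in> polyfun 0 \<Longrightarrow> \<phi> x = \<phi> y"
  by (erule polyfun_cong) auto

lemma polyfun_max: "\<phi> \<in> polyfun M \<Longrightarrow> \<exists>u\<in>polydisc. \<forall>x\<in>polydisc. av (\<phi> x) \<le> av (\<phi> u)"
proof (induction M arbitrary: \<phi>)
  case 0
  then show ?case
    by (intro bexI[OF _ zero_in_polydisc]) (metis polyfun_0_const order_refl)
next
  case (Suc M)
  then show ?case using polyfun_max_unit_step[of M \<phi>] by blast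
qed

lemma polyfun_max_unit:
  "\<phi> \<in> polyfun (Suc M) \<Longrightarrow> \<exists>u\<in>polydisc. av (u M) = 1 \<and> (\<forall>x\<in>polydisc. av (\<phi> x) \<le> av (\<phi> u))"
  using polyfun_max_unit_step polyfun_max by blast

end

section \<open>Leading forms after a linear change of coordinates\<close>

text \<open>The zero function counts as a form of every degree, so that \<open>homsum_graded\<close>
  can provide a component in each degree, also where none occurs.\<close>

inductive homfun :: "nat \<Rightarrow> nat \<Rightarrow> ((nat \<Rightarrow> 'k::comm_ring_1) \<Rightarrow> 'k) \<Rightarrow> bool" for M where
  const: "homfun M 0 (\<lambda>_. c)"
| zero: "homfun M d (\<lambda>_. 0)"
| var: "i < M \<Longrightarrow> homfun M 1 (\<lambda>x. x i)"
| add: "homfun M d \<phi> \<Longrightarrow> homfun M d \<psi> \<Longrightarrow> homfun M d (\<lambda>x. \<phi> x + \<psi> x)"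
| mult: "homfun M d \<phi> \<Longrightarrow> homfun M d' \<psi> \<Longrightarrow> homfun M (d + d') (\<lambda>x. \<phi> x * \<psi> x)"

lemma polyfun_if_homfun: "homfun M d \<phi> \<Longrightarrow> \<phi> \<in> polyfun M"
  by (induction rule: homfun.induct) (auto intro: polyfun.intros)

lemma homfun_scale: "homfun M d \<phi> \<Longrightarrow> \<phi> (\<lambda>i. c * x i) = c ^ d * \<phi> x"
  by (induction rule: homfun.induct) (auto simp: algebra_simps power_add)

inductive homsum :: "nat \<Rightarrow> ((nat \<Rightarrow> 'k::comm_ring_1) \<Rightarrow> 'k) \<Rightarrow> bool" for M where
  hom: "homfun M d \<phi> \<Longrightarrow> homsum M \<phi>"
| add: "homsum M \<phi> \<Longrightarrow> homsum M \<psi> \<Longrightarrow> homsum M (\<lambda>x. \<phi> x + \<psi> x)"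

lemma homsum_mult_homfun:
  "homsum M \<psi> \<Longrightarrow> homfun M d \<phi> \<Longrightarrow> homsum M (\<lambda>x. \<phi> x * \<psi> x)"
  by (induction rule: homsum.induct) (auto simp: distrib_left intro: homsum.intros homfun.mult)

lemma homsum_mult: "homsum M \<phi> \<Longrightarrow> homsum M \<psi> \<Longrightarrow> homsum M (\<lambda>x. \<phi> x * \<psi> x)"
  by (induction rule: homsum.induct)
    (auto simp: distrib_right intro: homsum.intros homsum_mult_homfun)

lemma homsum_if_polyfun: "\<phi> \<in> polyfun M \<Longrightarrow> homsum M \<phi>"
  by (induction rule: polyfun.induct)
    (blast intro: homsum_mult homsum.intros homfun.const homfun.var)+

lemma homsum_graded:
  "homsum M \<phi> \<Longrightarrow> \<exists>N Q. (\<forall>d. homfun M d (Q d)) \<and> (\<forall>d\<ge>N. Q d = (\<lambda>_. 0)) \<and> \<phi> = (\<lambda>x. \<Sum>d<N. Q d x)"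
proof (induction rule: homsum.induct)
  case (hom d \<phi>)
  then show ?case
    by (intro exI[of _ "Suc d"] exI[of _ "\<lambda>i. if i = d then \<phi> else (\<lambda>_. 0)"])
      (auto intro: homfun.zero)
next
  case (add \<phi> \<psi>)
  then obtain N Q N' Q' where Q: "\<forall>d. homfun M d (Q d)" "\<forall>d\<ge>N. Q d = (\<lambda>_. 0)"
      "\<phi> = (\<lambda>x. \<Sum>d<N. Q d x)"
    and Q': "\<forall>d. homfun M d (Q' d)" "\<forall>d\<ge>N'. Q' d = (\<lambda>_. 0)" "\<psi> = (\<lambda>x. \<Sum>d<N'. Q' d x)"
    by blast
  have "(\<Sum>d<N. Q d x) = (\<Sum>d<max N N'. Q d x)" for x
    using Q(2) by (intro sum.mono_neutral_left) auto
  moreover have "(\<Sum>d<N'. Q' d x) = (\<Sum>d<max N N'. Q' d x)" for x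
    using Q'(2) by (intro sum.mono_neutral_left) auto
  ultimately have "(\<lambda>x. \<phi> x + \<psi> x) = (\<lambda>x. \<Sum>d<max N N'. Q d x + Q' d x)"
    using Q(3) Q'(3) by (simp add: sum.distrib)
  then show ?case using Q(1,2) Q'(1,2)
    by (intro exI[of _ "max N N'"] exI[of _ "\<lambda>d x. Q d x + Q' d x"]) (auto intro: homfun.add)
qed

text \<open>The shape of a remainder of division by something of degree \<open>k\<close> in the last
  variable. For \<open>k = 0\<close> only the zero function remains, which is what division by a
  unit leaves.\<close>

definition lowdeg :: "nat \<Rightarrow> nat \<Rightarrow> ((nat \<Rightarrow> 'k::comm_ring_1) \<Rightarrow> 'k) \<Rightarrow> bool" where
  "lowdeg M k F \<longleftrightarrow> (\<exists>r. (\<forall>j<k. r j \<in> polyfun M) \<and> F = (\<lambda>x. \<Sum>j<k. r j x * x M ^ j))"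

lemma lowdegI: "(\<And>j. j < k \<Longrightarrow> r j \<in> polyfun M) \<Longrightarrow> lowdeg M k (\<lambda>x. \<Sum>j<k. r j x * x M ^ j)"
  unfolding lowdeg_def by blast

lemma lowdeg_zero: "lowdeg M k (\<lambda>_. 0)"
  using lowdegI[of k "\<lambda>_ _. 0" M] by (simp add: polyfun.const)

lemma lowdeg_monom:
  assumes "a \<in> polyfun M" and "j < k"
  shows "lowdeg M k (\<lambda>x. a x * x M ^ j)"
proof -
  have "lowdeg M k (\<lambda>x. \<Sum>i<k. (if i = j then a else (\<lambda>_. 0)) x * x M ^ i)"
    using assms by (intro lowdegI) (auto intro: polyfun.const)
  moreover have "(\<Sum>i<k. (if i = j then a else (\<lambda>_. 0)) x * x M ^ i) = a x * x M ^ j" for x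
    using assms(2) by (subst sum.remove[of _ j]) (auto intro!: sum.neutral)
  ultimately show ?thesis by simp
qed

lemma lowdeg_add: 
  assumes "lowdeg M k F" and "lowdeg M k G"
  shows "lowdeg M k (\<lambda>x. F x + G x)"
proof -
  obtain r s where "\<forall>j<k. r j \<in> polyfun M" "F = (\<lambda>x. \<Sum>j<k. r j x * x M ^ j)"
    "\<forall>j<k. s j \<in> polyfun M" "G = (\<lambda>x. \<Sum>j<k. s j x * x M ^ j)"
    using assms unfolding lowdeg_def by blast
  then show ?thesis
    using lowdegI[of k "\<lambda>j x. r j x + s j x" M]
    by (simp add: polyfun.add distrib_right sum.distrib)
qed

lemma lowdeg_sum: "(\<And>i. i \<in> S \<Longrightarrow> lowdeg M k (F i)) \<Longrightarrow> lowdeg M k (\<lambda>x. \<Sum>i\<in>S. F i x)"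
  by (induction S rule: infinite_finite_induct) (auto intro: lowdeg_zero lowdeg_add)

lemma lowdeg_mono:
  assumes "lowdeg M k F" and "k \<le> l"
  shows "lowdeg M l F"
proof -
  obtain r where r: "\<forall>j<k. r j \<in> polyfun M" "F = (\<lambda>x. \<Sum>j<k. r j x * x M ^ j)"
    using assms(1) unfolding lowdeg_def by blast
  show ?thesis unfolding r(2) using r(1) assms(2) by (intro lowdeg_sum lowdeg_monom) auto
qed

lemma lowdeg_monom_mult:
  assumes "lowdeg M k F" and "a \<in> polyfun M" and "k + j \<le> l"
  shows "lowdeg M l (\<lambda>x. a x * x M ^ j * F x)"
proof -
  obtain r where r: "\<forall>j<k. r j \<in> polyfun M" "F = (\<lambda>x. \<Sum>j<k. r j x * x M ^ j)"
    using assms(1) unfolding lowdeg_def by blast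
  have "(\<lambda>x. a x * x M ^ j * F x) = (\<lambda>x. \<Sum>i<k. (a x * r i x) * x M ^ (i + j))"
    by (simp add: r(2) sum_distrib_left power_add algebra_simps)
  then show ?thesis
    using r(1) assms(2,3) by (auto intro!: lowdeg_sum lowdeg_monom intro: polyfun.mult)
qed

lemma lowdeg_mult:
  assumes "lowdeg M k F" and "lowdeg M l G"
  shows "lowdeg M (k + l) (\<lambda>x. F x * G x)"
proof -
  obtain r where r: "\<forall>j<k. r j \<in> polyfun M" "F = (\<lambda>x. \<Sum>j<k. r j x * x M ^ j)"
    using assms(1) unfolding lowdeg_def by blast
  have "(\<lambda>x. F x * G x) = (\<lambda>x. \<Sum>i<k. r i x * x M ^ i * G x)"
    by (simp add: r(2) sum_distrib_right)
  then show ?thesis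
    using r(1) assms(2) by (auto intro!: lowdeg_sum lowdeg_monom_mult[of M l])
qed

text \<open>A shear: its inverse has direction \<open>- v\<close>, and for integral \<open>v\<close>
  it maps the polydisc onto itself, so it preserves sup norms.\<close>

definition shift :: "nat \<Rightarrow> (nat \<Rightarrow> 'k::comm_ring_1) \<Rightarrow> (nat \<Rightarrow> 'k) \<Rightarrow> nat \<Rightarrow> 'k" where
  "shift M v x = (\<lambda>i. if i < M then x i + v i * x M else x i)"

lemma shift_inverse: "shift M (\<lambda>i. - v i) (shift M v x) = x" "shift M v (shift M (\<lambda>i. - v i) x) = x"
  by (auto simp: shift_def)

lemma polyfun_shift: "i < Suc M \<Longrightarrow> (\<lambda>x. shift M v x i) \<in> polyfun (Suc M)"
  by (cases "i < M") (auto simp: shift_def intro!: polyfun.intros polyfun.const)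

text \<open>As \<open>v M = 1\<close>, the sheared point is \<open>x' + x M * v\<close> with
  \<open>x'\<close> free of the coordinate \<open>M\<close>. The top coefficient in
  \<open>x M\<close> of a form of degree \<open>d\<close> is therefore its value at
  \<open>v\<close>.\<close>

lemma homfun_shift:
  "homfun (Suc M) d \<phi> \<Longrightarrow> v M = 1 \<Longrightarrow> \<exists>A. lowdeg M d A \<and> (\<forall>x. \<phi> (shift M v x) = \<phi> v * x M ^ d + A x)"
proof (induction rule: homfun.induct)
  case (const c)
  show ?case by (rule exI[of _ "\<lambda>_. 0"]) (simp add: lowdeg_zero)
next
  case (zero d)
  show ?case by (rule exI[of _ "\<lambda>_. 0"]) (simp add: lowdeg_zero)
next
  case (var i)
  show ?case
  proof (cases "i < M")
    case True
    then show ?thesis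
      using lowdeg_monom[OF polyfun.var[OF True], of 0 1]
      by (intro exI[of _ "\<lambda>x. x i"]) (simp add: shift_def)
  next
    case False
    then show ?thesis using var
      by (intro exI[of _ "\<lambda>_. 0"]) (auto simp: shift_def lowdeg_zero less_Suc_eq)
  qed
next
  case (add d \<phi> \<psi>)
  then obtain A B where "lowdeg M d A" "\<forall>x. \<phi> (shift M v x) = \<phi> v * x M ^ d + A x"
    "lowdeg M d B" "\<forall>x. \<psi> (shift M v x) = \<psi> v * x M ^ d + B x" by blast
  then show ?case
    by (intro exI[of _ "\<lambda>x. A x + B x"]) (auto intro: lowdeg_add simp: algebra_simps)
next
  case (mult d \<phi> d' \<psi>)
  then obtain A B where A: "lowdeg M d A" "\<forall>x. \<phi> (shift M v x) = \<phi> v * x M ^ d + A x"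
    and B: "lowdeg M d' B" "\<forall>x. \<psi> (shift M v x) = \<psi> v * x M ^ d' + B x" by blast
  have "lowdeg M (d + d') (\<lambda>x. (\<phi> v * x M ^ d * B x + \<psi> v * x M ^ d' * A x) + A x * B x)"
    using lowdeg_monom_mult[OF B(1) polyfun.const[of "\<phi> v"], of d]
      lowdeg_monom_mult[OF A(1) polyfun.const[of "\<psi> v"], of d'] lowdeg_mult[OF A(1) B(1)]
    by (intro lowdeg_add) auto
  then show ?case using A(2) B(2)
    by (intro exI[of _ "\<lambda>x. (\<phi> v * x M ^ d * B x + \<psi> v * x M ^ d' * A x) + A x * B x"])
      (auto simp: algebra_simps power_add)
qed

context na_field
begin

lemma shift_polydisc: "v \<in> polydisc \<Longrightarrow> x \<in> polydisc \<Longrightarrow> shift M v x \<in> polydisc"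
  by (auto simp: polydisc_def shift_def intro!: av_addI av_mult_le1I)

text \<open>Approximate \<open>F\<close> by a polynomial to half its size at \<open>x0\<close>,
  split it into forms, and let \<open>k\<close> be the largest degree in which the maximum
  \<open>R\<close> of the norms of the forms is reached. Dividing by the value of that form at
  \<open>v\<close> makes the top coefficient 1. Forms of higher degree are strictly smaller than
  \<open>R\<close>, and forms of lower degree have degree below \<open>k\<close> in
  \<open>x M\<close>, so they go into \<open>A\<close>.\<close>

lemma exists_distinguished:
  assumes F: "F \<in> tate (Suc M)" and x0: "x0 \<in> polydisc" "F x0 \<noteq> 0"
  obtains v a k A \<delta> where "v \<in> polydisc" and "a \<noteq> 0" and "0 < \<delta>" and "\<delta> < 1"
    and "lowdeg M k A" and "\<And>x. x \<in> polydisc \<Longrightarrow> av (A x) \<le> 1"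
    and "\<And>x. x \<in> polydisc \<Longrightarrow> av (a * F (shift M v x) - (x M ^ k + A x)) \<le> \<delta>"
proof -
  have F0: "av (F x0) > 0" using x0(2) by (simp add: av_pos)
  then have "av (F x0) / 2 > 0" by simp
  then obtain P where P: "P \<in> polyfun (Suc M)"
    "\<And>x. x \<in> polydisc \<Longrightarrow> av (F x - P x) \<le> av (F x0) / 2"
    using tateD[OF F] by blast
  have "av (F x0 - P x0) < av (F x0)" using P(2)[OF x0(1)] F0 by linarith
  then have Px0: "av (P x0) = av (F x0)" by (rule av_eq_of_close)
  obtain N Q where Q: "\<And>d. homfun (Suc M) d (Q d)" "P = (\<lambda>x. \<Sum>d<N. Q d x)"
    using homsum_graded[OF homsum_if_polyfun[OF P(1)]] by blast
  have "\<forall>d. \<exists>u\<in>polydisc. av (u M) = 1 \<and> (\<forall>x\<in>polydisc. av (Q d x) \<le> av (Q d u))"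
    using polyfun_max_unit[OF polyfun_if_homfun[OF Q(1)]] by blast
  then obtain u where u: "\<And>d. u d \<in> polydisc" "\<And>d. av (u d M) = 1"
    "\<And>d x. x \<in> polydisc \<Longrightarrow> av (Q d x) \<le> av (Q d (u d))" by metis
  define \<rho> where "\<rho> d = av (Q d (u d))" for d
  have N: "N > 0" using Px0 F0 by (intro gr0I) (auto simp: Q(2))
  define R where "R = Max (\<rho> ` {..<N})"
  have \<rho>R: "\<rho> d \<le> R" if "d < N" for d unfolding R_def using that by (intro Max_ge) auto
  have R0: "av (F x0) \<le> R"
    unfolding Px0[symmetric] Q(2)
  proof (rule av_sumI)
    have "0 \<le> \<rho> 0" by (simp add: \<rho>_def)
    then show "0 \<le> R" using \<rho>R[OF N] by simp
    show "av (Q d x0) \<le> R" if "d \<in> {..<N}" for d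
      using u(3)[OF x0(1), of d] \<rho>R[of d] that by (simp add: \<rho>_def)
  qed
  then have Rpos: "R > 0" using F0 by simp
  define K where "K = {d. d < N \<and> \<rho> d = R}"
  have "R \<in> \<rho> ` {..<N}" unfolding R_def using N by (intro Max_in) auto
  then have K: "finite K" "K \<noteq> {}" by (auto simp: K_def)
  define k where "k = Max K"
  have "k \<in> K" unfolding k_def using K by (rule Max_in)
  then have k: "k < N" "\<rho> k = R" by (auto simp: K_def)
  have kmax: "\<rho> d < R" if "k < d" "d < N" for d
  proof -
    have "d \<notin> K" using Max_ge[OF K(1), of d] that(1) by (auto simp: k_def)
    then show ?thesis using that(2) \<rho>R[OF that(2)] by (auto simp: K_def)
  qed
  have uM: "u k M \<noteq> 0" using u(2)[of k] by auto
  \<comment> \<open>Since the last coordinate of \<open>u k\<close> is a unit, scaling it to 1 stays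
    in the polydisc, and homogeneity preserves the maximal absolute value \<open>R\<close>.\<close>
  define v where "v = (\<lambda>i. (1 / u k M) * u k i)"
  have v: "v \<in> polydisc" "v M = 1"
    using u(1)[of k] uM u(2)[of k] by (auto simp: v_def polydisc_def av_divide)
  have "av (Q k v) = R"
    unfolding v_def homfun_scale[OF Q(1)] using u(2)[of k] k(2)
    by (simp add: av_mult av_divide av_power \<rho>_def)
  then have Qv: "Q k v \<noteq> 0" using Rpos by auto
  define a where "a = 1 / Q k v"
  have ava: "av a = 1 / R" using \<open>av (Q k v) = R\<close> by (simp add: a_def av_divide)
  have a0: "a \<noteq> 0" using Qv by (simp add: a_def)
  have aQ: "av (a * Q d x) \<le> \<rho> d / R" if "x \<in> polydisc" for d x
    using u(3)[OF that, of d] Rpos by (simp add: av_mult ava \<rho>_def divide_right_mono)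
  have "\<forall>d. \<exists>A. lowdeg M d A \<and> (\<forall>x. Q d (shift M v x) = Q d v * x M ^ d + A x)"
    by (intro allI homfun_shift[where M = M and v = v] Q(1) v(2))
  then obtain B where B: "\<And>d. lowdeg M d (B d)"
    "\<And>d x. Q d (shift M v x) = Q d v * x M ^ d + B d x" by metis
  define A where "A x = (\<Sum>d<k. a * Q d (shift M v x)) + a * B k x" for x
  have A: "x M ^ k + A x = (\<Sum>d<Suc k. a * Q d (shift M v x))" for x
    using Qv by (simp add: A_def B(2)[of k] a_def field_simps)
  \<comment> \<open>\<open>1/2\<close> covers the approximation error, which is at most
    \<open>R / 2\<close> before the division by \<open>R\<close>; it also keeps
    \<open>\<delta>\<close> positive when no higher form exists.\<close>
  define \<delta> where "\<delta> = Max (insert (1/2) ((\<lambda>d. \<rho> d / R) ` {k<..<N}))"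
  have \<delta>: "1/2 \<le> \<delta>" unfolding \<delta>_def by (intro Max_ge) auto
  have \<delta>d: "\<rho> d / R \<le> \<delta>" if "k < d" "d < N" for d
    unfolding \<delta>_def using that by (intro Max_ge) auto
  show ?thesis
  proof
    show "v \<in> polydisc" "a \<noteq> 0" by fact+
    show "0 < \<delta>" using \<delta> by simp
    show "\<delta> < 1"
      unfolding \<delta>_def using kmax Rpos by (subst Max_less_iff) auto
    have "lowdeg M k (\<lambda>x. a * Q d (shift M v x))" if "d < k" for d
      unfolding B(2) distrib_left mult.assoc[symmetric]
      using that lowdeg_monom[OF polyfun.const[of "a * Q d v"], of d k M]
        lowdeg_monom_mult[OF B(1)[of d] polyfun.const[of a], of 0 k]
      by (intro lowdeg_add) auto
    moreover have "lowdeg M k (\<lambda>x. a * B k x)"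
      using lowdeg_monom_mult[OF B(1)[of k] polyfun.const[of a], of 0 k] by simp
    ultimately show "lowdeg M k A"
      unfolding A_def by (intro lowdeg_add lowdeg_sum) auto
    fix x :: "nat \<Rightarrow> 'k" assume x: "x \<in> polydisc"
    then have sx: "shift M v x \<in> polydisc" using shift_polydisc[OF v(1)] by blast
    have "av (x M ^ k + A x) \<le> 1"
      unfolding A
    proof (rule av_sumI)
      fix d assume "d \<in> {..<Suc k}"
      then have "\<rho> d / R \<le> 1" using \<rho>R[of d] k Rpos by simp
      then show "av (a * Q d (shift M v x)) \<le> 1" using aQ[OF sx, of d] by simp
    qed simp
    then show "av (A x) \<le> 1"
      using av_diffI[of "x M ^ k + A x" 1 "x M ^ k"] av_power_le1[OF polydiscD[OF x]] by simp
    have split: "(\<Sum>d<N. a * Q d (shift M v x)) =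
        (\<Sum>d<Suc k. a * Q d (shift M v x)) + (\<Sum>d\<in>{k<..<N}. a * Q d (shift M v x))"
      using k(1) by (subst sum.union_disjoint[symmetric]) (auto intro!: sum.cong)
    have aP: "a * P (shift M v x) = (\<Sum>d<N. a * Q d (shift M v x))"
      by (simp add: Q(2) sum_distrib_left)
    have "a * F (shift M v x) - (x M ^ k + A x) =
        a * (F (shift M v x) - P (shift M v x)) + (\<Sum>d\<in>{k<..<N}. a * Q d (shift M v x))"
      unfolding A right_diff_distrib aP split by simp
    moreover have "av (a * (F (shift M v x) - P (shift M v x))) \<le> \<delta>"
    proof -
      have "av (a * (F (shift M v x) - P (shift M v x))) \<le> 1 / R * (R / 2)"
        unfolding av_mult ava using P(2)[OF sx] R0 Rpos by (intro mult_left_mono) auto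
      then show ?thesis using \<delta> Rpos by simp
    qed
    moreover have "av (\<Sum>d\<in>{k<..<N}. a * Q d (shift M v x)) \<le> \<delta>"
      using \<delta> \<delta>d aQ[OF sx] by (intro av_sumI) (auto intro: order_trans)
    ultimately show "av (a * F (shift M v x) - (x M ^ k + A x)) \<le> \<delta>"
      by (metis av_addI)
  qed
qed

section \<open>Weierstrass division\<close>

context
  fixes M k :: nat and A f :: "(nat \<Rightarrow> 'k) \<Rightarrow> 'k" and \<delta> :: real
  assumes A: "lowdeg M k A" "\<And>x. x \<in> polydisc \<Longrightarrow> av (A x) \<le> 1"
    and f: "f \<in> tate (Suc M)" "\<And>x. x \<in> polydisc \<Longrightarrow> av (f x - (x M ^ k + A x)) \<le> \<delta>"
    and \<delta>: "0 < \<delta>" "\<delta> < 1"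
begin

text \<open>Long division by the monic polynomial \<open>x M ^ k + A\<close>. The leading
  coefficient is bounded by the norm of \<open>F\<close> and the divisor by 1, so no step enlarges
  the bound \<open>\<rho>\<close>.\<close>

lemma poly_division:
  assumes "lowdeg M N F" and "\<And>x. x \<in> polydisc \<Longrightarrow> av (F x) \<le> \<rho>"
  shows "\<exists>q\<in>polyfun (Suc M). \<exists>S. lowdeg M k S \<and> (\<forall>x. F x = q x * (x M ^ k + A x) + S x) \<and>
    (\<forall>x\<in>polydisc. av (q x) \<le> \<rho>) \<and> (\<forall>x\<in>polydisc. av (S x) \<le> \<rho>)"
  using assms
proof (induction N arbitrary: F)
  have \<rho>: "0 \<le> \<rho>" using assms(2)[OF zero_in_polydisc] av_nonneg order_trans by blast
  {
    case 0
    then show ?case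
      using \<rho> by (intro bexI[of _ "\<lambda>_. 0"] exI[of _ F]) (auto intro: lowdeg_mono polyfun.const)
  next
    case (Suc N)
    show ?case
    proof (cases "Suc N \<le> k")
      case True
      then show ?thesis
        using \<rho> Suc.prems by (intro bexI[of _ "\<lambda>_. 0"] exI[of _ F]) (auto intro: lowdeg_mono polyfun.const)
    next
      case False
      obtain r where r: "\<forall>j<Suc N. r j \<in> polyfun M" "F = (\<lambda>x. \<Sum>j<Suc N. r j x * x M ^ j)"
        using Suc.prems(1) unfolding lowdeg_def by blast
      define F0 where "F0 x = (\<Sum>j<N. r j x * x M ^ j)" for x
      have F: "F x = F0 x + r N x * x M ^ N" for x by (simp add: r(2) F0_def)
      have rN: "av (r N x) \<le> \<rho>" if "x \<in> polydisc" for x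
        using polyfun_coeff_bound[of "Suc N" r M \<rho> N x] r Suc.prems(2) that by auto
      define F1 where "F1 x = F0 x + (- r N x) * x M ^ (N - k) * A x" for x
      have pw: "x M ^ N = x M ^ (N - k) * x M ^ k" for x :: "nat \<Rightarrow> 'k"
        using False by (simp flip: power_add)
      have F1: "F1 x = F x - r N x * x M ^ (N - k) * (x M ^ k + A x)" for x
        by (simp add: F1_def F pw algebra_simps)
      have L: "lowdeg M N F1"
        unfolding F1_def F0_def using r(1) A(1) False
        by (intro lowdeg_add lowdegI lowdeg_monom_mult[of M k] polyfun_uminus) auto
      have W1: "av (x M ^ k + A x) \<le> 1" if "x \<in> polydisc" for x
        using A(2)[OF that] av_power_le1[OF polydiscD[OF that]] by (intro av_addI)
      have Bd: "av (F1 x) \<le> \<rho>" if "x \<in> polydisc" for x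
        unfolding F1 using Suc.prems(2)[OF that] rN[OF that] W1[OF that] polydiscD[OF that, of M]
        by (intro av_diffI av_mult_le1I av_power_le1)
      have IH: "\<exists>q\<in>polyfun (Suc M). \<exists>S. lowdeg M k S \<and> (\<forall>x. F1 x = q x * (x M ^ k + A x) + S x) \<and>
          (\<forall>x\<in>polydisc. av (q x) \<le> \<rho>) \<and> (\<forall>x\<in>polydisc. av (S x) \<le> \<rho>)"
        by (intro Suc.IH L Bd)
      obtain q S where q: "q \<in> polyfun (Suc M)" and S: "lowdeg M k S"
        "\<And>x. F1 x = q x * (x M ^ k + A x) + S x"
        "\<And>x. x \<in> polydisc \<Longrightarrow> av (q x) \<le> \<rho>" "\<And>x. x \<in> polydisc \<Longrightarrow> av (S x) \<le> \<rho>"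
        using IH by (elim bexE exE conjE) (rule that; (assumption | erule spec | erule (1) bspec))
      define q' where "q' x = q x + r N x * x M ^ (N - k)" for x
      have "r N \<in> polyfun (Suc M)" using r(1) polyfun_mono[of "r N" M "Suc M"] by simp
      then have q': "q' \<in> polyfun (Suc M)"
        unfolding q'_def by (rule polyfun.add[OF q polyfun.mult[OF _ polyfun_power[OF polyfun.var[OF lessI]]]])
      have F': "F x = q' x * (x M ^ k + A x) + S x" for x
        using F1[of x] S(2)[of x] by (simp add: q'_def algebra_simps)
      have "av (q' x) \<le> \<rho>" if "x \<in> polydisc" for x
        unfolding q'_def using S(3)[OF that] rN[OF that] polydiscD[OF that, of M]
        by (intro av_addI av_mult_le1I av_power_le1)
      then show ?thesis using S(1,4) q' F' by (intro bexI[of _ q'] exI[of _ S] conjI) auto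
    qed
  }
qed

lemma distinguished_le1: "x \<in> polydisc \<Longrightarrow> av (f x) \<le> 1"
proof -
  assume x: "x \<in> polydisc"
  have "av ((f x - (x M ^ k + A x)) + (x M ^ k + A x)) \<le> 1"
    using f(2)[OF x] A(2)[OF x] \<delta> av_power_le1[OF polydiscD[OF x]] by (intro av_addI) auto
  then show ?thesis by simp
qed

text \<open>A polynomial close to \<open>G\<close> is divided by the monic polynomial near
  \<open>f\<close>; replacing that divisor by \<open>f\<close> costs \<open>q\<close> times a
  function of size at most \<open>\<delta>\<close>. Both errors are at most
  \<open>\<sigma> * \<delta>\<close>, so repetition converges geometrically.\<close>

lemma division_step:
  assumes "G \<in> tate (Suc M)" and "\<And>x. x \<in> polydisc \<Longrightarrow> av (G x) \<le> \<sigma>" and "0 < \<sigma>"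
  shows "\<exists>q r. q \<in> polyfun (Suc M) \<and> (\<forall>x\<in>polydisc. av (q x) \<le> \<sigma>) \<and>
     (\<forall>j<k. r j \<in> polyfun M \<and> (\<forall>x\<in>polydisc. av (r j x) \<le> \<sigma>)) \<and>
     (\<forall>x\<in>polydisc. av (G x - q x * f x - (\<Sum>j<k. r j x * x M ^ j)) \<le> \<sigma> * \<delta>)"
proof -
  have "0 < \<sigma> * \<delta>" using assms \<delta> by simp
  then obtain p where p: "p \<in> polyfun (Suc M)" "\<And>x. x \<in> polydisc \<Longrightarrow> av (G x - p x) \<le> \<sigma> * \<delta>"
    using tateD[OF assms(1)] by blast
  have "\<sigma> * \<delta> \<le> \<sigma>" using assms(3) \<delta> by simp
  then have "av (G x - (G x - p x)) \<le> \<sigma>" if "x \<in> polydisc" for x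
    using assms(2)[OF that] p(2)[OF that] by (intro av_diffI[of "G x" \<sigma> "G x - p x"]) auto
  then have "av (p x) \<le> \<sigma>" if "x \<in> polydisc" for x using that by simp
  moreover obtain N r where "\<And>j. j < N \<Longrightarrow> r j \<in> polyfun M" "p = (\<lambda>x. \<Sum>j<N. r j x * x M ^ j)"
    by (rule polyfun_Suc_expand[OF p(1)]) blast
  then have "lowdeg M N p" using lowdegI[of N r M] by simp
  ultimately obtain q S where q: "q \<in> polyfun (Suc M)" and S: "lowdeg M k S"
    "\<And>x. p x = q x * (x M ^ k + A x) + S x"
    "\<And>x. x \<in> polydisc \<Longrightarrow> av (q x) \<le> \<sigma>" "\<And>x. x \<in> polydisc \<Longrightarrow> av (S x) \<le> \<sigma>"
    using poly_division[of N p \<sigma>] by blast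
  obtain r where r: "\<forall>j<k. r j \<in> polyfun M" "S = (\<lambda>x. \<Sum>j<k. r j x * x M ^ j)"
    using S(1) unfolding lowdeg_def by blast
  have "av (r j x) \<le> \<sigma>" if "j < k" "x \<in> polydisc" for j x
    using polyfun_coeff_bound[of k r M \<sigma> j x] r S(4) that by auto
  moreover have "av (G x - q x * f x - S x) \<le> \<sigma> * \<delta>" if x: "x \<in> polydisc" for x
  proof -
    have eq: "G x - q x * f x - S x = (G x - p x) - q x * (f x - (x M ^ k + A x))"
      by (simp add: S(2) algebra_simps)
    show ?thesis
      unfolding eq by (intro av_diffI p(2)[OF x] av_multI[OF S(3)[OF x] f(2)[OF x]])
  qed
  ultimately show ?thesis using q r S(3) by (intro exI[of _ q] exI[of _ r]) auto
qed

lemma Weierstrass_division: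
  assumes "g \<in> tate (Suc M)"
  shows "\<exists>q\<in>tate (Suc M). \<exists>s. (\<forall>j<k. s j \<in> tate M) \<and>
    (\<forall>x\<in>polydisc. g x = q x * f x + (\<Sum>j<k. s j x * x M ^ j))"
proof -
  obtain \<rho> where \<rho>: "0 < \<rho>" "\<And>x. x \<in> polydisc \<Longrightarrow> av (g x) \<le> \<rho>"
    using tate_bounded[OF assms] by blast
  have \<rho>n: "0 < \<rho> * \<delta> ^ n" for n using \<rho> \<delta> by simp
  define ok where "ok n q r \<longleftrightarrow> q \<in> polyfun (Suc M) \<and> (\<forall>x\<in>polydisc. av (q x) \<le> \<rho> * \<delta> ^ n) \<and>
     (\<forall>j<k. r j \<in> polyfun M \<and> (\<forall>x\<in>polydisc. av (r j x) \<le> \<rho> * \<delta> ^ n))"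
    for n and q :: "(nat \<Rightarrow> 'k) \<Rightarrow> 'k" and r :: "nat \<Rightarrow> (nat \<Rightarrow> 'k) \<Rightarrow> 'k"
  \<comment> \<open>\<open>dependent_nat_choice\<close> only promises the predicate at 0; the last
    conjunct pins the start of the sequence to \<open>g\<close>.\<close>
  define good where "good n G \<longleftrightarrow> G \<in> tate (Suc M) \<and> (\<forall>x\<in>polydisc. av (G x) \<le> \<rho> * \<delta> ^ n) \<and> (n = 0 \<longrightarrow> G = g)"
    for n and G :: "(nat \<Rightarrow> 'k) \<Rightarrow> 'k"
  define rest where "rest G q r = (\<lambda>x. G x - q x * f x - (\<Sum>j<k. r j x * x M ^ j))"
    for G q :: "(nat \<Rightarrow> 'k) \<Rightarrow> 'k" and r :: "nat \<Rightarrow> (nat \<Rightarrow> 'k) \<Rightarrow> 'k"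
  have "\<exists>G. \<forall>n. good n (G n) \<and> (\<exists>q r. ok n q r \<and> G (Suc n) = rest (G n) q r)"
  proof (rule dependent_nat_choice)
    show "\<exists>G. good 0 G"
      using assms \<rho> by (auto simp: good_def)
  next
    fix G n
    assume "good n G"
    then have G: "G \<in> tate (Suc M)" "\<And>x. x \<in> polydisc \<Longrightarrow> av (G x) \<le> \<rho> * \<delta> ^ n"
      by (auto simp: good_def)
    obtain q r where qr: "ok n q r"
      "\<forall>x\<in>polydisc. av (rest G q r x) \<le> \<rho> * \<delta> ^ n * \<delta>"
      using division_step[OF G \<rho>n] unfolding ok_def rest_def by blast
    have "rest G q r \<in> tate (Suc M)"
      using qr(1) G(1) f(1) unfolding ok_def rest_def
      by (intro tate_diff tate_mult tate_sum tate_power tate_var)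
        (auto intro: tate_polyfun tate_Suc)
    then have "good (Suc n) (rest G q r)"
      using qr(2) by (simp add: good_def mult_ac)
    then show "\<exists>G'. good (Suc n) G' \<and> (\<exists>q r. ok n q r \<and> G' = rest G q r)"
      using qr(1) by blast
  qed
  then obtain G where G: "\<And>n. good n (G n)" 
    and "\<And>n. \<exists>q r. ok n q r \<and> G (Suc n) = rest (G n) q r" by blast
  then obtain q r where qr: "\<And>n. ok n (q n) (r n)"
    and GS: "\<And>n. G (Suc n) = rest (G n) (q n) (r n)"
    by metis
  have G0: "G 0 = g" and Gb: "\<And>n x. x \<in> polydisc \<Longrightarrow> av (G n x) \<le> \<rho> * \<delta> ^ n"
    using G by (auto simp: good_def)
  have qb: "av (q n x) \<le> \<rho> * \<delta> ^ n" if "x \<in> polydisc" for n x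
    using qr[of n] that unfolding ok_def by blast
  obtain q' where q': "q' \<in> tate (Suc M)"
    "\<And>N x. x \<in> polydisc \<Longrightarrow> av (q' x - (\<Sum>n<N. q n x)) \<le> \<rho> * \<delta> ^ N"
    using tate_series[of q "Suc M" \<delta> \<rho>] qr \<delta> \<rho>(1) tate_polyfun unfolding ok_def by blast
  have "\<forall>j\<in>{..<k}. \<exists>s\<in>tate M. \<forall>N. \<forall>x\<in>polydisc. av (s x - (\<Sum>n<N. r n j x)) \<le> \<rho> * \<delta> ^ N"
  proof
    fix j assume j: "j \<in> {..<k}"
    show "\<exists>s\<in>tate M. \<forall>N. \<forall>x\<in>polydisc. av (s x - (\<Sum>n<N. r n j x)) \<le> \<rho> * \<delta> ^ N"
      by (rule tate_series[of "\<lambda>n. r n j" M \<delta> \<rho>])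
        (use j qr \<delta> \<rho>(1) in \<open>auto simp: ok_def intro: tate_polyfun\<close>)
  qed
  then obtain s where s: "\<And>j. j < k \<Longrightarrow> s j \<in> tate M"
    "\<And>j N x. j < k \<Longrightarrow> x \<in> polydisc \<Longrightarrow> av (s j x - (\<Sum>n<N. r n j x)) \<le> \<rho> * \<delta> ^ N"
    by (metis lessThan_iff)
  \<comment> \<open>The first \<open>N\<close> steps telescope: what is left of \<open>g\<close> is
    \<open>G N\<close>, which tends to 0 uniformly on the polydisc.\<close>
  have GN: "g x = G N x + (\<Sum>n<N. q n x) * f x + (\<Sum>j<k. (\<Sum>n<N. r n j x) * x M ^ j)" for N x
    by (induction N) (simp_all add: G0 GS rest_def algebra_simps sum.distrib)
  have "g x = q' x * f x + (\<Sum>j<k. s j x * x M ^ j)" if x: "x \<in> polydisc" for x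
  proof (rule eq_if_av_small)
    fix \<epsilon> :: real assume "0 < \<epsilon>"
    have "(\<lambda>N. \<rho> * \<delta> ^ N) \<longlonglongrightarrow> \<rho> * 0"
      using \<delta> by (intro tendsto_mult tendsto_const LIMSEQ_power_zero) auto
    then obtain N where N: "\<rho> * \<delta> ^ N \<le> \<epsilon>"
      using order_tendstoD(2)[of _ "\<rho> * 0" _ \<epsilon>] \<open>0 < \<epsilon>\<close>
      by (metis (no_types, lifting) eventually_sequentially less_imp_le mult_zero_right order_refl)
    have "g x - (q' x * f x + (\<Sum>j<k. s j x * x M ^ j)) = G N x - (q' x - (\<Sum>n<N. q n x)) * f x -
        (\<Sum>j<k. (s j x - (\<Sum>n<N. r n j x)) * x M ^ j)"
      by (subst GN[of x N]) (simp add: algebra_simps sum_subtractf)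
    also have "av \<dots> \<le> \<rho> * \<delta> ^ N"
    proof (intro av_diffI)
      show "av (G N x) \<le> \<rho> * \<delta> ^ N" by (rule Gb[OF x])
      show "av ((q' x - (\<Sum>n<N. q n x)) * f x) \<le> \<rho> * \<delta> ^ N"
        by (intro av_mult_le1I q'(2) x distinguished_le1)
      show "av (\<Sum>j<k. (s j x - (\<Sum>n<N. r n j x)) * x M ^ j) \<le> \<rho> * \<delta> ^ N"
        using x s(2) \<rho>n[of N] polydiscD[OF x, of M]
        by (intro av_sumI av_mult_le1I av_power_le1) auto
    qed
    finally show "av (g x - (q' x * f x + (\<Sum>j<k. s j x * x M ^ j))) \<le> \<epsilon>" using N by simp
  qed
  then show ?thesis using q'(1) s(1) by blast
qed

end
end

section \<open>The Nullstellensatz\<close>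

context na_field
begin

text \<open>Ideals are saturated with respect to equality on the polydisc, since functions
  may differ arbitrarily outside of it.\<close>
definition tate_ideal :: "nat \<Rightarrow> ((nat \<Rightarrow> 'k) \<Rightarrow> 'k) set \<Rightarrow> bool" where
  "tate_ideal M I \<longleftrightarrow> I \<subseteq> tate M \<and> (\<lambda>_. 0) \<in> I \<and>
     (\<forall>F\<in>I. \<forall>G\<in>I. (\<lambda>x. F x + G x) \<in> I) \<and>
     (\<forall>F\<in>I. \<forall>t\<in>tate M. (\<lambda>x. t x * F x) \<in> I) \<and>
     (\<forall>F\<in>I. \<forall>G. (\<forall>x\<in>polydisc. G x = F x) \<longrightarrow> G \<in> I)"

lemma tate_idealD:
  assumes "tate_ideal M I"
  shows "F \<in> I \<Longrightarrow> F \<in> tate M"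
    and "(\<lambda>_. 0) \<in> I"
    and "F \<in> I \<Longrightarrow> G \<in> I \<Longrightarrow> (\<lambda>x. F x + G x) \<in> I"
    and "F \<in> I \<Longrightarrow> t \<in> tate M \<Longrightarrow> (\<lambda>x. t x * F x) \<in> I"
    and "F \<in> I \<Longrightarrow> (\<And>x. x \<in> polydisc \<Longrightarrow> G x = F x) \<Longrightarrow> G \<in> I"
  using assms unfolding tate_ideal_def by blast+

lemma tate_ideal_vanish:
  "tate_ideal M I \<Longrightarrow> (\<And>x. x \<in> polydisc \<Longrightarrow> G x = 0) \<Longrightarrow> G \<in> I"
  using tate_idealD(5)[OF _ tate_idealD(2)] by metis

lemma tate_ideal_cmult: "tate_ideal M I \<Longrightarrow> F \<in> I \<Longrightarrow> (\<lambda>x. c * F x) \<in> I"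
  using tate_idealD(4) tate_const by fastforce

lemma tate_ideal_restrict:
  assumes "tate_ideal (Suc M) I"
  shows "tate_ideal M (I \<inter> tate M)"
  unfolding tate_ideal_def
  using tate_idealD[OF assms] tate_Suc
  by (auto intro: tate_add tate_mult tate_const dest: tate_saturated)

text \<open>For an ideal \<open>I\<close>, the ideal generated by \<open>I\<close> and the functions
  of the first \<open>M\<close> variables that vanish at \<open>c\<close>; its quotient is the ring
  of the fibre over \<open>c\<close> of the zero set of \<open>I\<close>.\<close>

inductive_set fiber_ideal :: "nat \<Rightarrow> ((nat \<Rightarrow> 'k) \<Rightarrow> 'k) set \<Rightarrow> (nat \<Rightarrow> 'k) \<Rightarrow> ((nat \<Rightarrow> 'k) \<Rightarrow> 'k) set"
  for M I c where
  base: "F \<in> I \<Longrightarrow> F \<in> fiber_ideal M I c"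
| gen: "a \<in> tate M \<Longrightarrow> a c = 0 \<Longrightarrow> t \<in> tate (Suc M) \<Longrightarrow> (\<lambda>x. a x * t x) \<in> fiber_ideal M I c"
| add: "F \<in> fiber_ideal M I c \<Longrightarrow> G \<in> fiber_ideal M I c \<Longrightarrow> (\<lambda>x. F x + G x) \<in> fiber_ideal M I c"

lemma fiber_ideal_mult:
  assumes "tate_ideal (Suc M) I" and "F \<in> fiber_ideal M I c" and t: "t \<in> tate (Suc M)"
  shows "(\<lambda>x. t x * F x) \<in> fiber_ideal M I c"
  using assms(2)
proof (induction rule: fiber_ideal.induct)
  case (base F)
  then show ?case using tate_idealD(4)[OF assms(1) _ t] fiber_ideal.base by blast
next
  case (gen a t')
  then have "(\<lambda>x. a x * (t x * t' x)) \<in> fiber_ideal M I c"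
    using t by (intro fiber_ideal.gen tate_mult) auto
  then show ?case by (simp add: mult_ac)
next
  case (add F G)
  then show ?case using fiber_ideal.add by (fastforce simp: distrib_left)
qed

lemma fiber_ideal_saturated:
  assumes "tate_ideal (Suc M) I" and "F \<in> fiber_ideal M I c" and "\<And>x. x \<in> polydisc \<Longrightarrow> G x = F x"
  shows "G \<in> fiber_ideal M I c"
proof -
  have "(\<lambda>x. G x - F x) \<in> fiber_ideal M I c"
    using tate_ideal_vanish[OF assms(1)] assms(3) by (intro fiber_ideal.base) auto
  from fiber_ideal.add[OF assms(2) this] show ?thesis by simp
qed

section \<open>Lifting a zero through a finite extension\<close>

context
  fixes M k :: nat and I :: "((nat \<Rightarrow> 'k) \<Rightarrow> 'k) set" and c :: "nat \<Rightarrow> 'k"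
  assumes I: "tate_ideal (Suc M) I" and proper: "(\<lambda>_. 1) \<notin> I"
    and fin: "\<And>g. g \<in> tate (Suc M) \<Longrightarrow>
      \<exists>s. (\<forall>j<k. s j \<in> tate M) \<and> (\<lambda>x. g x - (\<Sum>j<k. s j x * x M ^ j)) \<in> I"
    and c: "c \<in> polydisc" "\<And>F. F \<in> I \<Longrightarrow> F \<in> tate M \<Longrightarrow> F c = 0"
begin

text \<open>For \<open>t\<close> in \<open>I\<close> all coefficients may be 0, and for
  \<open>b * t\<close> with \<open>b c = 0\<close> the coefficients of \<open>t\<close> are
  multiplied by \<open>b\<close>. Coefficients vanishing at \<open>c\<close> are what the
  elimination in Nakayama's lemma consumes.\<close>

lemma fiber_coefficients:
  assumes a: "\<And>g. g \<in> tate (Suc M) \<Longrightarrow>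
      \<exists>s. (\<forall>j<l. s j \<in> tate M) \<and> (\<lambda>x. a x * g x - (\<Sum>j<l. s j x * x M ^ j)) \<in> I"
    and "a \<in> tate M" and "t \<in> fiber_ideal M I c"
  shows "\<exists>s. (\<forall>j<l. s j \<in> tate M \<and> s j c = 0) \<and> (\<lambda>x. a x * t x - (\<Sum>j<l. s j x * x M ^ j)) \<in> I"
  using assms(3)
proof (induction rule: fiber_ideal.induct)
  case (base F)
  then have "(\<lambda>x. a x * F x) \<in> I"
    using tate_idealD(4)[OF I] tate_Suc[OF assms(2)] by simp
  then show ?case by (intro exI[of _ "\<lambda>_ _. 0"]) (simp add: tate_const)
next
  case (gen b t)
  obtain s where s: "\<forall>j<l. s j \<in> tate M" "(\<lambda>x. a x * t x - (\<Sum>j<l. s j x * x M ^ j)) \<in> I"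
    using a[OF gen(3)] by blast
  have "(\<lambda>x. b x * (a x * t x - (\<Sum>j<l. s j x * x M ^ j))) \<in> I"
    using tate_idealD(4)[OF I s(2)] tate_Suc[OF gen(1)] by simp
  then have "(\<lambda>x. a x * (b x * t x) - (\<Sum>j<l. (b x * s j x) * x M ^ j)) \<in> I"
    by (simp add: algebra_simps sum_distrib_left)
  then show ?case using s(1) gen(1,2)
    by (intro exI[of _ "\<lambda>j x. b x * s j x"]) (auto intro: tate_mult)
next
  case (add F G)
  then obtain s s' where s: "\<forall>j<l. s j \<in> tate M \<and> s j c = 0" "(\<lambda>x. a x * F x - (\<Sum>j<l. s j x * x M ^ j)) \<in> I"
    and s': "\<forall>j<l. s' j \<in> tate M \<and> s' j c = 0" "(\<lambda>x. a x * G x - (\<Sum>j<l. s' j x * x M ^ j)) \<in> I" by blast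
  have "(\<lambda>x. a x * (F x + G x) - (\<Sum>j<l. (s j x + s' j x) * x M ^ j)) \<in> I"
    using tate_idealD(3)[OF I s(2) s'(2)] by (simp add: algebra_simps sum.distrib)
  then show ?case using s(1) s'(1)
    by (intro exI[of _ "\<lambda>j x. s j x + s' j x"]) (auto intro: tate_add)
qed

text \<open>Nakayama's lemma at the maximal ideal of \<^term>\<open>c\<close>: the generators
  \<open>x\<^sub>M ^ (k - 1), \<dots>, x\<^sub>M, 1\<close> are eliminated one after the other.\<close>
lemma fiber_ideal_proper: "(\<lambda>_. 1) \<notin> fiber_ideal M I c"
proof
  assume one: "(\<lambda>_. 1) \<in> fiber_ideal M I c"
  define P where "P l \<longleftrightarrow> (\<exists>a\<in>tate M. a c \<noteq> 0 \<and> (\<forall>g\<in>tate (Suc M).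
      \<exists>s. (\<forall>j<l. s j \<in> tate M) \<and> (\<lambda>x. a x * g x - (\<Sum>j<l. s j x * x M ^ j)) \<in> I))" for l
  have "P k" unfolding P_def using fin by (intro bexI[of _ "\<lambda>_. 1"]) (auto intro: tate_const)
  moreover have "P l" if "P (Suc l)" for l
  proof -
    obtain a where a: "a \<in> tate M" "a c \<noteq> 0" "\<And>g. g \<in> tate (Suc M) \<Longrightarrow>
        \<exists>s. (\<forall>j<Suc l. s j \<in> tate M) \<and> (\<lambda>x. a x * g x - (\<Sum>j<Suc l. s j x * x M ^ j)) \<in> I"
      using \<open>P (Suc l)\<close> unfolding P_def by blast
    have Xl: "(\<lambda>x. x M ^ l) \<in> tate (Suc M)" by (intro tate_power tate_var) simp
    then have "(\<lambda>x. x M ^ l) \<in> fiber_ideal M I c" using fiber_ideal_mult[OF I one Xl] by simp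
    from fiber_coefficients[OF a(3) a(1) this]
    obtain n where n: "\<forall>j<Suc l. n j \<in> tate M \<and> n j c = 0"
      "(\<lambda>x. a x * x M ^ l - (\<Sum>j<Suc l. n j x * x M ^ j)) \<in> I" by blast
    define b where "b x = a x - n l x" for x
    have b: "b \<in> tate M" "b c \<noteq> 0"
      unfolding b_def using a(1,2) n(1) by (auto intro: tate_diff)
    have bI: "(\<lambda>x. b x * x M ^ l - (\<Sum>j<l. n j x * x M ^ j)) \<in> I"
      using n(2) by (simp add: b_def algebra_simps)
    show ?thesis
      unfolding P_def
    proof (intro bexI[of _ "\<lambda>x. b x * a x"] conjI ballI)
      show "b c * a c \<noteq> 0" using a b by simp
      show "(\<lambda>x. b x * a x) \<in> tate M" using a b by (intro tate_mult)
      fix g assume "g \<in> tate (Suc M)"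
      then obtain s where s: "\<forall>j<Suc l. s j \<in> tate M"
        "(\<lambda>x. a x * g x - (\<Sum>j<Suc l. s j x * x M ^ j)) \<in> I" using a(3) by blast
      have "(\<lambda>x. b x * (a x * g x - (\<Sum>j<Suc l. s j x * x M ^ j)) +
          s l x * (b x * x M ^ l - (\<Sum>j<l. n j x * x M ^ j))) \<in> I"
        using s b tate_Suc by (intro tate_idealD(3,4)[OF I] bI) auto
      then have "(\<lambda>x. b x * a x * g x - (\<Sum>j<l. (b x * s j x + s l x * n j x) * x M ^ j)) \<in> I"
        by (simp add: algebra_simps sum.distrib sum_distrib_left)
      then show "\<exists>s. (\<forall>j<l. s j \<in> tate M) \<and> (\<lambda>x. b x * a x * g x - (\<Sum>j<l. s j x * x M ^ j)) \<in> I"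
        using s(1) b(1) n(1)
        by (intro exI[of _ "\<lambda>j x. b x * s j x + s l x * n j x"]) (auto intro!: tate_add tate_mult)
    qed
  qed
  ultimately have "P 0"
    by (induction k) blast+
  \<comment> \<open>With no generators left, \<open>a\<close> itself lies in \<open>I\<close> and in
    \<open>tate M\<close> yet is nonzero at \<open>c\<close>, contrary to the choice of
    \<open>c\<close>.\<close>
  then obtain a where a: "a \<in> tate M" "a c \<noteq> 0" "(\<lambda>x. a x * 1) \<in> I"
    unfolding P_def using tate_const[of 1] by fastforce
  then show False using c(2)[of a] by simp
qed

text \<open>The conclusion says that \<open>x M - z\<close> is not invertible modulo the fibre
  ideal. If it were for every \<open>z\<close>, the linear factors of \<open>p\<close> could be
  cancelled one by one until a nonzero constant lay in the ideal.\<close>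

lemma exists_fiber_root:
  "p \<noteq> 0 \<Longrightarrow> (\<lambda>x. poly p (x M)) \<in> fiber_ideal M I c \<Longrightarrow>
   \<exists>z. \<forall>t\<in>tate (Suc M). (\<lambda>x. 1 - (x M - z) * t x) \<notin> fiber_ideal M I c"
proof (induction "degree p" arbitrary: p rule: less_induct)
  case less
  show ?case
  proof (cases "degree p = 0")
    case True
    then obtain a where a: "p = [:a:]" by (auto elim: degree_eq_zeroE)
    then have "a \<noteq> 0" using less.prems(1) by simp
    then have "(\<lambda>_. 1) \<in> fiber_ideal M I c"
      using fiber_ideal_mult[OF I less.prems(2) tate_const[of "1/a"]] a by simp
    then show ?thesis using fiber_ideal_proper by blast
  next
    case False
    then obtain z where "poly p z = 0" using alg_closed by blast
    then obtain p1 where p1: "p = [:-z, 1:] * p1" unfolding poly_eq_0_iff_dvd by (elim dvdE)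
    with less.prems(1) have p10: "p1 \<noteq> 0" by auto
    have deg: "degree p1 < degree p" using p10 unfolding p1 by (subst degree_mult_eq) auto
    show ?thesis
    proof (rule ccontr)
      assume neg: "\<not> ?thesis"
      then obtain t where t: "t \<in> tate (Suc M)" "(\<lambda>x. 1 - (x M - z) * t x) \<in> fiber_ideal M I c"
        by blast
      have "(\<lambda>x. poly p1 (x M)) \<in> tate (Suc M)"
        unfolding poly_altdef by (intro tate_sum tate_mult tate_const tate_power tate_var) simp
      then have "(\<lambda>x. poly p1 (x M) * (1 - (x M - z) * t x) + t x * poly p (x M)) \<in> fiber_ideal M I c"
        using t less.prems(2) by (intro fiber_ideal.add fiber_ideal_mult[OF I])
      then have "(\<lambda>x. poly p1 (x M)) \<in> fiber_ideal M I c"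
        by (simp add: p1 algebra_simps)
      then show False using less.hyps[OF deg p10] neg by blast
    qed
  qed
qed

text \<open>A monic relation for \<open>x M ^ k\<close>, with its coefficients evaluated at
  \<open>c\<close>, gives a one-variable polynomial in the fibre ideal and so a \<open>z\<close> for
  which \<open>x M - z\<close> is not invertible there. The zero is \<open>c(M := z)\<close>: if it
  were not integral, or if some element of \<open>I\<close> did not vanish there,
  \<open>x M - z\<close> would become invertible.\<close>

lemma exists_zero_above: "\<exists>c'\<in>polydisc. \<forall>F\<in>I. F c' = 0"
proof -
  have "(\<lambda>x. x M ^ k) \<in> tate (Suc M)" by (intro tate_power tate_var) simp
  then obtain s where s: "\<forall>j<k. s j \<in> tate M" "(\<lambda>x. x M ^ k - (\<Sum>j<k. s j x * x M ^ j)) \<in> I"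
    using fin by blast
  define p where "p = monom 1 k - (\<Sum>j<k. monom (s j c) j)"
  have "coeff p k = 1" by (simp add: p_def coeff_sum)
  then have p0: "p \<noteq> 0" by auto
  have sumI: "(\<And>j. j \<in> S \<Longrightarrow> F j \<in> fiber_ideal M I c) \<Longrightarrow> (\<lambda>x. \<Sum>j\<in>S. F j x) \<in> fiber_ideal M I c"
    for S :: "nat set" and F
    by (induction S rule: infinite_finite_induct)
      (auto intro: fiber_ideal.intros tate_idealD(2)[OF I])
  have "(\<lambda>x. (x M ^ k - (\<Sum>j<k. s j x * x M ^ j)) + (\<Sum>j<k. (s j x - s j c) * x M ^ j)) \<in> fiber_ideal M I c"
    using s by (intro fiber_ideal.add fiber_ideal.base sumI fiber_ideal.gen)
      (auto intro: tate_diff tate_const tate_power tate_var)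
  also have "(\<lambda>x. (x M ^ k - (\<Sum>j<k. s j x * x M ^ j)) + (\<Sum>j<k. (s j x - s j c) * x M ^ j)) =
      (\<lambda>x. poly p (x M))"
    by (simp add: p_def poly_sum poly_monom algebra_simps sum_subtractf)
  finally obtain z where z: "\<And>t. t \<in> tate (Suc M) \<Longrightarrow> (\<lambda>x. 1 - (x M - z) * t x) \<notin> fiber_ideal M I c"
    using exists_fiber_root[OF p0] by blast
  have z1: "av z \<le> 1"
  proof (rule ccontr)
    assume z1: "\<not> av z \<le> 1"
    then have z0: "z \<noteq> 0" by auto
    \<comment> \<open>For \<open>av z > 1\<close> this is distinguished of degree 0, so dividing 1
      by it leaves no remainder: the quotient is an inverse on the polydisc.\<close>
    define f where "f x = 1 - x M / z" for x :: "nat \<Rightarrow> 'k"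
    have "f \<in> tate (Suc M)" 
      unfolding f_def divide_inverse by (intro tate_diff tate_mult tate_const tate_var) simp
    moreover have "av (f x - (x M ^ 0 + 0)) \<le> 1 / av z" if "x \<in> polydisc" for x
      using polydiscD[OF that, of M] z1 by (simp add: f_def av_divide divide_right_mono)
    ultimately obtain q where q: "q \<in> tate (Suc M)" "\<And>x. x \<in> polydisc \<Longrightarrow> 1 = q x * f x"
      using Weierstrass_division[of M 0 "\<lambda>_. 0" f "1 / av z" "\<lambda>_. 1"] z1
      by (auto simp: lowdeg_zero tate_const)
    have "1 - (x M - z) * (- (1 / z) * q x) = 0" if "x \<in> polydisc" for x
      using q(2)[OF that] z0 by (simp add: f_def field_simps)
    then have "(\<lambda>x. 1 - (x M - z) * (- (1 / z) * q x)) \<in> fiber_ideal M I c"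
      by (intro fiber_ideal.base tate_ideal_vanish[OF I])
    then show False using z tate_cmult[OF q(1)] by blast
  qed
  define c' where "c' = c(M := z)"
  have c': "c' \<in> polydisc" unfolding c'_def using c(1) z1 by (rule polydisc_upd)
  have "F c' = 0" if "F \<in> I" for F
  proof -
    have "(\<lambda>x. x M - z) \<in> tate (Suc M)" by (intro tate_diff tate_const tate_var) simp
    \<comment> \<open>As \<open>av z \<le> 1\<close>, \<open>x M - z\<close> is itself distinguished
      of degree 1, with \<open>A = - z\<close> and error 0; the remainder of division by it is free
      of \<open>x M\<close>.\<close>
    moreover have "lowdeg M 1 (\<lambda>_. - z)"
      using lowdeg_monom[OF polyfun.const[of "- z" M], of 0 1] by simp
    ultimately have "\<exists>q\<in>tate (Suc M). \<exists>s. (\<forall>j<1. s j \<in> tate M) \<and>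
        (\<forall>x\<in>polydisc. F x = q x * (x M - z) + (\<Sum>j<1. s j x * x M ^ j))"
      using z1 tate_idealD(1)[OF I that]
      by (intro Weierstrass_division[of M 1 "\<lambda>_. - z" _ "1/2"]) auto
    then obtain q r where q: "q \<in> tate (Suc M)" and r: "r \<in> tate M"
      "\<And>x. x \<in> polydisc \<Longrightarrow> F x = q x * (x M - z) + r x" by auto
    have rc: "r c' = r c" 
      by (rule tate_cong[OF r(1) c' c(1)]) (simp add: c'_def)
    have Fc: "F c' = r c" using r(2)[OF c'] rc by (simp add: c'_def)
    show ?thesis
    proof (rule ccontr)
      assume "F c' \<noteq> 0"
      then have rc0: "r c \<noteq> 0" using Fc by simp
      \<comment> \<open>Modulo the fibre ideal \<open>F\<close> and \<open>r - r c\<close> are 0, so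
        \<open>q * (x M - z)\<close> is congruent to the nonzero constant
        \<open>- r c\<close>.\<close>
      have "(\<lambda>x. (1 / r c) * (F x + (r x - r c) * - 1)) \<in> fiber_ideal M I c"
        using that r(1)
        by (intro fiber_ideal_mult[OF I] fiber_ideal.add fiber_ideal.base fiber_ideal.gen)
          (auto intro: tate_const tate_diff)
      then have "(\<lambda>x. 1 - (x M - z) * (- (1 / r c) * q x)) \<in> fiber_ideal M I c"
        by (rule fiber_ideal_saturated[OF I]) (use rc0 r(2) in \<open>simp add: field_simps\<close>)
      then show False using z tate_cmult[OF q] by blast
    qed
  qed
  then show ?thesis using c' by blast
qed

end

lemma tate_ideal_compose:
  assumes I: "tate_ideal M I"
    and \<sigma>: "\<And>i. i < M \<Longrightarrow> (\<lambda>x. \<sigma> x i) \<in> polyfun M" "\<And>x. x \<in> polydisc \<Longrightarrow> \<sigma> x \<in> polydisc"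
    and \<tau>: "\<And>i. i < M \<Longrightarrow> (\<lambda>x. \<tau> x i) \<in> polyfun M" "\<And>x. x \<in> polydisc \<Longrightarrow> \<tau> x \<in> polydisc"
    and inv: "\<And>x. \<tau> (\<sigma> x) = x" "\<And>x. \<sigma> (\<tau> x) = x"
  shows "tate_ideal M {G. (\<lambda>x. G (\<tau> x)) \<in> I}"
  unfolding tate_ideal_def
proof (intro conjI ballI subsetI allI impI)
  fix G assume "G \<in> {G. (\<lambda>x. G (\<tau> x)) \<in> I}"
  then have "(\<lambda>x. G (\<tau> x)) \<in> tate M" using tate_idealD(1)[OF I] by blast
  from tate_compose[OF this \<sigma>] show "G \<in> tate M" by (simp add: inv)
next
  fix G t assume G: "G \<in> {G. (\<lambda>x. G (\<tau> x)) \<in> I}" and "t \<in> tate M"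
  then show "(\<lambda>x. t x * G x) \<in> {G. (\<lambda>x. G (\<tau> x)) \<in> I}"
    using tate_idealD(4)[OF I, of "\<lambda>x. G (\<tau> x)"] tate_compose[OF _ \<tau>] by auto
next
  fix F G assume "F \<in> {G. (\<lambda>x. G (\<tau> x)) \<in> I}" "\<forall>x\<in>polydisc. G x = F x"
  then show "G \<in> {G. (\<lambda>x. G (\<tau> x)) \<in> I}"
    using tate_idealD(5)[OF I, of "\<lambda>x. F (\<tau> x)" "\<lambda>x. G (\<tau> x)"] \<tau>(2) by auto
qed (use tate_idealD(2,3)[OF I] in auto)

theorem Nullstellensatz:
  assumes "tate_ideal M I" and "(\<lambda>_. 1) \<notin> I"
  shows "\<exists>c\<in>polydisc. \<forall>F\<in>I. F c = 0"
  using assms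
proof (induction M arbitrary: I)
  case (0 I)
  have "F (\<lambda>_. 0) = 0" if "F \<in> I" for F
  proof (rule ccontr)
    assume F0: "F (\<lambda>_. 0) \<noteq> 0"
    have "F x = F (\<lambda>_. 0)" if "x \<in> polydisc" for x
      using tate_cong[OF tate_idealD(1)[OF 0(1) \<open>F \<in> I\<close>] that zero_in_polydisc] by simp
    then have "(\<lambda>_. 1) \<in> I"
      using F0 tate_ideal_cmult[OF 0(1) \<open>F \<in> I\<close>, of "1 / F (\<lambda>_. 0)"]
      by (elim tate_idealD(5)[OF 0(1)]) auto
    then show False using 0(2) by blast
  qed
  then show ?case using zero_in_polydisc by blast
next
  case (Suc M I)
  note I = Suc.prems(1)
  show ?case
  proof (cases "\<forall>F\<in>I. \<forall>x\<in>polydisc. F x = 0")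
    case True
    then show ?thesis using zero_in_polydisc by blast
  next
    case False
    then obtain F x0 where F: "F \<in> I" and x0: "x0 \<in> polydisc" "F x0 \<noteq> 0" by blast
    obtain v a k A \<delta> where v: "v \<in> polydisc" and a: "a \<noteq> 0" and \<delta>: "0 < \<delta>" "\<delta> < 1"
      and A: "lowdeg M k A" "\<And>x. x \<in> polydisc \<Longrightarrow> av (A x) \<le> 1"
      and dist: "\<And>x. x \<in> polydisc \<Longrightarrow> av (a * F (shift M v x) - (x M ^ k + A x)) \<le> \<delta>"
      by (rule exists_distinguished[OF tate_idealD(1)[OF I F] x0]) (rule that)
    define w where "w = (\<lambda>i. - v i)"
    have w: "w \<in> polydisc" using v by (simp add: w_def polydisc_def)
    have inv: "shift M w (shift M v x) = x" "shift M v (shift M w x) = x" for x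
      unfolding w_def by (rule shift_inverse)+
    \<comment> \<open>\<open>I\<close> in sheared coordinates. It contains the distinguished
      function \<open>f\<close>, so Weierstrass division makes the quotient finite over the Tate
      algebra in \<open>M\<close> variables.\<close>
    define J where "J = {G. (\<lambda>x. G (shift M w x)) \<in> I}"
    have J: "tate_ideal (Suc M) J"
      unfolding J_def by (rule tate_ideal_compose[OF I, of "shift M v"])
        (simp_all only: polyfun_shift shift_polydisc[OF v] shift_polydisc[OF w] inv)
    have J1: "(\<lambda>_. 1) \<notin> J" using Suc.prems(2) by (simp add: J_def)
    define f where "f x = a * F (shift M v x)" for x
    have fJ: "f \<in> J" using tate_ideal_cmult[OF I F] by (simp add: J_def f_def inv)
    have "\<exists>s. (\<forall>j<k. s j \<in> tate M) \<and> (\<lambda>x. g x - (\<Sum>j<k. s j x * x M ^ j)) \<in> J"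
      if "g \<in> tate (Suc M)" for g
    proof -
      have W: "\<exists>q\<in>tate (Suc M). \<exists>s. (\<forall>j<k. s j \<in> tate M) \<and>
          (\<forall>x\<in>polydisc. g x = q x * f x + (\<Sum>j<k. s j x * x M ^ j))"
        by (rule Weierstrass_division[OF A tate_idealD(1)[OF J fJ] dist[folded f_def] \<delta> that])
      obtain q s where q: "q \<in> tate (Suc M)" and s: "\<forall>j<k. s j \<in> tate M"
        "\<And>x. x \<in> polydisc \<Longrightarrow> g x = q x * f x + (\<Sum>j<k. s j x * x M ^ j)"
        using W by blast
      have "(\<lambda>x. g x - (\<Sum>j<k. s j x * x M ^ j)) \<in> J"
        using tate_idealD(4)[OF J fJ q] by (rule tate_idealD(5)[OF J]) (simp add: s(2))
      then show ?thesis using s(1) by blast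
    qed
    moreover obtain c where "c \<in> polydisc" "\<forall>F\<in>J \<inter> tate M. F c = 0"
      using Suc.IH[OF tate_ideal_restrict[OF J]] J1 by blast
    ultimately obtain c' where c': "c' \<in> polydisc" "\<forall>F\<in>J. F c' = 0"
      using exists_zero_above[OF J J1, of k c] by blast
    have "G (shift M v c') = 0" if "G \<in> I" for G
      using bspec[OF c'(2), of "\<lambda>x. G (shift M v x)"] that by (simp add: J_def inv)
    then show ?thesis using shift_polydisc[OF v c'(1)] by blast
  qed
qed

end

section \<open>Integral points of seminormed algebras\<close>

lemma polyrel_0_const:
  assumes "(\<phi>, u) \<in> polyrel e g 0"
    and "\<And>x y. e (x + y) = e x + e y" and "\<And>x y. e (x * y) = e x * e y"
  shows "\<exists>c. \<phi> = (\<lambda>_. c) \<and> u = e c"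
  using assms(1)
proof (induction rule: polyrel.induct)
  case (add \<phi> u \<psi> v)
  then obtain c c' where "\<phi> = (\<lambda>_. c)" "u = e c" "\<psi> = (\<lambda>_. c')" "v = e c'" by blast
  then show ?case by (intro exI[of _ "c + c'"]) (simp add: assms(2))
next
  case (mult \<phi> u \<psi> v)
  then obtain c c' where "\<phi> = (\<lambda>_. c)" "u = e c" "\<psi> = (\<lambda>_. c')" "v = e c'" by blast
  then show ?case by (intro exI[of _ "c * c'"]) (simp add: assms(3))
qed auto

context na_field
begin

context
  fixes e :: "'k \<Rightarrow> 'b::comm_ring_1" and L :: "'b set" and N :: "'b \<Rightarrow> real"
    and g :: "nat \<Rightarrow> 'b" and M :: nat
  assumes e: "e 0 = 0" "e 1 = 1" "\<And>x y. e (x + y) = e x + e y" "\<And>x y. e (x * y) = e x * e y"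
    and L: "\<And>c. e c \<in> L" "\<And>x y. x \<in> L \<Longrightarrow> y \<in> L \<Longrightarrow> x + y \<in> L" "\<And>x y. x \<in> L \<Longrightarrow> y \<in> L \<Longrightarrow> x * y \<in> L"
    and N: "\<And>c. N (e c) = av c" "\<And>x. x \<in> L \<Longrightarrow> 0 \<le> N x"
      "\<And>x y. x \<in> L \<Longrightarrow> y \<in> L \<Longrightarrow> N (x + y) \<le> max (N x) (N y)"
      "\<And>x y. x \<in> L \<Longrightarrow> y \<in> L \<Longrightarrow> N (x * y) \<le> N x * N y"
    and g: "\<And>i. i < M \<Longrightarrow> g i \<in> L" "\<And>i. i < M \<Longrightarrow> N (g i) \<le> 1"
begin

lemma polyrel_in_L: "(\<phi>, u) \<in> polyrel e g m \<Longrightarrow> m \<le> M \<Longrightarrow> u \<in> L"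
  by (induction rule: polyrel.induct) (auto intro: L g)

lemma power_in_L: "x \<in> L \<Longrightarrow> x ^ n \<in> L"
  using L(1)[of 1] e(2) by (induction n) (auto intro: L)

lemma N_power_le1: "x \<in> L \<Longrightarrow> N x \<le> 1 \<Longrightarrow> N (x ^ n) \<le> 1"
proof (induction n)
  case 0
  then show ?case using N(1)[of 1] e(2) by simp
next
  case (Suc n)
  have "N x * N (x ^ n) \<le> 1"
    using Suc N(2)[OF power_in_L[OF Suc.prems(1)], of n] N(2)[of x] by (intro mult_le_one) auto
  then show ?case using N(4)[OF Suc.prems(1) power_in_L[OF Suc.prems(1)], of n] by simp
qed

lemma N_sum_le:
  fixes n :: nat
  assumes "0 \<le> \<rho>" and "\<And>j. j < n \<Longrightarrow> f j \<in> L" and "\<And>j. j < n \<Longrightarrow> N (f j) \<le> \<rho>"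
  shows "(\<Sum>j<n. f j) \<in> L \<and> N (\<Sum>j<n. f j) \<le> \<rho>"
  using assms(2,3)
proof (induction n)
  case 0
  then show ?case using e(1) L(1)[of 0] N(1)[of 0] assms(1) by simp
next
  case (Suc n)
  then have "(\<Sum>j<n. f j) \<in> L" "N (\<Sum>j<n. f j) \<le> \<rho>" "f n \<in> L" "N (f n) \<le> \<rho>" by simp_all
  then show ?case using N(3)[of "\<Sum>j<n. f j" "f n"] L(2) by simp
qed

text \<open>Evaluation at \<open>g\<close> is contractive for the sup norm on the polydisc:
  expanding in the last variable, each coefficient is bounded by the same \<open>\<rho>\<close>, and
  powers of \<open>g m\<close> have norm at most 1.\<close>

lemma polyrel_bound:
  assumes "(\<phi>, u) \<in> polyrel e g m" and "m \<le> M" and "\<And>x. x \<in> polydisc \<Longrightarrow> av (\<phi> x) \<le> \<rho>"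
  shows "N u \<le> \<rho>"
  using assms
proof (induction m arbitrary: \<phi> u)
  case 0
  then obtain c where "\<phi> = (\<lambda>_. c)" "u = e c" using polyrel_0_const[OF 0(1) e(3,4)] by blast
  then show ?case using 0(3)[OF zero_in_polydisc] N(1) by simp
next
  case (Suc m)
  have \<rho>: "0 \<le> \<rho>" using Suc.prems(3)[OF zero_in_polydisc] av_nonneg order_trans by blast
  have m: "m < M" using Suc.prems(2) by simp
  obtain n r t where rt: "\<And>j. j < n \<Longrightarrow> (r j, t j) \<in> polyrel e g m"
    and \<phi>: "\<phi> = (\<lambda>x. \<Sum>j<n. r j x * x m ^ j)" and u: "u = (\<Sum>j<n. t j * g m ^ j)"
    using polyrel_Suc_expand[OF e(1,2) Suc.prems(1)] by blast
  have "av (r j x) \<le> \<rho>" if "j < n" "x \<in> polydisc" for j x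
    using polyfun_coeff_bound[of n r m \<rho> j x] polyfun_if_polyrel[OF rt] Suc.prems(3) that
    by (simp add: \<phi>)
  then have Nt: "N (t j) \<le> \<rho>" if "j < n" for j
    using Suc.IH[OF rt[OF that]] m that by simp
  have tL: "t j \<in> L" if "j < n" for j using polyrel_in_L[OF rt[OF that]] m by simp
  have gL: "g m ^ j \<in> L" "N (g m ^ j) \<le> 1" for j
    using g[OF m] power_in_L N_power_le1 by blast+
  have "N (t j * g m ^ j) \<le> \<rho>" if "j < n" for j
  proof -
    have "N (t j) * N (g m ^ j) \<le> \<rho> * 1"
      using Nt[OF that] gL N(2) tL[OF that] \<rho> by (intro mult_mono) auto
    then show ?thesis using N(4)[OF tL[OF that] gL(1), of j] by simp
  qed
  then show ?case unfolding u using \<rho> tL gL L(3) by (intro conjunct2[OF N_sum_le]) auto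
qed

text \<open>The kernel of evaluation at \<open>g\<close> from the Tate algebra to the completion of
  \<open>L\<close> under \<open>N\<close>: \<open>F\<close> is a uniform limit of polynomials whose
  values at \<open>g\<close> tend to 0.\<close>

definition relation_ideal :: "((nat \<Rightarrow> 'k) \<Rightarrow> 'k) set" where
  "relation_ideal = {F. \<forall>\<epsilon>>0. \<exists>\<phi> u. (\<phi>, u) \<in> polyrel e g M \<and> N u \<le> \<epsilon> \<and>
     (\<forall>x\<in>polydisc. av (F x - \<phi> x) \<le> \<epsilon>)}"

lemma relation_idealD:
  assumes "F \<in> relation_ideal" and "0 < \<epsilon>"
  obtains \<phi> u where "(\<phi>, u) \<in> polyrel e g M" and "N u \<le> \<epsilon>"
    and "\<And>x. x \<in> polydisc \<Longrightarrow> av (F x - \<phi> x) \<le> \<epsilon>"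
  using assms unfolding relation_ideal_def by blast

lemma tate_ideal_relation_ideal: "tate_ideal M relation_ideal"
  unfolding tate_ideal_def
proof (intro conjI ballI subsetI allI impI)
  fix F assume F: "F \<in> relation_ideal"
  show "F \<in> tate M"
    by (rule tateI) (metis relation_idealD[OF F] polyfun_if_polyrel)
next
  have "(\<lambda>_. 0, e 0) \<in> polyrel e g M" by (rule polyrel.const)
  then show "(\<lambda>_. 0) \<in> relation_ideal"
    unfolding relation_ideal_def using N(1)[of 0] by fastforce
next
  fix F G assume F: "F \<in> relation_ideal" and G: "G \<in> relation_ideal"
  show "(\<lambda>x. F x + G x) \<in> relation_ideal"
    unfolding relation_ideal_def
  proof (intro CollectI allI impI)
    fix \<epsilon> :: real assume \<epsilon>: "0 < \<epsilon>"
    obtain \<phi> u where \<phi>: "(\<phi>, u) \<in> polyrel e g M" "N u \<le> \<epsilon>"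
      "\<And>x. x \<in> polydisc \<Longrightarrow> av (F x - \<phi> x) \<le> \<epsilon>" by (rule relation_idealD[OF F \<epsilon>]) (rule that)
    obtain \<psi> v where \<psi>: "(\<psi>, v) \<in> polyrel e g M" "N v \<le> \<epsilon>"
      "\<And>x. x \<in> polydisc \<Longrightarrow> av (G x - \<psi> x) \<le> \<epsilon>" by (rule relation_idealD[OF G \<epsilon>]) (rule that)
    have "N (u + v) \<le> \<epsilon>"
      using N(3)[OF polyrel_in_L[OF \<phi>(1)] polyrel_in_L[OF \<psi>(1)]] \<phi>(2) \<psi>(2) by simp
    moreover have "av (F x + G x - (\<phi> x + \<psi> x)) \<le> \<epsilon>" if "x \<in> polydisc" for x
      using av_addI[OF \<phi>(3)[OF that] \<psi>(3)[OF that]] by (simp add: algebra_simps)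
    ultimately show "\<exists>\<phi> u. (\<phi>, u) \<in> polyrel e g M \<and> N u \<le> \<epsilon> \<and> (\<forall>x\<in>polydisc. av (F x + G x - \<phi> x) \<le> \<epsilon>)"
      using polyrel.add[OF \<phi>(1) \<psi>(1)]
      by (intro exI[of _ "\<lambda>x. \<phi> x + \<psi> x"] exI[of _ "u + v"] conjI ballI)
  qed
next
  fix F t assume F: "F \<in> relation_ideal" and t: "t \<in> tate M"
  show "(\<lambda>x. t x * F x) \<in> relation_ideal"
    unfolding relation_ideal_def
  proof (intro CollectI allI impI)
    fix \<epsilon> :: real assume \<epsilon>: "0 < \<epsilon>"
    obtain B where B: "0 < B" "\<And>x. x \<in> polydisc \<Longrightarrow> av (t x) \<le> B" by (rule tate_bounded[OF t]) (rule that)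
    have "\<epsilon> / B > 0" using \<epsilon> B by simp
    then obtain \<phi> u where \<phi>: "(\<phi>, u) \<in> polyrel e g M" "N u \<le> \<epsilon> / B"
      "\<And>x. x \<in> polydisc \<Longrightarrow> av (F x - \<phi> x) \<le> \<epsilon> / B" by (rule relation_idealD[OF F]) (rule that)
    obtain C where C: "0 < C" "\<forall>x\<in>polydisc. av (\<phi> x) \<le> C"
      using polyfun_bounded[OF polyfun_if_polyrel[OF \<phi>(1)]] by blast
    \<comment> \<open>The bound \<open>B\<close> makes \<open>\<psi>\<close> inherit the bound of
      \<open>t\<close>, so that \<open>N v \<le> B\<close>; the bound \<open>\<epsilon> / C\<close>
      controls the error multiplied by \<open>\<phi>\<close>.\<close>
    have "min B (\<epsilon> / C) > 0" using \<epsilon> B C by simp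
    then obtain \<psi> where \<psi>: "\<psi> \<in> polyfun M" "\<And>x. x \<in> polydisc \<Longrightarrow> av (t x - \<psi> x) \<le> min B (\<epsilon> / C)"
      by (rule tateD[OF t]) (rule that)
    obtain v where v: "(\<psi>, v) \<in> polyrel e g M" using polyrel_if_polyfun[OF \<psi>(1)] by blast
    have "av (\<psi> x) \<le> B" if "x \<in> polydisc" for x
      using av_diffI[of "t x" B "t x - \<psi> x"] B(2)[OF that] \<psi>(2)[OF that] by simp
    then have "N v \<le> B" using polyrel_bound[OF v] by simp
    have uv: "u \<in> L" "v \<in> L" using polyrel_in_L \<phi>(1) v by blast+
    have "N v * N u \<le> B * (\<epsilon> / B)"
      using \<open>N v \<le> B\<close> \<phi>(2) B(1) N(2) uv by (intro mult_mono) auto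
    then have "N (v * u) \<le> \<epsilon>" using N(4)[OF uv(2,1)] B(1) by simp
    moreover have "av (t x * F x - \<psi> x * \<phi> x) \<le> \<epsilon>" if x: "x \<in> polydisc" for x
    proof -
      have "av (t x * (F x - \<phi> x)) \<le> \<epsilon>"
        using av_multI[OF B(2)[OF x] \<phi>(3)[OF x]] B(1) by simp
      moreover have "av ((t x - \<psi> x) * \<phi> x) \<le> \<epsilon>"
        using av_multI[of "t x - \<psi> x" "\<epsilon> / C" "\<phi> x" C] \<psi>(2)[OF x] C x by simp
      moreover have "t x * F x - \<psi> x * \<phi> x = t x * (F x - \<phi> x) + (t x - \<psi> x) * \<phi> x"
        by (simp add: algebra_simps)
      ultimately show ?thesis by (metis av_addI)
    qed
    ultimately show "\<exists>\<phi> u. (\<phi>, u) \<in> polyrel e g M \<and> N u \<le> \<epsilon> \<and> (\<forall>x\<in>polydisc. av (t x * F x - \<phi> x) \<le> \<epsilon>)"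
      using polyrel.mult[OF v \<phi>(1)]
      by (intro exI[of _ "\<lambda>x. \<psi> x * \<phi> x"] exI[of _ "v * u"] conjI ballI)
  qed
next
  fix F G assume "F \<in> relation_ideal" "\<forall>x\<in>polydisc. G x = F x"
  then show "G \<in> relation_ideal" unfolding relation_ideal_def by simp
qed

lemma polyrel_diff:
  assumes "(\<phi>, u) \<in> polyrel e g M" and "(\<psi>, v) \<in> polyrel e g M"
  shows "(\<lambda>x. \<phi> x - \<psi> x, u - v) \<in> polyrel e g M"
proof -
  have "e 1 + e (-1) = 0" using e(1) e(3)[of 1 "-1"] by simp
  then have "e (- 1) = - 1" using e(2) by (simp add: add_eq_0_iff)
  then show ?thesis
    using polyrel.add[OF assms(1) polyrel.mult[OF polyrel.const[of "-1"] assms(2)]] by simp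
qed

text \<open>An approximant of 1 within 1/2 whose value \<open>u\<close> has norm at most 1/2 would
  give \<open>N (e 1 - u) \<le> 1/2\<close> by contractivity, hence
  \<open>N (e 1) \<le> 1/2\<close>, although this norm is 1.\<close>

lemma relation_ideal_proper: "(\<lambda>_. 1) \<notin> relation_ideal"
proof
  assume "(\<lambda>_. 1) \<in> relation_ideal"
  then obtain \<phi> u where \<phi>: "(\<phi>, u) \<in> polyrel e g M" "N u \<le> 1/2"
    "\<And>x. x \<in> polydisc \<Longrightarrow> av (1 - \<phi> x) \<le> 1/2" using relation_idealD[of "\<lambda>_. 1" "1/2"] by auto
  have D: "(\<lambda>x. 1 - \<phi> x, e 1 - u) \<in> polyrel e g M" by (rule polyrel_diff[OF polyrel.const \<phi>(1)])
  then have "N (e 1 - u) \<le> 1/2" using polyrel_bound \<phi>(3) by blast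
  moreover have "N (e 1 - u + u) \<le> max (N (e 1 - u)) (N u)"
    by (intro N(3) polyrel_in_L[OF D] polyrel_in_L[OF \<phi>(1)]) auto
  ultimately show False using \<phi>(2) N(1)[of 1] by simp
qed

text \<open>The second clause says that evaluation at \<open>c\<close> factors through the
  subalgebra generated by the \<open>g i\<close>, that is, \<open>c\<close> is a point of that
  algebra. It holds because \<open>\<phi> - \<psi>\<close> has value 0 at \<open>g\<close> and so
  lies in \<open>relation_ideal\<close>.\<close>

lemma exists_integral_point:
  obtains c where "c \<in> polydisc"
    and "\<And>\<phi> \<psi> u. (\<phi>, u) \<in> polyrel e g M \<Longrightarrow> (\<psi>, u) \<in> polyrel e g M \<Longrightarrow> \<phi> c = \<psi> c"
proof -
  obtain c where c: "c \<in> polydisc" "\<forall>F\<in>relation_ideal. F c = 0"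
    using Nullstellensatz[OF tate_ideal_relation_ideal relation_ideal_proper] by blast
  have "\<phi> c = \<psi> c" if "(\<phi>, u) \<in> polyrel e g M" "(\<psi>, u) \<in> polyrel e g M" for \<phi> \<psi> u
  proof -
    have "(\<lambda>x. \<phi> x - \<psi> x, e 0) \<in> polyrel e g M"
      using polyrel_diff[OF that] e(1) by simp
    then have "(\<lambda>x. \<phi> x - \<psi> x) \<in> relation_ideal"
      unfolding relation_ideal_def using N(1)[of 0] by fastforce
    then show ?thesis using c(2) by fastforce
  qed
  then show ?thesis using that c(1) by blast
qed

end

section \<open>Density of the rational points\<close>

lemma av_of_nat: "av (of_nat n) \<le> 1"
  by (induction n) (auto intro!: av_addI)

context
  fixes e :: "'k \<Rightarrow> 'a::idom" and s :: "'a \<Rightarrow> real"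
  assumes e: "is_ring_hom e"
    and s_nonneg: "\<And>f. 0 \<le> s f" and s0: "s 0 = 0" and s1: "s 1 = 1"
    and s_mult: "\<And>f g. s (f * g) = s f * s g" and s_add: "\<And>f g. s (f + g) \<le> s f + s g"
    and s_e: "\<And>c. s (e c) = av c"
begin

lemma e_hom: "e 0 = 0" "e 1 = 1" "e (x + y) = e x + e y" "e (x * y) = e x * e y"
  using e by (auto simp: is_ring_hom_def)

lemma s_power: "s (f ^ n) = s f ^ n"
  by (induction n) (auto simp: s1 s_mult)

lemma s_of_nat: "s (of_nat n) \<le> 1"
proof -
  have "e (of_nat n) = of_nat n" by (induction n) (auto simp: e_hom)
  then show ?thesis using av_of_nat[of n] s_e by metis
qed

lemma s_sum: "s (sum h S) \<le> (\<Sum>i\<in>S. s (h i))"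
proof (induction S rule: infinite_finite_induct)
  case (insert x F)
  then show ?case using s_add[of "h x" "sum h F"] by simp
qed (auto simp: s0)

text \<open>Points of \<open>Xan\<close> are only required to satisfy the triangle inequality.
  Integers have seminorm at most 1, so the binomial theorem bounds the \<open>n\<close>-th power of
  \<open>s (f + g)\<close> by \<open>n + 1\<close> times that of the maximum; a linear factor cannot
  offset exponential growth.\<close>

lemma s_ultrametric: "s (f + g) \<le> max (s f) (s g)"
proof (rule ccontr)
  define m where "m = max (s f) (s g)"
  assume "\<not> ?thesis"
  then have less: "m < s (f + g)" by (simp only: m_def not_le)
  have m0: "0 \<le> m" unfolding m_def using s_nonneg[of f] by simp
  define q where "q = m / s (f + g)"
  have q: "0 \<le> q" "q < 1" using less m0 by (auto simp: q_def)
  have "s (f + g) ^ n \<le> real (n + 1) * m ^ n" for n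
  proof -
    have "s (f + g) ^ n = s (\<Sum>k\<le>n. of_nat (n choose k) * f ^ k * g ^ (n - k))"
      by (simp add: s_power[symmetric] binomial_ring)
    also have "\<dots> \<le> (\<Sum>k\<le>n. s (of_nat (n choose k) * f ^ k * g ^ (n - k)))" by (rule s_sum)
    also have "\<dots> \<le> (\<Sum>k\<le>n. 1 * m ^ k * m ^ (n - k))"
      unfolding s_mult s_power
      by (intro sum_mono mult_mono s_of_nat power_mono)
        (auto simp: m_def s_nonneg le_max_iff_disj intro!: mult_nonneg_nonneg zero_le_power)
    also have "\<dots> = (\<Sum>k\<le>n. m ^ n)" by (intro sum.cong) (auto simp flip: power_add)
    finally show ?thesis by simp
  qed
  then have ge1: "1 \<le> real (n + 1) * q ^ n" for n
    using less m0 by (simp add: q_def power_divide field_simps)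
  have "(\<lambda>n. real n * q ^ n + q ^ n) \<longlonglongrightarrow> 0 + 0"
    using q by (intro tendsto_add LIMSEQ_power_zero powser_times_n_limit_0) auto
  then have "(1::real) \<le> 0 + 0"
    by (rule LIMSEQ_le_const) (use ge1 in \<open>auto simp: algebra_simps\<close>)
  then show False by simp
qed

text \<open>The seminorm may vanish on nonzero functions. It therefore extends only to the
  localisation at the complement of its kernel, a prime ideal, and not to the whole fraction
  field.\<close>

definition loc :: "'a fract set" where
  "loc = {Fract a b | a b. s b \<noteq> 0}"

text \<open>Meaningful on \<^term>\<open>loc\<close> only; elsewhere an arbitrary value.\<close>
definition loc_norm :: "'a fract \<Rightarrow> real" where
  "loc_norm q = (SOME r. \<exists>a b. s b \<noteq> 0 \<and> q = Fract a b \<and> r = s a / s b)"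

lemma nonzero_if_s: "s b \<noteq> 0 \<Longrightarrow> b \<noteq> 0"
  using s0 by auto

lemma loc_norm_Fract: 
  assumes "s b \<noteq> 0"
  shows "loc_norm (Fract a b) = s a / s b"
proof -
  have "\<exists>a' b'. s b' \<noteq> 0 \<and> Fract a b = Fract a' b' \<and> loc_norm (Fract a b) = s a' / s b'"
    unfolding loc_norm_def by (rule someI[of _ "s a / s b"]) (use assms in blast)
  then obtain a' b' where *: "s b' \<noteq> 0" "Fract a b = Fract a' b'" "loc_norm (Fract a b) = s a' / s b'"
    by blast
  then have "a * b' = a' * b" using assms nonzero_if_s by (simp add: eq_fract)
  then have "s a * s b' = s a' * s b" by (metis s_mult)
  then show ?thesis unfolding *(3) using *(1) assms by (simp add: frac_eq_eq)
qed

lemma Fract_in_loc: "s b \<noteq> 0 \<Longrightarrow> Fract a b \<in> loc"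
  by (auto simp: loc_def)

lemma locE:
  assumes "x \<in> loc"
  obtains a b where "s b \<noteq> 0" and "b \<noteq> 0" and "x = Fract a b" and "loc_norm x = s a / s b"
  using assms loc_norm_Fract nonzero_if_s unfolding loc_def by blast

text \<open>The generators \<open>f i / a i\<close> and \<open>b i / f i\<close> have seminorm at
  most 1 when \<open>av (a i)\<close> lies slightly above and \<open>av (b i)\<close> slightly below
  \<open>s (f i)\<close>. An integral point then satisfies
  \<open>av (b i) \<le> av (p (f i)) \<le> av (a i)\<close>. Where \<open>s (f i) = 0\<close> the
  upper bound suffices, and the second generator is set to 0.\<close>

lemma exists_close_point:
  assumes gen: "gen_subalg e fs = UNIV" and d: "0 < d"
  shows "\<exists>p\<in>Kpoints e. \<forall>i<length fs. \<bar>av (p (fs ! i)) - s (fs ! i)\<bar> < d"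
proof -
  define m where "m = length fs"
  define f where "f i = fs ! i" for i
  have "\<forall>i. \<exists>a. s (f i) < av a \<and> av a < s (f i) + d"
  proof
    fix i
    \<comment> \<open>\<open>value_dense\<close> needs a positive left end, and
      \<open>s (f i)\<close> may be 0.\<close>
    obtain a where "s (f i) + d / 2 < av a" "av a < s (f i) + d"
      using value_dense[of "s (f i) + d / 2" "s (f i) + d"] d s_nonneg[of "f i"] by auto
    then show "\<exists>a. s (f i) < av a \<and> av a < s (f i) + d" using d by (intro exI[of _ a]) simp
  qed
  then obtain a where a: "\<And>i. s (f i) < av (a i)" "\<And>i. av (a i) < s (f i) + d" by metis
  have a0: "a i \<noteq> 0" for i using a(1)[of i] s_nonneg[of "f i"] by auto
  have "\<forall>i. \<exists>b. s (f i) \<noteq> 0 \<longrightarrow> s (f i) - d < av b \<and> av b < s (f i)"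
  proof (intro allI)
    fix i
    show "\<exists>b. s (f i) \<noteq> 0 \<longrightarrow> s (f i) - d < av b \<and> av b < s (f i)"
    proof (cases "s (f i) = 0")
      case False
      then have "0 < s (f i)" using s_nonneg[of "f i"] by simp
      then have "0 < max (s (f i) / 2) (s (f i) - d)" "max (s (f i) / 2) (s (f i) - d) < s (f i)"
        using d by (simp_all add: less_max_iff_disj)
      from value_dense[OF this] show ?thesis by auto
    qed simp
  qed
  then obtain b where b: "\<And>i. s (f i) \<noteq> 0 \<Longrightarrow> s (f i) - d < av (b i)"
    "\<And>i. s (f i) \<noteq> 0 \<Longrightarrow> av (b i) < s (f i)" by metis
  define E where "E c = Fract (e c) 1" for c
  \<comment> \<open>The first \<open>m\<close> variables bound the \<open>f i\<close> from above, the last \<open>m\<close> from below.\<close>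
  define g where "g i = (if i < m then Fract (e (1 / a i) * f i) 1
      else if s (f (i - m)) \<noteq> 0 then Fract (e (b (i - m))) (f (i - m)) else 0)" for i
  have zero_loc: "(0 :: 'a fract) \<in> loc" "loc_norm 0 = 0"
    using Fract_in_loc[of 1 0] loc_norm_Fract[of 1 0] by (auto simp: s0 s1 Zero_fract_def)
  obtain c where c: "c \<in> polydisc" and uniq:
    "\<And>\<phi> \<psi> u. (\<phi>, u) \<in> polyrel E g (2 * m) \<Longrightarrow> (\<psi>, u) \<in> polyrel E g (2 * m) \<Longrightarrow> \<phi> c = \<psi> c"
  proof (rule exists_integral_point[of E loc loc_norm "2 * m" g])
    show "E 0 = 0" "E 1 = 1" "\<And>x y. E (x + y) = E x + E y" "\<And>x y. E (x * y) = E x * E y"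
      by (simp_all add: E_def e_hom Zero_fract_def One_fract_def)
    show "\<And>c. E c \<in> loc" "\<And>c. loc_norm (E c) = av c"
      by (simp_all add: E_def Fract_in_loc loc_norm_Fract s1 s_e)
    show "0 \<le> loc_norm x" if "x \<in> loc" for x
      by (rule locE[OF that]) (simp add: s_nonneg)
    fix x y :: "'a fract" assume "x \<in> loc" "y \<in> loc"
    then obtain u v u' v' where x: "s v \<noteq> 0" "v \<noteq> 0" "x = Fract u v" "loc_norm x = s u / s v"
      and y: "s v' \<noteq> 0" "v' \<noteq> 0" "y = Fract u' v'" "loc_norm y = s u' / s v'"
      by (metis locE)
    have xy: "x * y = Fract (u * u') (v * v')" "x + y = Fract (u * v' + u' * v) (v * v')"
      using x y by simp_all
    have svv: "s (v * v') \<noteq> 0" using x y by (simp add: s_mult)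
    show "x + y \<in> loc" "x * y \<in> loc" unfolding xy using svv by (intro Fract_in_loc; simp)+
    show "loc_norm (x * y) \<le> loc_norm x * loc_norm y"
      unfolding xy loc_norm_Fract[OF svv] x(4) y(4) by (simp add: s_mult)
    have sv: "0 < s v" "0 < s v'" using x(1) y(1) s_nonneg by (metis less_eq_real_def)+
    have "s (u * v' + u' * v) / s (v * v') \<le> max (s (u * v')) (s (u' * v)) / s (v * v')"
      using s_ultrametric s_nonneg by (intro divide_right_mono)
    also have "\<dots> = max (s u / s v) (s u' / s v')"
      using sv by (simp add: s_mult max_divide_distrib_right)
    finally show "loc_norm (x + y) \<le> max (loc_norm x) (loc_norm y)"
      unfolding xy loc_norm_Fract[OF svv] x(4) y(4) .
  next
    fix i assume "i < 2 * m"
    show "g i \<in> loc"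
      by (auto simp: g_def Fract_in_loc s1 zero_loc)
    have "s (e (1 / a i) * f i) \<le> 1"
      using a(1)[of i] a0[of i] by (simp add: s_mult s_e av_divide av_pos divide_le_eq)
    moreover have "s (e (b j)) / s (f j) \<le> 1" if "s (f j) \<noteq> 0" for j
      using b(2)[OF that] s_nonneg[of "f j"] that by (simp add: s_e divide_le_eq)
    ultimately show "loc_norm (g i) \<le> 1"
      by (auto simp: g_def loc_norm_Fract s1 zero_loc)
  qed (rule that)
  have rf: "(\<lambda>x. a i * x i, Fract (f i) 1) \<in> polyrel E g (2 * m)" if "i < m" for i
  proof -
    have ea: "e (a i) * e (1 / a i) = 1"
      using a0[of i] e_hom(2) by (simp flip: e_hom(4))
    have "E (a i) * g i = Fract (f i) 1"
      using that ea by (simp add: E_def g_def mult.assoc[symmetric])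
    then show ?thesis
      using polyrel.mult[OF polyrel.const[of "a i"] polyrel.var[of i "2 * m"], of E g] that by simp
  qed
  \<comment> \<open>Because \<open>f i\<close> is \<open>a i\<close> times a generator, every
    function is a polynomial in the \<open>g i\<close> and acquires a value at
    \<open>c\<close>.\<close>
  have "\<exists>\<phi>. (\<phi>, Fract x 1) \<in> polyrel E g (2 * m)" if "x \<in> gen_subalg e fs" for x
    using that
  proof (induction rule: gen_subalg.induct)
    case (const c)
    show ?case by (rule exI) (rule polyrel.const[of c E g "2 * m", unfolded E_def[of c]])
  next
    case (gen i)
    then show ?case using rf[of i] by (auto simp: f_def m_def)
  next
    case (add x y)
    then obtain \<phi> \<psi> where "(\<phi>, Fract x 1) \<in> polyrel E g (2 * m)" "(\<psi>, Fract y 1) \<in> polyrel E g (2 * m)"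
      by blast
    from polyrel.add[OF this] show ?case by auto
  next
    case (mult x y)
    then obtain \<phi> \<psi> where "(\<phi>, Fract x 1) \<in> polyrel E g (2 * m)" "(\<psi>, Fract y 1) \<in> polyrel E g (2 * m)"
      by blast
    from polyrel.mult[OF this] show ?case by auto
  qed
  then have "\<forall>x. \<exists>\<phi>. (\<phi>, Fract x 1) \<in> polyrel E g (2 * m)" using gen by auto
  then obtain \<Phi> where \<Phi>: "\<And>x. (\<Phi> x, Fract x 1) \<in> polyrel E g (2 * m)" by metis
  define p where "p x = \<Phi> x c" for x
  \<comment> \<open>Independence of the chosen polynomial turns the closure of
    \<open>polyrel\<close> under sums and products into the homomorphism laws for
    \<open>p\<close>.\<close>
  have p: "p x = \<phi> c" if "(\<phi>, Fract x 1) \<in> polyrel E g (2 * m)" for x \<phi>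
    unfolding p_def using uniq[OF \<Phi> that] .
  have "p (e k) = k" for k
    using p[OF polyrel.const[of k E g "2 * m", unfolded E_def[of k]]] .
  moreover have "p (x + y) = p x + p y" for x y
    using p[of "\<lambda>z. \<Phi> x z + \<Phi> y z" "x + y"] polyrel.add[OF \<Phi>[of x] \<Phi>[of y]] by (simp add: p_def)
  moreover have "p (x * y) = p x * p y" for x y
    using p[of "\<lambda>z. \<Phi> x z * \<Phi> y z" "x * y"] polyrel.mult[OF \<Phi>[of x] \<Phi>[of y]] by (simp add: p_def)
  ultimately have "p \<in> Kpoints e" by (simp add: Kpoints_def)
  moreover have "\<bar>av (p (fs ! i)) - s (fs ! i)\<bar> < d" if i: "i < length fs" for i
  proof -
    have im: "i < m" using i by (simp add: m_def)
    have pf: "p (f i) = a i * c i" using p[OF rf[OF im]] .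
    have "av (p (f i)) \<le> av (a i)" unfolding pf using c by (intro av_mult_le1I order_refl polydiscD)
    then have up: "av (p (f i)) < s (f i) + d" using a(2)[of i] by simp
    have "s (f i) - d < av (p (f i))"
    proof (cases "s (f i) = 0")
      case True
      then show ?thesis using d av_nonneg[of "p (f i)"] by linarith
    next
      case False
      \<comment> \<open>The relation \<open>(b i / f i) * f i = b i\<close> persists at
        \<open>c\<close>, and \<open>c (m + i)\<close> is integral; this gives the lower
        bound.\<close>
      have "g (m + i) * Fract (f i) 1 = E (b i)"
        using False nonzero_if_s[OF False] by (simp add: g_def E_def eq_fract)
      then have "(\<lambda>x. x (m + i) * (a i * x i), E (b i)) \<in> polyrel E g (2 * m)"
        using polyrel.mult[OF polyrel.var[of "m + i" "2 * m" g E] rf[OF im]] im by simp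
      from uniq[OF this polyrel.const] have "b i = c (m + i) * p (f i)" by (simp add: pf)
      then have "av (b i) \<le> av (p (f i))"
        using av_mult_le1I[OF order_refl polydiscD[OF c, of "m + i"], of "p (f i)"] by (simp add: mult.commute)
      then show ?thesis using b(1)[OF False] by simp
    qed
    then show ?thesis using up by (simp add: f_def abs_less_iff)
  qed
  ultimately show ?thesis by blast
qed

end
end

section \<open>Extended real coordinates\<close>

text \<open>The inverse of \<open>neglog\<close>. Conditions on tropicalizations are written in
  these real coordinates, where sums, differences and products are continuous also at infinite
  points.\<close>

definition expneg :: "ereal \<Rightarrow> real" where
  "expneg x = (if x = \<infinity> then 0 else exp (- real_of_ereal x))"

lemma expneg_nonneg: "0 \<le> expneg x"
  by (simp add: expneg_def)

lemma absv_eq_expneg: "absv \<nu> c = expneg (\<nu> c)"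
  by (simp add: absv_def expneg_def)

lemma neglog_expneg: "x \<noteq> -\<infinity> \<Longrightarrow> neglog (expneg x) = x"
  by (cases x) (auto simp: neglog_def expneg_def)

lemma expneg_neglog: "0 \<le> r \<Longrightarrow> expneg (neglog r) = r"
  by (auto simp: neglog_def expneg_def)

lemma neglog_not_MInf: "neglog r \<noteq> -\<infinity>"
  by (simp add: neglog_def)

lemma expneg_eq_iff: "x \<noteq> -\<infinity> \<Longrightarrow> y \<noteq> -\<infinity> \<Longrightarrow> expneg x = expneg y \<longleftrightarrow> x = y"
  by (metis neglog_expneg)

lemma continuous_on_neglog: "continuous_on {0..} neglog"
  unfolding continuous_on_def
proof
  fix r :: real assume r: "r \<in> {0..}"
  show "(neglog \<longlongrightarrow> neglog r) (at r within {0..})"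
  proof (cases "r = 0")
    case True
    have "\<forall>\<^sub>F t in at r within {0..}. ereal M < neglog t" for M
      unfolding eventually_at
    proof (intro exI[of _ "exp (- M)"] conjI ballI impI)
      fix t :: real assume t: "t \<in> {0..}" "t \<noteq> r \<and> dist t r < exp (- M)"
      then have "0 < t" "t < exp (- M)" using True by (auto simp: dist_real_def)
      then have "ln t < - M" by (metis exp_gt_zero ln_exp ln_less_cancel_iff)
      then show "ereal M < neglog t" using \<open>0 < t\<close> by (simp add: neglog_def)
    qed simp
    then have "(neglog \<longlongrightarrow> \<infinity>) (at r within {0..})" by (simp add: tendsto_PInfty)
    then show ?thesis using True by (simp add: neglog_def)
  next
    case False
    then have "0 < r" using r by simp
    then have ev: "\<forall>\<^sub>F t in at r within {0..}. ereal (- ln t) = neglog t"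
      unfolding eventually_at by (intro exI[of _ r]) (auto simp: neglog_def dist_real_def)
    have "((\<lambda>t. ereal (- ln t)) \<longlongrightarrow> ereal (- ln r)) (at r within {0..})"
      using False by (intro tendsto_intros) auto
    then have "(neglog \<longlongrightarrow> ereal (- ln r)) (at r within {0..})"
      by (rule Lim_transform_eventually[OF _ ev])
    then show ?thesis using False by (simp add: neglog_def)
  qed
qed

lemma continuous_on_expneg: "continuous_on {x. x \<noteq> -\<infinity>} expneg"
  unfolding continuous_on_def
proof
  fix x :: ereal assume x: "x \<in> {x. x \<noteq> -\<infinity>}"
  show "(expneg \<longlongrightarrow> expneg x) (at x within {x. x \<noteq> -\<infinity>})"
  proof (cases "x = \<infinity>")
    case True
    have "(expneg \<longlongrightarrow> 0) (at x within {x. x \<noteq> -\<infinity>})"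
    proof (rule order_tendstoI)
      fix a :: real assume "a < 0"
      then have "a < expneg y" for y using expneg_nonneg[of y] by linarith
      then show "\<forall>\<^sub>F y in at x within {x. x \<noteq> -\<infinity>}. a < expneg y" by simp
    next
      fix a :: real assume a: "0 < a"
      have "\<forall>\<^sub>F y in at x within {x. x \<noteq> -\<infinity>}. ereal (- ln a) < y"
        using True by (intro order_tendstoD(1)[OF tendsto_ident_at]) auto
      then show "\<forall>\<^sub>F y in at x within {x. x \<noteq> -\<infinity>}. expneg y < a"
      proof eventually_elim
        case (elim y)
        then show ?case
        proof (cases y)
          case (real r)
          then have "exp (- r) < exp (ln a)" using elim by (subst exp_less_cancel_iff) simp
          then show ?thesis using real a by (simp add: expneg_def)
        qed (use a in \<open>auto simp: expneg_def\<close>)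
      qed
    qed
    then show ?thesis using True by (simp add: expneg_def)
  next
    case False
    then have fin: "\<bar>x\<bar> \<noteq> \<infinity>" using x by auto
    have ev: "\<forall>\<^sub>F y in at x within {x. x \<noteq> -\<infinity>}. exp (- real_of_ereal y) = expneg y"
    proof -
      have "\<forall>\<^sub>F y in at x within {x. x \<noteq> -\<infinity>}. y < \<infinity>"
        using False by (intro order_tendstoD(2)[OF tendsto_ident_at]) auto
      then show ?thesis by eventually_elim (auto simp: expneg_def)
    qed
    obtain r where r: "x = ereal r" using fin by (cases x) auto
    have "((\<lambda>y. real_of_ereal y) \<longlongrightarrow> r) (at x within {x. x \<noteq> -\<infinity>})"
      unfolding r by (intro lim_real_of_ereal tendsto_ident_at)
    then have "((\<lambda>y. exp (- real_of_ereal y)) \<longlongrightarrow> exp (- r)) (at x within {x. x \<noteq> -\<infinity>})"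
      by (intro tendsto_exp tendsto_minus)
    then have "(expneg \<longlongrightarrow> exp (- r)) (at x within {x. x \<noteq> -\<infinity>})"
      by (rule Lim_transform_eventually[OF _ ev])
    then show ?thesis using r by (simp add: expneg_def)
  qed
qed

lemma topspace_Rtop: "topspace Rtop = {x. x \<noteq> -\<infinity>}"
  by (simp add: Rtop_def)

lemma topspace_Rm: "topspace (Rm m) = {..<m} \<rightarrow>\<^sub>E {x. x \<noteq> -\<infinity>}"
  by (simp add: Rm_def topspace_Rtop)

lemma continuous_map_neglog: "continuous_map (top_of_set {0..}) Rtop neglog"
  unfolding Rtop_def continuous_map_in_subtopology
  using continuous_on_neglog neglog_not_MInf by auto

lemma continuous_map_expneg: "continuous_map Rtop euclideanreal expneg"
  unfolding Rtop_def using continuous_on_expneg by simp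

lemma continuous_map_coordinate: "i < m \<Longrightarrow> continuous_map (Rm m) Rtop (\<lambda>x. x i)"
  unfolding Rm_def by (rule continuous_map_product_projection) simp

lemma continuous_map_expneg_coordinate:
  "i < m \<Longrightarrow> continuous_map (Rm m) euclideanreal (\<lambda>x. expneg (x i))"
  using continuous_map_compose[OF continuous_map_coordinate continuous_map_expneg]
  by (simp add: o_def)

lemma continuous_map_select:
  "(\<And>j. j < n \<Longrightarrow> \<sigma> j < m) \<Longrightarrow> continuous_map (Rm m) (Rm n) (\<lambda>x. \<lambda>j\<in>{..<n}. x (\<sigma> j))"
  by (subst (2) Rm_def) (auto simp: continuous_map_componentwise intro: continuous_map_coordinate)

section \<open>Valuations as absolute values\<close>

lemma na_field_absv:
  fixes \<nu> :: "'k::field \<Rightarrow> ereal"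
  assumes v: "valuation \<nu>" and nt: "nontrivial_valuation \<nu>" and c: "complete_valuation \<nu>"
    and ac: "alg_closed_field TYPE('k)"
  shows "na_field (absv \<nu>)"
proof
  have v_inf: "\<nu> x = \<infinity> \<longleftrightarrow> x = 0" and v_minf: "\<nu> x \<noteq> -\<infinity>"
    and v_mult: "\<nu> (x * y) = \<nu> x + \<nu> y" and v_add: "min (\<nu> x) (\<nu> y) \<le> \<nu> (x + y)" for x y
    using v unfolding valuation_def by blast+
  show 0: "0 \<le> absv \<nu> x" for x by (simp add: absv_def)
  show eq0: "absv \<nu> x = 0 \<longleftrightarrow> x = 0" for x by (simp add: absv_def v_inf)
  show "absv \<nu> (x * y) = absv \<nu> x * absv \<nu> y" for x y
    using v_mult[of x y] v_minf[of x] v_minf[of y]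
    by (cases "\<nu> x"; cases "\<nu> y") (auto simp: absv_def exp_add[symmetric])
  have anti: "expneg b \<le> expneg a" if "a \<le> b" "a \<noteq> -\<infinity>" for a b
    using that by (cases a; cases b) (auto simp: expneg_def)
  show "absv \<nu> (x + y) \<le> max (absv \<nu> x) (absv \<nu> y)" for x y
  proof (cases "\<nu> x \<le> \<nu> y")
    case True
    then show ?thesis using anti[of "\<nu> x" "\<nu> (x + y)"] v_add[of x y] v_minf[of x]
      by (simp add: absv_eq_expneg min_def le_max_iff_disj)
  next
    case False
    then show ?thesis using anti[of "\<nu> y" "\<nu> (x + y)"] v_add[of x y] v_minf[of y]
      by (simp add: absv_eq_expneg min_def le_max_iff_disj)
  qed
  show "\<exists>x. 0 < absv \<nu> x \<and> absv \<nu> x < 1"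
  proof -
    obtain x where x: "x \<noteq> 0" "\<nu> x \<noteq> 0" using nt unfolding nontrivial_valuation_def by blast
    obtain r where r: "\<nu> x = ereal r" using v_inf[of x] v_minf[of x] x(1) by (cases "\<nu> x") auto
    have one: "\<nu> 1 = 0"
      using v_mult[of 1 1] v_inf[of 1] v_minf[of 1] by (cases "\<nu> 1") auto
    have inv: "\<nu> (1 / x) = ereal (- r)"
      using v_mult[of x "1 / x"] one x(1) r by (cases "\<nu> (1 / x)") auto
    show ?thesis
    proof (cases "r > 0")
      case True
      then show ?thesis using r by (intro exI[of _ x]) (simp add: absv_def)
    next
      case False
      then have "r < 0" using x(2) r by (cases "r = 0") auto
      then show ?thesis using inv by (intro exI[of _ "1 / x"]) (simp add: absv_def)
    qed
  qed
  have le_iff: "absv \<nu> x \<le> exp (- M) \<longleftrightarrow> ereal M \<le> \<nu> x" for x M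
    using v_minf[of x] by (cases "\<nu> x") (auto simp: absv_def)
  show "\<exists>l. \<forall>\<epsilon>>0. \<exists>N. \<forall>n\<ge>N. absv \<nu> (s n - l) \<le> \<epsilon>"
    if "\<And>\<epsilon>. 0 < \<epsilon> \<Longrightarrow> \<exists>N. \<forall>m\<ge>N. \<forall>n\<ge>N. absv \<nu> (s m - s n) \<le> \<epsilon>" for s :: "nat \<Rightarrow> 'k"
  proof -
    have "\<forall>M::real. \<exists>N. \<forall>m\<ge>N. \<forall>n\<ge>N. ereal M \<le> \<nu> (s m - s n)"
      using that[of "exp (- M)" for M] unfolding le_iff by simp
    then obtain l where l: "\<forall>M::real. \<exists>N. \<forall>n\<ge>N. ereal M \<le> \<nu> (s n - l)"
      using c unfolding complete_valuation_def by blast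
    have "\<exists>N. \<forall>n\<ge>N. absv \<nu> (s n - l) \<le> \<epsilon>" if "0 < \<epsilon>" for \<epsilon>
      using l[rule_format, of "- ln \<epsilon>"] that unfolding le_iff[symmetric] by simp
    then show ?thesis by blast
  qed
  show "\<exists>x. poly p x = 0" if "0 < degree p" for p :: "'k poly"
    using ac that unfolding alg_closed_field_def by blast
qed

section \<open>Closed conditions on tropicalizations\<close>

lemma gen_subalg_mono: "x \<in> gen_subalg e fs \<Longrightarrow> set fs \<subseteq> set gs \<Longrightarrow> x \<in> gen_subalg e gs"
proof (induction rule: gen_subalg.induct)
  case (gen i)
  then have "fs ! i \<in> set gs" by auto
  then obtain j where "j < length gs" "gs ! j = fs ! i" by (auto simp: in_set_conv_nth)
  then show ?case by (metis gen_subalg.gen)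
qed (auto intro: gen_subalg.intros)

lemma affine_embeddings_mono: 
  "fs \<in> affine_embeddings e \<Longrightarrow> set fs \<subseteq> set gs \<Longrightarrow> gs \<in> affine_embeddings e"
  unfolding affine_embeddings_def using gen_subalg_mono by blast

lemma TropX_subset: "TropX e \<nu> fs \<subseteq> topspace (Rm (length fs))"
  unfolding TropX_def by (rule closure_of_subset_topspace)

text \<open>The preimage of \<open>C\<close> is closed and contains the tropicalizations of all
  K-points, hence their closure. Every identity or inequality needed at a point of the limit is
  obtained this way.\<close>

lemma TropX_closed_condition:
  assumes "z \<in> TropX e \<nu> fs" and "continuous_map (Rm (length fs)) euclideanreal F" and "closed C"
    and pts: "\<And>p. p \<in> Kpoints e \<Longrightarrow> F (tropv \<nu> (length fs) (\<lambda>i. p (fs ! i))) \<in> C"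
    and v: "valuation \<nu>"
  shows "F z \<in> C"
proof -
  have "closedin (Rm (length fs)) {x \<in> topspace (Rm (length fs)). F x \<in> C}"
    using assms(2,3) by (intro closedin_continuous_map_preimage[of _ euclideanreal]) auto
  moreover have "tropv \<nu> (length fs) (\<lambda>i. p (fs ! i)) \<in> topspace (Rm (length fs))" for p
    using v by (auto simp: topspace_Rm tropv_def valuation_def)
  ultimately have "TropX e \<nu> fs \<subseteq> {x \<in> topspace (Rm (length fs)). F x \<in> C}"
    unfolding TropX_def using pts by (intro closure_of_minimal) auto
  then show ?thesis using assms(1) by blast
qed

lemma neglog_open:
  assumes "openin Rtop U" and "neglog r \<in> U" and "0 \<le> r"
  shows "\<exists>d>0. \<forall>t\<ge>0. \<bar>t - r\<bar> < d \<longrightarrow> neglog t \<in> U"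
proof -
  have "openin (top_of_set {0..}) {t \<in> topspace (top_of_set {0..}). neglog t \<in> U}"
    using continuous_map_neglog assms(1) by (rule openin_continuous_map_preimage)
  then show ?thesis
    using assms(2,3) unfolding openin_euclidean_subtopology_iff by (fastforce simp: dist_real_def)
qed

context
  fixes \<nu> :: "'k::field \<Rightarrow> ereal" and e :: "'k \<Rightarrow> 'a::idom"
  assumes val: "valuation \<nu>"
    and nontriv: "nontrivial_valuation \<nu>"
    and complete: "complete_valuation \<nu>"
    and ac: "alg_closed_field TYPE('k)"
    and hom: "is_ring_hom e"
begin

interpretation na_field "absv \<nu>"
  using na_field_absv[OF val nontriv complete ac] .

text \<open>The place where density enters: a basic neighbourhood restricts each of finitely many
  coordinates, and pulled back along \<open>neglog\<close> these restrictions contain intervals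
  around the values \<open>s (fs ! i)\<close>.\<close>

lemma trop_pi_in_TropX:
  assumes s: "s \<in> Xan e \<nu>" and fs: "fs \<in> affine_embeddings e"
  shows "trop_pi fs s \<in> TropX e \<nu> fs"
  unfolding TropX_def in_closure_of
proof (intro conjI allI impI)
  have s_nonneg: "0 \<le> s f" for f using s by (simp add: Xan_def)
  show "trop_pi fs s \<in> topspace (Rm (length fs))"
    by (auto simp: trop_pi_def topspace_Rm neglog_not_MInf)
  fix T assume T: "trop_pi fs s \<in> T \<and> openin (Rm (length fs)) T"
  then obtain U where U: "\<And>i. i < length fs \<Longrightarrow> openin Rtop (U i)" "trop_pi fs s \<in> PiE {..<length fs} U"
    "PiE {..<length fs} U \<subseteq> T"
    unfolding Rm_def openin_product_topology_alt by (metis (no_types, lifting) lessThan_iff)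
  have "\<forall>i\<in>{..<length fs}. \<exists>d>0. \<forall>t\<ge>0. \<bar>t - s (fs ! i)\<bar> < d \<longrightarrow> neglog t \<in> U i"
  proof
    fix i assume i: "i \<in> {..<length fs}"
    have "neglog (s (fs ! i)) \<in> U i" using U(2) i by (auto simp: trop_pi_def PiE_iff)
    then show "\<exists>d>0. \<forall>t\<ge>0. \<bar>t - s (fs ! i)\<bar> < d \<longrightarrow> neglog t \<in> U i"
      using U(1) i s_nonneg by (intro neglog_open) auto
  qed
  then obtain d where d: "\<And>i. i < length fs \<Longrightarrow> 0 < d i"
    "\<And>i t. i < length fs \<Longrightarrow> 0 \<le> t \<Longrightarrow> \<bar>t - s (fs ! i)\<bar> < d i \<Longrightarrow> neglog t \<in> U i"
    by (metis lessThan_iff)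
  \<comment> \<open>The inserted 1 keeps the minimum defined for the empty list of
    generators.\<close>
  define \<delta> where "\<delta> = Min (insert 1 (d ` {..<length fs}))"
  have "0 < \<delta>" unfolding \<delta>_def using d(1) by (subst Min_gr_iff) auto
  have \<delta>: "\<delta> \<le> d i" if "i < length fs" for i
    unfolding \<delta>_def using that by (intro Min_le) auto
  obtain p where p: "p \<in> Kpoints e" "\<forall>i<length fs. \<bar>absv \<nu> (p (fs ! i)) - s (fs ! i)\<bar> < \<delta>"
    using exists_close_point[OF hom, of s fs \<delta>] s fs \<open>0 < \<delta>\<close>
    unfolding Xan_def affine_embeddings_def by auto
  have "\<nu> (p (fs ! i)) \<in> U i" if "i < length fs" for i
  proof -
    have "neglog (absv \<nu> (p (fs ! i))) \<in> U i"
      using d(2)[OF that, of "absv \<nu> (p (fs ! i))"] p(2) \<delta>[OF that] that by fastforce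
    moreover have "\<nu> (p (fs ! i)) \<noteq> -\<infinity>" using val by (simp add: valuation_def)
    ultimately show ?thesis by (simp add: absv_eq_expneg neglog_expneg)
  qed
  then have "tropv \<nu> (length fs) (\<lambda>i. p (fs ! i)) \<in> PiE {..<length fs} U"
    by (auto simp: tropv_def)
  then have "tropv \<nu> (length fs) (\<lambda>i. p (fs ! i)) \<in> T" using U(3) by blast
  then show "\<exists>y. y \<in> (\<lambda>p. tropv \<nu> (length fs) (\<lambda>i. p (fs ! i))) ` Kpoints e \<and> y \<in> T"
    using p(1) by blast
qed

text \<open>By density for the embedding \<open>\<iota> @ \<kappa>\<close> the equation only has to be checked at K-points;
  in particular it holds without computing the tropicalization of \<open>\<phi>\<close>.\<close>
lemma trop_pi_compatible:
  assumes s: "s \<in> Xan e \<nu>" and emb: "\<iota> \<in> affine_embeddings e" "\<kappa> \<in> affine_embeddings e"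
    and fac: "factors_through e \<iota> \<kappa> \<phi>" and g: "is_trop_map \<nu> (length \<iota>) (length \<kappa>) \<phi> g"
    and vars: "\<And>j. j < length \<kappa> \<Longrightarrow> pvars (\<phi> j) \<subseteq> {..<length \<iota>}"
  shows "trop_pi \<kappa> s = g (trop_pi \<iota> s)"
proof -
  define m n where "m = length \<iota>" and "n = length \<kappa>"
  have gc: "continuous_map (Rm m) (Rm n) g" and gt: "\<And>y. g (tropv \<nu> m y) = tropv \<nu> n (\<lambda>j. peval id y (\<phi> j))"
    using g by (auto simp: is_trop_map_def m_def n_def)
  define r where "r x = (\<lambda>i\<in>{..<m}. x i)" for x :: "nat \<Rightarrow> ereal"
  have r: "continuous_map (Rm (m + n)) (Rm m) r"
    unfolding r_def by (rule continuous_map_select) simp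
  have "\<iota> @ \<kappa> \<in> affine_embeddings e" using emb(1) by (rule affine_embeddings_mono) simp
  then have z: "trop_pi (\<iota> @ \<kappa>) s \<in> TropX e \<nu> (\<iota> @ \<kappa>)" using trop_pi_in_TropX[OF s] by blast
  have rz: "r (trop_pi (\<iota> @ \<kappa>) s) = trop_pi \<iota> s"
    by (auto simp: r_def trop_pi_def m_def nth_append)
  have gin: "g (trop_pi \<iota> s) \<in> topspace (Rm n)"
    using gc subsetD[OF TropX_subset trop_pi_in_TropX[OF s emb(1)]]
    by (auto simp: continuous_map_def m_def)
  have peval_p: "p (peval e (\<lambda>i. \<iota> ! i) P) = peval id (\<lambda>i. p (\<iota> ! i)) P" if "p \<in> Kpoints e" for p P
    using that by (induction P) (auto simp: Kpoints_def)
  have "trop_pi \<kappa> s j = g (trop_pi \<iota> s) j" if j: "j < n" for j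
  proof -
    \<comment> \<open>Equality is phrased as the vanishing of a real difference, since the
      coordinates themselves may both be infinite.\<close>
    have "expneg (trop_pi (\<iota> @ \<kappa>) s (m + j)) - expneg (g (r (trop_pi (\<iota> @ \<kappa>) s)) j) \<in> {0}"
    proof (rule TropX_closed_condition[OF z _ _ _ val])
      show "continuous_map (Rm (length (\<iota> @ \<kappa>))) euclideanreal (\<lambda>x. expneg (x (m + j)) - expneg (g (r x) j))"
        using j continuous_map_compose[OF continuous_map_compose[OF r gc] continuous_map_expneg_coordinate[OF j]]
        by (intro continuous_map_diff continuous_map_expneg_coordinate) (auto simp: o_def m_def n_def)
    next
      fix p assume p: "p \<in> Kpoints e"
      let ?t = "tropv \<nu> (length (\<iota> @ \<kappa>)) (\<lambda>i. p ((\<iota> @ \<kappa>) ! i))"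
      have "r ?t = tropv \<nu> m (\<lambda>i. p (\<iota> ! i))"
        by (auto simp: r_def tropv_def m_def nth_append)
      then have "g (r ?t) j = \<nu> (p (peval e (\<lambda>i. \<iota> ! i) (\<phi> j)))"
        using j by (simp only: gt) (simp add: tropv_def peval_p[OF p])
      also have "\<dots> = \<nu> (p (\<kappa> ! j))" using fac j by (simp add: factors_through_def n_def)
      also have "\<dots> = ?t (m + j)" using j by (simp add: tropv_def m_def n_def)
      finally show "expneg (?t (m + j)) - expneg (g (r ?t) j) \<in> {0}" by simp
    qed simp
    moreover have "trop_pi (\<iota> @ \<kappa>) s (m + j) = trop_pi \<kappa> s j"
      using j by (simp add: trop_pi_def m_def n_def)
    ultimately have "expneg (trop_pi \<kappa> s j) = expneg (g (trop_pi \<iota> s) j)" by (simp add: rz)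
    moreover have "g (trop_pi \<iota> s) j \<noteq> -\<infinity>" using gin j by (auto simp: topspace_Rm PiE_iff)
    moreover have "trop_pi \<kappa> s j \<noteq> -\<infinity>" using j by (simp add: trop_pi_def n_def neglog_not_MInf)
    ultimately show ?thesis by (simp add: expneg_eq_iff)
  qed
  moreover have "trop_pi \<kappa> s j = g (trop_pi \<iota> s) j" if "\<not> j < n" for j
    using gin that by (auto simp: topspace_Rm PiE_iff extensional_def trop_pi_def n_def)
  ultimately show ?thesis by blast
qed

section \<open>Points of the inverse limit and their seminorms\<close>

lemma topspace_lim_trop_top:
  "z \<in> topspace (lim_trop_top e \<nu>) \<longleftrightarrow> z \<in> (\<Pi>\<^sub>E \<iota>\<in>affine_embeddings e. TropX e \<nu> \<iota>) \<and>
    (\<forall>\<iota>\<in>affine_embeddings e. \<forall>\<kappa>\<in>affine_embeddings e. \<forall>\<phi> g.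
      equivariant_morphism (length \<iota>) (length \<kappa>) \<phi> \<and> factors_through e \<iota> \<kappa> \<phi> \<and>
      is_trop_map \<nu> (length \<iota>) (length \<kappa>) \<phi> g \<longrightarrow> z \<kappa> = g (z \<iota>))"
  using TropX_subset[of e \<nu>] unfolding lim_trop_top_def by (simp add: Int_absorb1)

lemma lim_pi_in_lim: 
  assumes "s \<in> Xan e \<nu>"
  shows "lim_pi e s \<in> topspace (lim_trop_top e \<nu>)"
  unfolding topspace_lim_trop_top
proof (intro conjI ballI allI impI)
  show "lim_pi e s \<in> (\<Pi>\<^sub>E \<iota>\<in>affine_embeddings e. TropX e \<nu> \<iota>)"
    using trop_pi_in_TropX[OF assms] by (auto simp: lim_pi_def)
  fix \<iota> \<kappa> \<phi> g
  assume "\<iota> \<in> affine_embeddings e" "\<kappa> \<in> affine_embeddings e" and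
    "equivariant_morphism (length \<iota>) (length \<kappa>) \<phi> \<and> factors_through e \<iota> \<kappa> \<phi> \<and>
      is_trop_map \<nu> (length \<iota>) (length \<kappa>) \<phi> g"
  then show "lim_pi e s \<kappa> = g (lim_pi e s \<iota>)"
    using trop_pi_compatible[OF assms, of \<iota> \<kappa> \<phi> g] by (simp add: lim_pi_def equivariant_morphism_def)
qed

lemma equivariant_select:
  assumes "\<And>j. j < n \<Longrightarrow> \<sigma> j < m"
  shows "equivariant_morphism m n (\<lambda>j. PVar (\<sigma> j) :: 'k pexpr)"
  unfolding equivariant_morphism_def
proof (intro conjI exI[of _ "\<lambda>j i. if i = \<sigma> j then 1 else 0"] allI impI)
  fix t y :: "nat \<Rightarrow> 'k" and j assume "j < n"
  have "(\<Prod>i<m. t i powi (if i = \<sigma> j then 1 else 0)) = (\<Prod>i<m. if i = \<sigma> j then t i else 1)"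
    by (intro prod.cong) auto
  then show "peval id (\<lambda>i. t i * y i) (PVar (\<sigma> j)) =
      (\<Prod>i<m. t i powi (if i = \<sigma> j then 1 else 0)) * peval id y (PVar (\<sigma> j))"
    using assms[OF \<open>j < n\<close>] by (simp add: prod.delta)
qed (use assms in auto)

text \<open>Selections of coordinates are equivariant, so they are transition maps of the system;
  they are the ones used to recover a seminorm from a point of the limit.\<close>

lemma lim_select:
  assumes z: "z \<in> topspace (lim_trop_top e \<nu>)"
    and emb: "\<iota> \<in> affine_embeddings e" "\<kappa> \<in> affine_embeddings e"
    and \<sigma>: "\<And>j. j < length \<kappa> \<Longrightarrow> \<sigma> j < length \<iota> \<and> \<kappa> ! j = \<iota> ! \<sigma> j"
  shows "z \<kappa> = (\<lambda>j\<in>{..<length \<kappa>}. z \<iota> (\<sigma> j))"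
proof -
  let ?g = "\<lambda>x::nat \<Rightarrow> ereal. \<lambda>j\<in>{..<length \<kappa>}. x (\<sigma> j)"
  have "equivariant_morphism (length \<iota>) (length \<kappa>) (\<lambda>j. PVar (\<sigma> j) :: 'k pexpr)"
    using \<sigma> by (intro equivariant_select) auto
  moreover have "factors_through e \<iota> \<kappa> (\<lambda>j. PVar (\<sigma> j))"
    using \<sigma> by (simp add: factors_through_def)
  moreover have "is_trop_map \<nu> (length \<iota>) (length \<kappa>) (\<lambda>j. PVar (\<sigma> j)) ?g"
    unfolding is_trop_map_def
  proof (intro conjI allI)
    show "continuous_map (Rm (length \<iota>)) (Rm (length \<kappa>)) ?g"
      using \<sigma> by (intro continuous_map_select) auto
    show "?g (tropv \<nu> (length \<iota>) y) = tropv \<nu> (length \<kappa>) (\<lambda>j. peval id y (PVar (\<sigma> j)))" for y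
      using \<sigma> by (auto simp: tropv_def restrict_def)
  qed
  ultimately show ?thesis using z emb unfolding topspace_lim_trop_top by blast
qed

lemma lim_in_TropX: "z \<in> topspace (lim_trop_top e \<nu>) \<Longrightarrow> \<iota> \<in> affine_embeddings e \<Longrightarrow> z \<iota> \<in> TropX e \<nu> \<iota>"
  unfolding topspace_lim_trop_top by (auto simp: PiE_iff)

lemma TropX_not_MInf: "x \<in> TropX e \<nu> fs \<Longrightarrow> i < length fs \<Longrightarrow> x i \<noteq> -\<infinity>"
  using TropX_subset[of e \<nu> fs] by (auto simp: topspace_Rm PiE_iff)

text \<open>Both embeddings are selections from \<open>\<iota> @ \<kappa>\<close>, which lists the
  common function twice. The two coordinates agree at K-points and therefore on the whole
  tropicalization.\<close>

lemma lim_coherent: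
  assumes z: "z \<in> topspace (lim_trop_top e \<nu>)"
    and emb: "\<iota> \<in> affine_embeddings e" "\<kappa> \<in> affine_embeddings e"
    and ij: "i < length \<iota>" "j < length \<kappa>" "\<iota> ! i = \<kappa> ! j"
  shows "z \<iota> i = z \<kappa> j"
proof -
  have l: "\<iota> @ \<kappa> \<in> affine_embeddings e" using emb(1) by (rule affine_embeddings_mono) simp
  have "z \<iota> = (\<lambda>j\<in>{..<length \<iota>}. z (\<iota> @ \<kappa>) j)"
    by (rule lim_select[OF z l emb(1)]) (simp add: nth_append)
  then have 1: "z \<iota> i = z (\<iota> @ \<kappa>) i" using ij by simp
  have "z \<kappa> = (\<lambda>j\<in>{..<length \<kappa>}. z (\<iota> @ \<kappa>) (length \<iota> + j))"
    by (rule lim_select[OF z l emb(2)]) simp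
  then have 2: "z \<kappa> j = z (\<iota> @ \<kappa>) (length \<iota> + j)" using ij by simp
  have T: "z (\<iota> @ \<kappa>) \<in> TropX e \<nu> (\<iota> @ \<kappa>)" using z l by (rule lim_in_TropX)
  have "expneg (z (\<iota> @ \<kappa>) i) - expneg (z (\<iota> @ \<kappa>) (length \<iota> + j)) \<in> {0}"
  proof (rule TropX_closed_condition[OF T _ _ _ val])
    show "continuous_map (Rm (length (\<iota> @ \<kappa>))) euclideanreal (\<lambda>x. expneg (x i) - expneg (x (length \<iota> + j)))"
      using ij by (intro continuous_map_diff continuous_map_expneg_coordinate) auto
  qed (use ij in \<open>auto simp: tropv_def nth_append\<close>)
  then show ?thesis
    using 1 2 TropX_not_MInf[OF T] ij by (simp add: expneg_eq_iff)
qed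

text \<open>Prepending \<open>f\<close> to a fixed embedding gives an embedding with
  \<open>f\<close> as coordinate 0. By \<open>lim_coherent\<close> any other embedding containing
  \<open>f\<close> yields the same value.\<close>

definition lim_val :: "'a list \<Rightarrow> ('a list \<Rightarrow> nat \<Rightarrow> ereal) \<Rightarrow> 'a \<Rightarrow> real" where
  "lim_val fs z f = expneg (z (f # fs) 0)"

context
  fixes fs :: "'a list"
  assumes fs: "fs \<in> affine_embeddings e"
begin

lemma extend_embedding: "gs @ fs \<in> affine_embeddings e" "f # fs \<in> affine_embeddings e"
  using fs by (auto intro: affine_embeddings_mono)

lemma lim_val_eq:
  assumes "z \<in> topspace (lim_trop_top e \<nu>)" and "\<kappa> \<in> affine_embeddings e" and "j < length \<kappa>"
  shows "lim_val fs z (\<kappa> ! j) = expneg (z \<kappa> j)"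
  unfolding lim_val_def using lim_coherent[OF assms(1) extend_embedding(2) assms(2), of 0 "\<kappa> ! j" j] assms(3)
  by simp

text \<open>Transfers a closed condition on the values of the functions in \<open>gs\<close> from
  K-points to \<open>lim_val\<close>, by way of the embedding \<open>gs @ fs\<close>. The assumption
  \<open>local\<close> confines \<open>F\<close> to the coordinates belonging to
  \<open>gs\<close>.\<close>

lemma lim_val_condition:
  assumes z: "z \<in> topspace (lim_trop_top e \<nu>)"
    and F: "continuous_map (Rm (length (gs @ fs))) euclideanreal (\<lambda>x. F (\<lambda>i. expneg (x i)))" and C: "closed C"
    and local: "\<And>x y. (\<And>i. i < length gs \<Longrightarrow> x i = y i) \<Longrightarrow> F x = F y"
    and pts: "\<And>p. p \<in> Kpoints e \<Longrightarrow> F (\<lambda>i. absv \<nu> (p (gs ! i))) \<in> C"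
  shows "F (\<lambda>i. lim_val fs z (gs ! i)) \<in> C"
proof -
  have "F (\<lambda>i. expneg (z (gs @ fs) i)) \<in> C"
  proof (rule TropX_closed_condition[OF lim_in_TropX[OF z extend_embedding(1)] F C _ val])
    fix p assume "p \<in> Kpoints e"
    then have "F (\<lambda>i. absv \<nu> (p (gs ! i))) \<in> C" by (rule pts)
    also have "F (\<lambda>i. absv \<nu> (p (gs ! i))) =
        F (\<lambda>i. expneg (tropv \<nu> (length (gs @ fs)) (\<lambda>i. p ((gs @ fs) ! i)) i))"
      by (rule local) (simp add: tropv_def absv_eq_expneg nth_append)
    finally show "F (\<lambda>i. expneg (tropv \<nu> (length (gs @ fs)) (\<lambda>i. p ((gs @ fs) ! i)) i)) \<in> C" .
  qed
  also have "F (\<lambda>i. expneg (z (gs @ fs) i)) = F (\<lambda>i. lim_val fs z (gs ! i))"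
  proof (rule local)
    show "expneg (z (gs @ fs) i) = lim_val fs z (gs ! i)" if "i < length gs" for i
      using lim_val_eq[OF z extend_embedding(1), of i gs] that by (simp add: nth_append)
  qed
  finally show ?thesis .
qed

lemma lim_val_in_Xan:
  assumes z: "z \<in> topspace (lim_trop_top e \<nu>)"
  shows "lim_val fs z \<in> Xan e \<nu>"
proof -
  have const: "lim_val fs z (e c) = absv \<nu> c" for c
    using lim_val_condition[OF z, of "[e c]" "\<lambda>x. x 0" "{absv \<nu> c}"]
    by (simp add: Kpoints_def continuous_map_expneg_coordinate)
  have mult: "lim_val fs z (f * g) = lim_val fs z f * lim_val fs z g" for f g
  proof -
    have "continuous_map (Rm (length ([f * g, f, g] @ fs))) euclideanreal
        (\<lambda>x. expneg (x 0) - expneg (x 1) * expneg (x 2))"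
      by (intro continuous_map_diff continuous_map_real_mult continuous_map_expneg_coordinate) auto
    then show ?thesis
      using lim_val_condition[OF z, of "[f * g, f, g]" "\<lambda>x. x 0 - x 1 * x 2" "{0}"]
      by (simp add: Kpoints_def av_mult)
  qed
  have add: "lim_val fs z (f + g) \<le> lim_val fs z f + lim_val fs z g" for f g
  proof -
    have "continuous_map (Rm (length ([f + g, f, g] @ fs))) euclideanreal
        (\<lambda>x. expneg (x 0) - (expneg (x 1) + expneg (x 2)))"
      by (intro continuous_map_diff continuous_map_add continuous_map_expneg_coordinate) auto
    moreover have "absv \<nu> (a + b) \<le> absv \<nu> a + absv \<nu> b" for a b
      using av_add[of a b] av_nonneg[of a] av_nonneg[of b] by linarith
    ultimately show ?thesis
      using lim_val_condition[OF z, of "[f + g, f, g]" "\<lambda>x. x 0 - (x 1 + x 2)" "{..0}"]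
      by (simp add: Kpoints_def)
  qed
  have "lim_val fs z 0 = 0" "lim_val fs z 1 = 1"
    using const[of 0] const[of 1] hom by (simp_all add: is_ring_hom_def)
  then show ?thesis
    using const mult add by (simp add: Xan_def lim_val_def expneg_nonneg)
qed

lemma lim_pi_lim_val:
  assumes z: "z \<in> topspace (lim_trop_top e \<nu>)"
  shows "lim_pi e (lim_val fs z) = z"
proof
  fix \<iota> show "lim_pi e (lim_val fs z) \<iota> = z \<iota>"
  proof (cases "\<iota> \<in> affine_embeddings e")
    case True
    have T: "z \<iota> \<in> TropX e \<nu> \<iota>" using z True by (rule lim_in_TropX)
    then have "z \<iota> \<in> extensional {..<length \<iota>}"
      using TropX_subset[of e \<nu> \<iota>] by (auto simp: topspace_Rm PiE_iff)
    then have "trop_pi \<iota> (lim_val fs z) = z \<iota>"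
      using lim_val_eq[OF z True] TropX_not_MInf[OF T]
      by (intro extensionalityI[of _ "{..<length \<iota>}"]) (auto simp: trop_pi_def neglog_expneg)
    then show ?thesis using True by (simp add: lim_pi_def)
  next
    case False
    then show ?thesis using z unfolding topspace_lim_trop_top by (simp add: lim_pi_def PiE_iff extensional_def)
  qed
qed

lemma lim_val_lim_pi:
  assumes "s \<in> Xan e \<nu>"
  shows "lim_val fs (lim_pi e s) = s"
proof
  fix f
  have "0 \<le> s f" using assms by (simp add: Xan_def)
  then show "lim_val fs (lim_pi e s) f = s f"
    using extend_embedding(2)[of f] by (simp add: lim_val_def lim_pi_def trop_pi_def expneg_neglog)
qed

lemma topspace_Xan_top: "topspace (Xan_top e \<nu>) = Xan e \<nu>"
  by (simp add: Xan_top_def)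

section \<open>Continuity in both directions\<close>

lemma continuous_map_lim_pi: "continuous_map (Xan_top e \<nu>) (lim_trop_top e \<nu>) (lim_pi e)"
proof -
  have ev: "continuous_map (Xan_top e \<nu>) (top_of_set {0..}) (\<lambda>s. s f)" for f
    unfolding continuous_map_in_subtopology
  proof
    show "continuous_map (Xan_top e \<nu>) euclidean (\<lambda>s. s f)"
      unfolding Xan_top_def
      by (intro continuous_map_from_subtopology continuous_map_product_projection) simp
    show "(\<lambda>s. s f) \<in> topspace (Xan_top e \<nu>) \<rightarrow> {0..}"
      by (auto simp: topspace_Xan_top Xan_def)
  qed
  have nl: "continuous_map (Xan_top e \<nu>) Rtop (\<lambda>s. neglog (s f))" for f
    using continuous_map_compose[OF ev continuous_map_neglog, of f] by (simp add: o_def)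
  have tp: "continuous_map (Xan_top e \<nu>) (Rm (length \<iota>)) (trop_pi \<iota>)" for \<iota>
    unfolding Rm_def continuous_map_componentwise using nl by (auto simp: trop_pi_def)
  have "continuous_map (Xan_top e \<nu>) (subtopology (Rm (length \<iota>)) (TropX e \<nu> \<iota>)) (\<lambda>s. lim_pi e s \<iota>)"
    if "\<iota> \<in> affine_embeddings e" for \<iota>
    unfolding continuous_map_in_subtopology
    using tp[of \<iota>] that trop_pi_in_TropX[of _ \<iota>] by (auto simp: lim_pi_def topspace_Xan_top)
  then have "continuous_map (Xan_top e \<nu>)
      (product_topology (\<lambda>\<iota>. subtopology (Rm (length \<iota>)) (TropX e \<nu> \<iota>)) (affine_embeddings e)) (lim_pi e)"
    unfolding continuous_map_componentwise by (auto simp: lim_pi_def)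
  then show ?thesis
    using lim_pi_in_lim unfolding lim_trop_top_def continuous_map_in_subtopology
    by (auto simp: topspace_Xan_top)
qed

text \<open>Evaluation at \<open>f\<close> reads off one coordinate of the projection to the
  embedding \<open>f # fs\<close>.\<close>

lemma continuous_map_lim_val: "continuous_map (lim_trop_top e \<nu>) (Xan_top e \<nu>) (lim_val fs)"
  unfolding Xan_top_def continuous_map_in_subtopology
proof
  have "continuous_map (lim_trop_top e \<nu>) (Rm (length \<iota>)) (\<lambda>z. z \<iota>)" if "\<iota> \<in> affine_embeddings e" for \<iota>
  proof -
    have "continuous_map (lim_trop_top e \<nu>) (subtopology (Rm (length \<iota>)) (TropX e \<nu> \<iota>)) (\<lambda>z. z \<iota>)"
      unfolding lim_trop_top_def
      using continuous_map_product_projection[OF that, of "\<lambda>\<iota>. subtopology (Rm (length \<iota>)) (TropX e \<nu> \<iota>)"]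
      by (rule continuous_map_from_subtopology)
    then show ?thesis by (simp add: continuous_map_in_subtopology)
  qed
  from continuous_map_compose[OF this[OF extend_embedding(2)] continuous_map_expneg_coordinate]
  show "continuous_map (lim_trop_top e \<nu>) (product_topology (\<lambda>_. euclideanreal) UNIV) (lim_val fs)"
    unfolding continuous_map_componentwise_UNIV by (simp add: lim_val_def o_def)
  show "lim_val fs \<in> topspace (lim_trop_top e \<nu>) \<rightarrow> Xan e \<nu>"
    using lim_val_in_Xan by blast
qed

lemma homeomorphic_map_lim_pi: "homeomorphic_map (Xan_top e \<nu>) (lim_trop_top e \<nu>) (lim_pi e)"
proof -
  have "homeomorphic_maps (Xan_top e \<nu>) (lim_trop_top e \<nu>) (lim_pi e) (lim_val fs)"
    unfolding homeomorphic_maps_def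
    using continuous_map_lim_pi continuous_map_lim_val lim_val_lim_pi lim_pi_lim_val
    by (auto simp: topspace_Xan_top)
  then show ?thesis unfolding homeomorphic_map_maps by blast
qed

end
end

theorem theorem1:
  fixes \<nu> :: "'k::field \<Rightarrow> ereal"
    and e :: "'k \<Rightarrow> 'a::idom"
  assumes "valuation \<nu>"
    and "nontrivial_valuation \<nu>"
    and "complete_valuation \<nu>"
    and "alg_closed_field TYPE('k)"
    and "is_ring_hom e"
    and "\<exists>fs. gen_subalg e fs = UNIV"
  shows "homeomorphic_map (Xan_top e \<nu>) (lim_trop_top e \<nu>) (lim_pi e)"
proof -
  obtain fs where "fs \<in> affine_embeddings e"
    using assms(6) by (auto simp: affine_embeddings_def)
  then show ?thesis by (rule homeomorphic_map_lim_pi[OF assms(1-5)])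
qed

end
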